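(* The $p$-AKC problem is W[1]-hard when parameterized by $b+k+p$, for $k\geq 3$. That is, the parameterized decision problem whose instances are tuples $(G,b,k,p)$ with $k\ge 3$, where $k$ is part of the input and the parameter is $b+k+p$, is W[1]-hard.
   Context: Graphs are finite, simple and undirected. For a graph $G$ and $H\subseteq V(G)$, $G[H]$ denotes the induced subgraph on $H$ and $\deg_{G[H]}(v)$ the degree of $v$ in it. The $p$-AKC problem (decision version of Anchored $k$-Core): the input is an undirected graph $G=(V,E)$ and integers $b,k,p$. The question is whether there exist sets $B\subseteq H\subseteq V$ such that $|B|\leq b$, $|H|\geq p$, and every $v\in H\setminus B$ satisfies $\deg_{G[H]}(v)\geq k$. W[1]-hardness is in the standard sense of parameterized complexity (hardness for W[1] under parameterized (fpt) reductions). *)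

theory Defs
  imports Main
begin

section \<open>Model of computation\<close>

text \<open>
  The machine model is the WHILE language over binary trees (N. D. Jones, \<^emph>\<open>Computability and
  Complexity from a Programming Perspective\<close>).  Every expression node is charged the size of the
  tree it denotes, so that a program cannot build an exponentially large tree by sharing; with
  this cost measure, WHILE programs and Turing machines simulate each other with polynomial
  overhead.
\<close>

datatype tree = Tip | Br tree tree

fun tsize :: "tree \<Rightarrow> nat" where
  "tsize Tip = 1"
| "tsize (Br a b) = 1 + tsize a + tsize b"

datatype expr =
    Var nat
  | Quote tree
  | Pair expr expr
  | Left expr
  | Right expr
  | Eq expr expr

fun left_sub :: "tree \<Rightarrow> tree" where
  "left_sub Tip = Tip"
| "left_sub (Br a b) = a"

fun right_sub :: "tree \<Rightarrow> tree" where
  "right_sub Tip = Tip"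
| "right_sub (Br a b) = b"

type_synonym store = "nat \<Rightarrow> tree"

text \<open>The tree \<open>Tip\<close> plays the role of false, every other tree that of true.\<close>

fun eval_expr :: "expr \<Rightarrow> store \<Rightarrow> tree" where
  "eval_expr (Var x) s = s x"
| "eval_expr (Quote a) s = a"
| "eval_expr (Pair e1 e2) s = Br (eval_expr e1 s) (eval_expr e2 s)"
| "eval_expr (Left e) s = left_sub (eval_expr e s)"
| "eval_expr (Right e) s = right_sub (eval_expr e s)"
| "eval_expr (Eq e1 e2) s = (if eval_expr e1 s = eval_expr e2 s then Br Tip Tip else Tip)"

fun cost :: "expr \<Rightarrow> store \<Rightarrow> nat" where
  "cost (Var x) s = tsize (s x)"
| "cost (Quote a) s = tsize a"
| "cost (Pair e1 e2) s = cost e1 s + cost e2 s + tsize (eval_expr (Pair e1 e2) s)"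
| "cost (Left e) s = cost e s + tsize (eval_expr (Left e) s)"
| "cost (Right e) s = cost e s + tsize (eval_expr (Right e) s)"
| "cost (Eq e1 e2) s = cost e1 s + cost e2 s + tsize (eval_expr (Eq e1 e2) s)"

datatype prog =
    Assign nat expr
  | Seq prog prog
  | Cond expr prog prog
  | While expr prog

text \<open>\<open>exec c s s' t\<close>: started in store \<open>s\<close>, program \<open>c\<close> halts in store \<open>s'\<close> after time \<open>t\<close>.\<close>

inductive exec :: "prog \<Rightarrow> store \<Rightarrow> store \<Rightarrow> nat \<Rightarrow> bool" where
  Assign: "exec (Assign x e) s (s(x := eval_expr e s)) (1 + cost e s)"
| Seq: "exec c1 s s' t1 \<Longrightarrow> exec c2 s' s'' t2 \<Longrightarrow> exec (Seq c1 c2) s s'' (t1 + t2)"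
| CondTrue: "eval_expr e s \<noteq> Tip \<Longrightarrow> exec c1 s s' t
    \<Longrightarrow> exec (Cond e c1 c2) s s' (1 + cost e s + t)"
| CondFalse: "eval_expr e s = Tip \<Longrightarrow> exec c2 s s' t
    \<Longrightarrow> exec (Cond e c1 c2) s s' (1 + cost e s + t)"
| WhileTrue: "eval_expr e s \<noteq> Tip \<Longrightarrow> exec c s s' t1 \<Longrightarrow> exec (While e c) s' s'' t2
    \<Longrightarrow> exec (While e c) s s'' (1 + cost e s + t1 + t2)"
| WhileFalse: "eval_expr e s = Tip \<Longrightarrow> exec (While e c) s s (1 + cost e s)"

inductive_cases AssignE: "exec (Assign x e) s s' t"
inductive_cases SeqE: "exec (Seq c1 c2) s s' t"
inductive_cases CondE: "exec (Cond e c1 c2) s s' t"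
inductive_cases WhileE: "exec (While e c) s s' t"

lemma exec_deterministic:
  "exec c s s1 t1 \<Longrightarrow> exec c s s2 t2 \<Longrightarrow> s1 = s2 \<and> t1 = t2"
proof (induction arbitrary: s2 t2 rule: exec.induct)
  case (Assign x e s)
  from Assign.prems show ?case by (rule AssignE) simp
next
  case (Seq c1 s s' t1 c2 s'' t2 s2 u)
  from Seq.prems show ?case
  proof (rule SeqE)
    fix r u1 u2
    assume "u = u1 + u2" and r: "exec c1 s r u1" "exec c2 r s2 u2"
    then show ?thesis using Seq.IH(1)[OF r(1)] Seq.IH(2)[of s2 u2] by simp
  qed
next
  case (CondTrue e s c1 s' t c2)
  from CondTrue.prems show ?case
    by (rule CondE) (use CondTrue.hyps in \<open>auto dest: CondTrue.IH\<close>)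
next
  case (CondFalse e s c2 s' t c1)
  from CondFalse.prems show ?case
    by (rule CondE) (use CondFalse.hyps in \<open>auto dest: CondFalse.IH\<close>)
next
  case (WhileTrue e s c s' t1 s'' t2 s2 u)
  from WhileTrue.prems show ?case
  proof (rule WhileE)
    fix r u1 u2
    assume "u = Suc (cost e s + u1 + u2)" and r: "exec c s r u1" "exec (While e c) r s2 u2"
    then show ?thesis using WhileTrue.IH(1)[OF r(1)] WhileTrue.IH(2)[of s2 u2] by simp
  qed (use WhileTrue.hyps in simp)
next
  case (WhileFalse e s c)
  from WhileFalse.prems show ?case
    by (rule WhileE) (use WhileFalse.hyps in simp_all)
qed

text \<open>Input and output are passed in variable 0; all other variables are initially \<open>Tip\<close>.\<close>

definition runs :: "prog \<Rightarrow> tree \<Rightarrow> tree \<Rightarrow> nat \<Rightarrow> bool" where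
  "runs c x y t \<longleftrightarrow> (\<exists>s. exec c ((\<lambda>_. Tip)(0 := x)) s t \<and> s 0 = y)"


section \<open>Encodings\<close>

text \<open>Natural numbers are encoded in unary.\<close>

fun enc_nat :: "nat \<Rightarrow> tree" where
  "enc_nat 0 = Tip"
| "enc_nat (Suc n) = Br Tip (enc_nat n)"

fun enc_list :: "('a \<Rightarrow> tree) \<Rightarrow> 'a list \<Rightarrow> tree" where
  "enc_list enc [] = Tip"
| "enc_list enc (x # xs) = Br (enc x) (enc_list enc xs)"

lemma enc_nat_inject [simp]: "enc_nat m = enc_nat n \<longleftrightarrow> m = n"
proof (induction m arbitrary: n)
  case 0
  show ?case by (cases n) auto
next
  case (Suc m)
  then show ?case by (cases n) auto
qed

lemma enc_list_inject:
  assumes "inj enc"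
  shows "enc_list enc xs = enc_list enc ys \<longleftrightarrow> xs = ys"
proof (induction xs arbitrary: ys)
  case Nil
  show ?case by (cases ys) auto
next
  case (Cons x xs)
  then show ?case using assms by (cases ys) (auto dest: injD)
qed


section \<open>Parameterized problems and fpt reductions\<close>

type_synonym param_problem = "(tree \<times> nat) set"

definition computable :: "(nat \<Rightarrow> nat) \<Rightarrow> bool" where
  "computable f \<longleftrightarrow> (\<exists>c. \<forall>n. \<exists>t. runs c (enc_nat n) (enc_nat (f n)) t)"

definition fpt_reducible :: "param_problem \<Rightarrow> param_problem \<Rightarrow> bool" where
  "fpt_reducible A B \<longleftrightarrow>
     (\<exists>c f g d. computable f \<and> computable g \<and>
        (\<forall>x k. \<exists>y l t. runs c (Br x (enc_nat k)) (Br y (enc_nat l)) t \<and>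
           t \<le> f k * tsize x ^ d \<and> l \<le> g k \<and> ((x, k) \<in> A \<longleftrightarrow> (y, l) \<in> B)))"

definition fpt_hard :: "param_problem set \<Rightarrow> param_problem \<Rightarrow> bool" where
  "fpt_hard K B \<longleftrightarrow> (\<forall>A\<in>K. fpt_reducible A B)"


section \<open>Weighted circuit satisfiability and the W-hierarchy\<close>

text \<open>
  A circuit is a list of gates in topological order: the numbers occurring in a gate are the
  positions of the gates it reads.  The last gate is the output.
\<close>

datatype gate = Input | NotG nat | AndG "nat list" | OrG "nat list"

type_synonym circuit = "gate list"

fun gate_args :: "gate \<Rightarrow> nat list" where
  "gate_args Input = []"
| "gate_args (NotG j) = [j]"
| "gate_args (AndG js) = js"
| "gate_args (OrG js) = js"

definition wf_circuit :: "circuit \<Rightarrow> bool" where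
  "wf_circuit C \<longleftrightarrow> C \<noteq> [] \<and>
     (\<forall>i<length C. (\<forall>j\<in>set (gate_args (C ! i)). j < i) \<and>
        (C ! i \<noteq> Input \<longrightarrow> gate_args (C ! i) \<noteq> []))"

definition circuit_inputs :: "circuit \<Rightarrow> nat set" where
  "circuit_inputs C = {i. i < length C \<and> C ! i = Input}"

text \<open>
  \<open>gate_val C X i\<close> is the value of gate \<open>i\<close> when exactly the inputs in \<open>X\<close> are true.  The guards
  \<open>j < i\<close> only ensure termination; they hold in every well-formed circuit.
\<close>

context
  notes conj_cong [fundef_cong]
begin

function gate_val :: "circuit \<Rightarrow> nat set \<Rightarrow> nat \<Rightarrow> bool" where
  "gate_val C X i =
     (case C ! i of
        Input \<Rightarrow> i \<in> X
      | NotG j \<Rightarrow> j < i \<longrightarrow> \<not> gate_val C X j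
      | AndG js \<Rightarrow> (\<forall>j\<in>set js. j < i \<longrightarrow> gate_val C X j)
      | OrG js \<Rightarrow> (\<exists>j\<in>set js. j < i \<and> gate_val C X j))"
  by pat_completeness auto
termination
  by (relation "measure (\<lambda>(C, X, i). i)") auto

end

declare gate_val.simps [simp del]

definition satisfies :: "nat set \<Rightarrow> circuit \<Rightarrow> bool" where
  "satisfies X C \<longleftrightarrow> gate_val C X (length C - 1)"

definition io_path :: "circuit \<Rightarrow> nat list \<Rightarrow> bool" where
  "io_path C p \<longleftrightarrow> p \<noteq> [] \<and> set p \<subseteq> {..<length C} \<and>
     hd p \<in> circuit_inputs C \<and> last p = length C - 1 \<and>
     successively (\<lambda>j i. j \<in> set (gate_args (C ! i))) p"

definition large_gate :: "gate \<Rightarrow> bool" where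
  "large_gate g \<longleftrightarrow> length (gate_args g) > 2"

definition depth :: "circuit \<Rightarrow> nat" where
  "depth C = Max ((\<lambda>p. length p - 1) ` {p. io_path C p})"

definition weft :: "circuit \<Rightarrow> nat" where
  "weft C = Max ((\<lambda>p. length (filter (\<lambda>i. large_gate (C ! i)) p)) ` {p. io_path C p})"

fun enc_gate :: "gate \<Rightarrow> tree" where
  "enc_gate Input = Br (enc_nat 0) Tip"
| "enc_gate (NotG j) = Br (enc_nat 1) (enc_nat j)"
| "enc_gate (AndG js) = Br (enc_nat 2) (enc_list enc_nat js)"
| "enc_gate (OrG js) = Br (enc_nat 3) (enc_list enc_nat js)"

definition enc_circuit :: "circuit \<Rightarrow> tree" where
  "enc_circuit = enc_list enc_gate"

definition WCS :: "nat \<Rightarrow> nat \<Rightarrow> param_problem" where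
  "WCS t d = {(enc_circuit C, k) | C k.
     wf_circuit C \<and> weft C \<le> t \<and> depth C \<le> d \<and>
     (\<exists>X \<subseteq> circuit_inputs C. card X = k \<and> satisfies X C)}"

definition W :: "nat \<Rightarrow> param_problem set" where
  "W t = {A. \<exists>d. fpt_reducible A (WCS t d)}"


section \<open>The anchored k-core problem\<close>

definition simple_graph :: "'a set \<Rightarrow> 'a set set \<Rightarrow> bool" where
  "simple_graph V E \<longleftrightarrow> finite V \<and> (\<forall>e\<in>E. e \<subseteq> V \<and> card e = 2)"

definition induced_edges :: "'a set set \<Rightarrow> 'a set \<Rightarrow> 'a set set" where
  "induced_edges E H = {e \<in> E. e \<subseteq> H}"

definition degree :: "'a set set \<Rightarrow> 'a \<Rightarrow> nat" where
  "degree E v = card {e \<in> E. v \<in> e}"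

definition anchored_core :: "'a set \<Rightarrow> 'a set set \<Rightarrow> nat \<Rightarrow> nat \<Rightarrow> nat \<Rightarrow> bool" where
  "anchored_core V E b k p \<longleftrightarrow>
     (\<exists>B H. B \<subseteq> H \<and> H \<subseteq> V \<and> card B \<le> b \<and> card H \<ge> p \<and>
        (\<forall>v\<in>H - B. degree (induced_edges E H) v \<ge> k))"

text \<open>A graph on the vertices \<open>0, \<dots>, n - 1\<close> is given by \<open>n\<close> and a list of its edges.\<close>

definition edges_of :: "(nat \<times> nat) list \<Rightarrow> nat set set" where
  "edges_of es = {{u, v} | u v. (u, v) \<in> set es}"

definition enc_edge :: "nat \<times> nat \<Rightarrow> tree" where
  "enc_edge e = Br (enc_nat (fst e)) (enc_nat (snd e))"

definition enc_akc :: "nat \<Rightarrow> (nat \<times> nat) list \<Rightarrow> nat \<Rightarrow> nat \<Rightarrow> nat \<Rightarrow> tree" where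
  "enc_akc n es b k p =
     Br (Br (enc_nat n) (enc_list enc_edge es)) (enc_list enc_nat [b, k, p])"

definition pAKC :: param_problem where
  "pAKC = {(enc_akc n es b k p, b + k + p) | n es b k p.
     k \<ge> 3 \<and> simple_graph {..<n} (edges_of es) \<and> anchored_core {..<n} (edges_of es) b k p}"

lemma inj_enc_gate: "inj enc_gate"
proof (rule injI)
  fix g h
  assume "enc_gate g = enc_gate h"
  moreover have "inj enc_nat" by (rule injI) simp
  ultimately show "g = h"
    by (cases g; cases h) (simp_all add: enc_list_inject numeral_2_eq_2 numeral_3_eq_3)
qed

lemma enc_circuit_inject: "enc_circuit C = enc_circuit D \<longleftrightarrow> C = D"
  by (simp add: enc_circuit_def enc_list_inject inj_enc_gate)

lemma enc_akc_inject:
  "enc_akc n es b k p = enc_akc n' es' b' k' p' \<longleftrightarrow>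
     n = n' \<and> es = es' \<and> b = b' \<and> k = k' \<and> p = p'"
proof -
  have "inj enc_edge"
    by (rule injI) (auto simp: enc_edge_def prod_eq_iff)
  then show ?thesis
    by (auto simp: enc_akc_def enc_list_inject)
qed

end

theory Submission
  imports Defs
begin

text \<open>
  A circuit of weft one and depth \<open>d\<close> is a boolean combination of boundedly many large gates over
  gates that depend on boundedly many inputs. So it, and its negation, is a disjunction of
  polynomially many conjunctive normal forms whose clauses have width at most \<open>2 ^ d\<close>. An assignment
  \<open>X\<close> of weight \<open>k\<close> satisfies such a normal form iff for every small subset \<open>S\<close> of \<open>X\<close> the clauses whose
  negated variables all lie in \<open>S\<close> are hit by \<open>X\<close>. A bounded search tree lists the candidates for the
  part of \<open>X\<close> that does this for a given \<open>S\<close>; a choice of mutually consistent candidates for all \<open>S\<close>, where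
  \<open>S\<close> is given by positions in an enumeration of \<open>X\<close>, is a clique in a compatibility graph.

  A clique of size \<open>q\<close> becomes an anchored core as follows. Every pair of adjacent or equal
  vertices gets a gadget that costs one anchor and adds a fixed number of vertices to the core, but
  only if both vertices of the pair are in it. The degree bound is so large that the original vertices
  have to be anchored themselves. The budget \<open>q + q\<^sup>2\<close> and the target force \<open>q\<^sup>2\<close> complete gadgets on
  \<open>q\<close> vertices.

  Running times: polynomial-time functions on encodable types are closed under the usual
  list operations, and a fold is harmless if every step increases the size of the accumulator by
  an amount bounded independently of the accumulator. The only part of the reduction that is not
  polynomial is a list of all branches of the search tree, which depends on the parameter alone.
\<close>

section \<open>Subroutine calls\<close>

text \<open>\<open>W 1\<close> is defined by circuits, so hardness of the clique problem is not at
  hand and is obtained on the way. The obstacle is that clauses mix signs: whether a clause fails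
  depends on all chosen variables at once, as any of them could be the unnegated one that saves it,
  whereas the edges of a graph test pairs. The size of the clique must depend on the parameter only,
  so its nodes cannot range over clauses either. They range over the \<open>(k + 1) ^ D\<close>
  tuples of positions: a node guesses the values at \<open>D\<close> positions together with further
  values that satisfy every clause triggered by the first ones. The choice among the normal forms is
  itself a variable, at position 0, that guards the clauses; hence \<open>D = 2 ^ d + 1\<close>. In
  the gadget construction, ordered pairs with the diagonal make the count tight: \<open>x\<close>
  vertices carry at most \<open>x * x\<close> gadgets, which leaves only \<open>x = q\<close> under
  budget and target. The definition of \<open>fpt_reducible\<close> wants a computable factor in the
  time bound, so for the search tree the running time, not just the result, is shown to be
  computably bounded.\<close>

fun shift_expr :: "nat \<Rightarrow> expr \<Rightarrow> expr" where
  "shift_expr m (Var x) = Var (x + m)"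
| "shift_expr m (Quote a) = Quote a"
| "shift_expr m (Pair e1 e2) = Pair (shift_expr m e1) (shift_expr m e2)"
| "shift_expr m (Left e) = Left (shift_expr m e)"
| "shift_expr m (Right e) = Right (shift_expr m e)"
| "shift_expr m (Eq e1 e2) = Eq (shift_expr m e1) (shift_expr m e2)"

fun shift_prog :: "nat \<Rightarrow> prog \<Rightarrow> prog" where
  "shift_prog m (Assign x e) = Assign (x + m) (shift_expr m e)"
| "shift_prog m (Seq c1 c2) = Seq (shift_prog m c1) (shift_prog m c2)"
| "shift_prog m (Cond e c1 c2) = Cond (shift_expr m e) (shift_prog m c1) (shift_prog m c2)"
| "shift_prog m (While e c) = While (shift_expr m e) (shift_prog m c)"

fun expr_bound :: "expr \<Rightarrow> nat" where
  "expr_bound (Var x) = Suc x"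
| "expr_bound (Quote a) = 0"
| "expr_bound (Pair e1 e2) = max (expr_bound e1) (expr_bound e2)"
| "expr_bound (Left e) = expr_bound e"
| "expr_bound (Right e) = expr_bound e"
| "expr_bound (Eq e1 e2) = max (expr_bound e1) (expr_bound e2)"

fun prog_bound :: "prog \<Rightarrow> nat" where
  "prog_bound (Assign x e) = max (Suc x) (expr_bound e)"
| "prog_bound (Seq c1 c2) = max (prog_bound c1) (prog_bound c2)"
| "prog_bound (Cond e c1 c2) = max (expr_bound e) (max (prog_bound c1) (prog_bound c2))"
| "prog_bound (While e c) = max (expr_bound e) (prog_bound c)"

lemma eval_shift_expr:
  assumes "expr_bound e \<le> N" "\<forall>i<N. s2 (i + m) = s i"
  shows "eval_expr (shift_expr m e) s2 = eval_expr e s"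
  using assms by (induction e) auto

lemma cost_shift_expr:
  assumes "expr_bound e \<le> N" "\<forall>i<N. s2 (i + m) = s i"
  shows "cost (shift_expr m e) s2 = cost e s"
  using assms
proof (induction e)
  case (Pair e1 e2)
  then show ?case using eval_shift_expr[of e1 N s2 m s] eval_shift_expr[of e2 N s2 m s] by simp
next
  case (Left e)
  then show ?case using eval_shift_expr[of e N s2 m s] by simp
next
  case (Right e)
  then show ?case using eval_shift_expr[of e N s2 m s] by simp
next
  case (Eq e1 e2)
  then show ?case using eval_shift_expr[of e1 N s2 m s] eval_shift_expr[of e2 N s2 m s] by simp
qed auto

text \<open>A program touches no variable beyond its bound, so agreement on a window of
  \<open>N\<close> variables is enough, whatever the rest of the store contains. That the variables
  below \<open>m\<close> survive makes them usable as the caller's frame.\<close>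

lemma exec_shift_prog:
  assumes "exec c s s' t" "prog_bound c \<le> N" "\<forall>i<N. s2 (i + m) = s i"
  shows "\<exists>s2'. exec (shift_prog m c) s2 s2' t \<and> (\<forall>i<N. s2' (i + m) = s' i) \<and> (\<forall>v<m. s2' v = s2 v)"
  using assms
proof (induction arbitrary: s2 rule: exec.induct)
  case (Assign x e s)
  have "exec (shift_prog m (Assign x e)) s2 (s2(x + m := eval_expr e s)) (1 + cost e s)"
    using exec.Assign[of "x + m" "shift_expr m e" s2] Assign.prems
    by (simp add: eval_shift_expr[of e N s2 m s] cost_shift_expr[of e N s2 m s])
  then show ?case using Assign.prems by (intro exI conjI) auto
next
  case (Seq c1 s s' t1 c2 s'' t2)
  obtain r where r: "exec (shift_prog m c1) s2 r t1" "\<forall>i<N. r (i + m) = s' i" "\<forall>v<m. r v = s2 v"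
    using Seq.IH(1)[of s2] Seq.prems by auto
  obtain r' where r': "exec (shift_prog m c2) r r' t2" "\<forall>i<N. r' (i + m) = s'' i" "\<forall>v<m. r' v = r v"
    using Seq.IH(2)[of r] Seq.prems r by auto
  show ?case using exec.Seq[OF r(1) r'(1)] r r' by (intro exI[of _ r']) auto
next
  case (CondTrue e s c1 s' t c2)
  obtain r where r: "exec (shift_prog m c1) s2 r t" "\<forall>i<N. r (i + m) = s' i" "\<forall>v<m. r v = s2 v"
    using CondTrue.IH[of s2] CondTrue.prems by auto
  have "eval_expr (shift_expr m e) s2 \<noteq> Tip"
    using eval_shift_expr[of e N s2 m s] CondTrue by simp
  from exec.CondTrue[OF this r(1), of "shift_prog m c2"] show ?case
    using r CondTrue.prems cost_shift_expr[of e N s2 m s] by (intro exI[of _ r]) auto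
next
  case (CondFalse e s c2 s' t c1)
  obtain r where r: "exec (shift_prog m c2) s2 r t" "\<forall>i<N. r (i + m) = s' i" "\<forall>v<m. r v = s2 v"
    using CondFalse.IH[of s2] CondFalse.prems by auto
  have "eval_expr (shift_expr m e) s2 = Tip"
    using eval_shift_expr[of e N s2 m s] CondFalse by simp
  from exec.CondFalse[OF this r(1), of "shift_prog m c1"] show ?case
    using r CondFalse.prems cost_shift_expr[of e N s2 m s] by (intro exI[of _ r]) auto
next
  case (WhileTrue e s c s' t1 s'' t2)
  obtain r where r: "exec (shift_prog m c) s2 r t1" "\<forall>i<N. r (i + m) = s' i" "\<forall>v<m. r v = s2 v"
    using WhileTrue.IH(1)[of s2] WhileTrue.prems by auto
  obtain r' where r': "exec (shift_prog m (While e c)) r r' t2" "\<forall>i<N. r' (i + m) = s'' i" "\<forall>v<m. r' v = r v"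
    using WhileTrue.IH(2)[of r] WhileTrue.prems r by auto
  have "eval_expr (shift_expr m e) s2 \<noteq> Tip"
    using eval_shift_expr[of e N s2 m s] WhileTrue by simp
  from exec.WhileTrue[OF this r(1)] r'(1) have "exec (shift_prog m (While e c)) s2 r'
     (1 + cost (shift_expr m e) s2 + t1 + t2)" by simp
  then show ?case
    using r r' WhileTrue.prems cost_shift_expr[of e N s2 m s] by (intro exI[of _ r']) auto
next
  case (WhileFalse e s c)
  have "eval_expr (shift_expr m e) s2 = Tip"
    using eval_shift_expr[of e N s2 m s] WhileFalse by simp
  from exec.WhileFalse[OF this, of "shift_prog m c"] show ?case
    using WhileFalse.prems cost_shift_expr[of e N s2 m s] by (intro exI[of _ s2]) auto
qed

lemma exec_AssignI:
  "s' = s(x := eval_expr e s) \<Longrightarrow> t = 1 + cost e s \<Longrightarrow> exec (Assign x e) s s' t"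
  using exec.Assign by simp

fun clear :: "nat \<Rightarrow> nat \<Rightarrow> prog" where
  "clear m 0 = Assign (Suc m) (Quote Tip)"
| "clear m (Suc n) = Seq (clear m n) (Assign (m + n + 2) (Quote Tip))"

lemma exec_clear:
  "exec (clear m n) s (\<lambda>v. if m < v \<and> v \<le> m + n + 1 then Tip else s v) (2 * (n + 1))"
proof (induction n)
  case 0
  show ?case unfolding clear.simps by (rule exec_AssignI) auto
next
  case (Suc n)
  let ?r = "\<lambda>v. if m < v \<and> v \<le> m + n + 1 then Tip else s v"
  have "?r(m + n + 2 := Tip) = (\<lambda>v. if m < v \<and> v \<le> m + Suc n + 1 then Tip else s v)"
    by auto
  then show ?case
    using exec.Seq[OF Suc exec.Assign[of "m + n + 2" "Quote Tip"]] by simp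
qed

text \<open>A program expects \<open>Tip\<close> in all variables but its argument, so leftovers of
  earlier calls are wiped first; the time for this depends on the program only.\<close>

definition call :: "nat \<Rightarrow> prog \<Rightarrow> prog" where
  "call m c = Seq (clear m (prog_bound c)) (shift_prog m c)"

text \<open>Variables below \<open>m\<close> form the caller's frame; argument and result are in variable \<open>m\<close>.\<close>

lemma exec_call:
  assumes "runs c x y t" "s m = x"
  shows "\<exists>s'. exec (call m c) s s' (2 * (prog_bound c + 1) + t) \<and> s' m = y \<and> (\<forall>v<m. s' v = s v)"
proof -
  from assms(1) obtain s1 where s1: "exec c ((\<lambda>_. Tip)(0 := x)) s1 t" "s1 0 = y"
    by (auto simp: runs_def)
  let ?r = "\<lambda>v. if m < v \<and> v \<le> m + prog_bound c + 1 then Tip else s v"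
  have "\<forall>i<Suc (prog_bound c). ?r (i + m) = ((\<lambda>_. Tip)(0 := x)) i"
    using assms(2) by auto
  from exec_shift_prog[OF s1(1) _ this] obtain s2 where
    "exec (shift_prog m c) ?r s2 t" "\<forall>i<Suc (prog_bound c). s2 (i + m) = s1 i" "\<forall>v<m. s2 v = ?r v"
    by auto
  then show ?thesis
    using exec.Seq[OF exec_clear[of m "prog_bound c" s]] s1(2)
    by (intro exI[of _ s2]) (auto simp: call_def)
qed

section \<open>Size of values against running time\<close>

lemma tsize_pos [simp]: "0 < tsize t"
  by (cases t) auto

lemma tsize_eval_le_cost: "tsize (eval_expr e s) \<le> cost e s"
  by (cases e) auto

text \<open>An expression costs at least the size of its value, so an assignment cannot create a
  tree larger than the time it takes. This turns every time bound into a bound on the size of the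
  output.\<close>

lemma exec_size:
  "exec c s s' t \<Longrightarrow> \<forall>v. tsize (s v) \<le> M \<Longrightarrow> tsize (s' v) \<le> M + t"
proof (induction arbitrary: M v rule: exec.induct)
  case (Assign x e s)
  then show ?case using tsize_eval_le_cost[of e s] by (auto intro: le_SucI trans_le_add1 trans_le_add2)
next
  case (Seq c1 s s' t1 c2 s'' t2)
  have "tsize (s'' v) \<le> (M + t1) + t2" by (rule Seq.IH(2)) (use Seq in blast)
  then show ?case by simp
next
  case (CondTrue e s c1 s' t c2)
  have "tsize (s' v) \<le> M + t" by (rule CondTrue.IH) (use CondTrue in blast)
  then show ?case by simp
next
  case (CondFalse e s c2 s' t c1)
  have "tsize (s' v) \<le> M + t" by (rule CondFalse.IH) (use CondFalse in blast)
  then show ?case by simp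
next
  case (WhileTrue e s c s' t1 s'' t2)
  have "tsize (s'' v) \<le> (M + t1) + t2" by (rule WhileTrue.IH(2)) (use WhileTrue in blast)
  then show ?case by simp
next
  case (WhileFalse e s c)
  then have "tsize (s v) \<le> M" by blast
  then show ?case by linarith
qed

lemma runs_size: "runs c x y t \<Longrightarrow> tsize y \<le> tsize x + t"
proof -
  assume "runs c x y t"
  then obtain s where s: "exec c ((\<lambda>_. Tip)(0 := x)) s t" "s 0 = y" by (auto simp: runs_def)
  have "\<forall>v. tsize (((\<lambda>_. Tip)(0 := x)) v) \<le> tsize x"
    using tsize_pos[of x] by (auto simp: Suc_le_eq simp del: tsize_pos)
  from exec_size[OF s(1) this, of 0] s(2) show ?thesis by simp
qed

section \<open>Encodable types and functions computed by programs\<close>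

text \<open>The instances are chosen to coincide with \<open>enc_nat\<close>,
  \<open>enc_list\<close> and \<open>enc_gate\<close>; trees encode themselves, so the input format
  \<open>Br x (enc_nat k)\<close> of a reduction is \<open>enc (x, k)\<close>.\<close>

class encodable =
  fixes enc :: "'a \<Rightarrow> tree"
  assumes inj_enc: "inj enc"

lemma enc_inject [simp]: "enc (x::'a::encodable) = enc y \<longleftrightarrow> x = y"
  using inj_enc by (auto dest: injD)

instantiation tree :: encodable
begin
definition "enc (t::tree) = t"
instance by standard (simp add: enc_tree_def inj_def)
end

instantiation nat :: encodable
begin
definition "enc (n::nat) = enc_nat n"
instance by standard (simp add: enc_nat_def inj_def)
end

instantiation bool :: encodable
begin
definition "enc (b::bool) = (if b then Br Tip Tip else Tip)"
instance by standard (simp add: enc_bool_def inj_def)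
end

instantiation unit :: encodable
begin
definition "enc (u::unit) = Tip"
instance by standard (simp add: inj_def)
end

instantiation prod :: (encodable, encodable) encodable
begin
definition "enc p = Br (enc (fst p)) (enc (snd p))"
instance by standard (auto simp add: enc_prod_def inj_def)
end

instantiation list :: (encodable) encodable
begin
definition "enc xs = enc_list enc xs"
instance by standard (simp add: enc_list_def inj_def enc_list_inject inj_enc[unfolded inj_def])
end

instantiation gate :: encodable
begin
definition "enc g = enc_gate g"
instance by standard (simp add: enc_gate_def inj_enc_gate[unfolded inj_def] inj_def)
end

lemma enc_Pair [simp]: "enc (x, y) = Br (enc x) (enc y)"
  by (simp add: enc_prod_def)

lemma enc_Nil [simp]: "enc [] = Tip"
  by (simp add: enc_list_def)

lemma enc_Cons [simp]: "enc (x # xs) = Br (enc x) (enc xs)"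
  by (simp add: enc_list_def)

lemma enc_0 [simp]: "enc (0::nat) = Tip"
  by (simp add: enc_nat_def)

lemma enc_Suc [simp]: "enc (Suc n) = Br Tip (enc n)"
  by (simp add: enc_nat_def)

definition sz :: "'a::encodable \<Rightarrow> nat" where
  "sz x = tsize (enc x)"

lemma sz_pos [simp]: "0 < sz x"
  by (simp add: sz_def)

lemma sz_ge_1: "1 \<le> sz x"
  using sz_pos[of x] by linarith

lemma sz_Pair [simp]: "sz (x, y) = 1 + sz x + sz y"
  by (simp add: sz_def)

lemma sz_Nil [simp]: "sz [] = 1"
  by (simp add: sz_def)

lemma sz_Cons [simp]: "sz (x # xs) = 1 + sz x + sz xs"
  by (simp add: sz_def)

lemma sz_nat [simp]: "sz (n::nat) = 2 * n + 1"
  by (induction n) (simp_all add: sz_def)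

lemma sz_bool_le: "sz (b::bool) \<le> 3"
  by (simp add: sz_def enc_bool_def)

lemma sz_unit [simp]: "sz (u::unit) = 1"
  by (simp add: sz_def enc_unit_def)

section \<open>Program constructions with explicit time bounds\<close>

definition computes :: "prog \<Rightarrow> ('a::encodable \<Rightarrow> 'b::encodable) \<Rightarrow> ('a \<Rightarrow> nat) \<Rightarrow> bool" where
  "computes c f T \<longleftrightarrow> (\<forall>a. \<exists>t\<le>T a. runs c (enc a) (enc (f a)) t)"

lemma computes_mono: "computes c f T \<Longrightarrow> (\<And>a. T a \<le> T' a) \<Longrightarrow> computes c f T'"
  unfolding computes_def by (meson order_trans)

lemma computes_size: "computes c f T \<Longrightarrow> sz (f a) \<le> sz a + T a"
  unfolding computes_def sz_def using runs_size by (meson add_left_mono order_trans)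

lemma computes_Assign:
  assumes "\<And>a. eval_expr e ((\<lambda>_. Tip)(0 := enc a)) = enc (f a)"
    and "\<And>a. 1 + cost e ((\<lambda>_. Tip)(0 := enc a)) \<le> T a"
  shows "computes (Assign 0 e) f T"
  unfolding computes_def runs_def
proof
  fix a
  show "\<exists>t\<le>T a. \<exists>s. exec (Assign 0 e) ((\<lambda>_. Tip)(0 := enc a)) s t \<and> s 0 = enc (f a)"
    using exec.Assign[of 0 e "(\<lambda>_. Tip)(0 := enc a)"] assms by fastforce
qed

lemma exec_call_computes:
  assumes "computes c f T" "s m = enc a"
  shows "\<exists>s' t. exec (call m c) s s' t \<and> t \<le> 2 * (prog_bound c + 1) + T a
    \<and> s' m = enc (f a) \<and> (\<forall>v<m. s' v = s v)"
proof -
  from assms(1) obtain t where t: "t \<le> T a" "runs c (enc a) (enc (f a)) t"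
    by (auto simp: computes_def)
  from exec_call[of c "enc a" "enc (f a)" t s m, OF t(2) assms(2)] t(1) show ?thesis by (meson add_left_mono)
qed

lemma runsI:
  "exec c ((\<lambda>_. Tip)(0 := x)) s t \<Longrightarrow> t \<le> B \<Longrightarrow> s 0 = y \<Longrightarrow> \<exists>t\<le>B. runs c x y t"
  by (auto simp: runs_def)

text \<open>\<open>Tf\<close> and \<open>Tg\<close> are arbitrary here, so that one construction
  serves polynomial, computable and fixed-parameter time bounds. The constant \<open>K\<close>
  absorbs the cost of clearing variables and of copying.\<close>

lemma computes_comp:
  assumes "computes cf f Tf" "computes cg g Tg"
  shows "\<exists>c K. computes c (\<lambda>x. g (f x)) (\<lambda>x. K + K * (sz x + sz (g (f x))) + Tf x + Tg (f x))"
proof -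
  let ?c = "Seq (Assign 1 (Var 0)) (Seq (call 1 cf) (Seq (call 1 cg) (Assign 0 (Var 1))))"
  define K where "K = 2 * (prog_bound cf + 1) + 2 * (prog_bound cg + 1) + 2"
  have "\<exists>t\<le>K + K * (sz a + sz (g (f a))) + Tf a + Tg (f a). runs ?c (enc a) (enc (g (f a))) t" for a
  proof -
    let ?s0 = "(\<lambda>_. Tip)(0 := enc a) :: store"
    let ?s1 = "?s0(1 := enc a)"
    have 1: "exec (Assign 1 (Var 0)) ?s0 ?s1 (1 + sz a)"
      by (rule exec_AssignI) (simp_all add: sz_def)
    obtain s2 t2 where 2: "exec (call 1 cf) ?s1 s2 t2" "t2 \<le> 2 * (prog_bound cf + 1) + Tf a"
      "s2 1 = enc (f a)"
      using exec_call_computes[OF assms(1), of ?s1 1 a] by auto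
    obtain s3 t3 where 3: "exec (call 1 cg) s2 s3 t3" "t3 \<le> 2 * (prog_bound cg + 1) + Tg (f a)"
      "s3 1 = enc (g (f a))"
      using exec_call_computes[OF assms(2), of s2 1 "f a"] 2 by auto
    have 4: "exec (Assign 0 (Var 1)) s3 (s3(0 := enc (g (f a)))) (1 + sz (g (f a)))"
      by (rule exec_AssignI) (use 3 in \<open>simp_all add: sz_def\<close>)
    have "exec ?c ?s0 (s3(0 := enc (g (f a)))) ((1 + sz a) + (t2 + (t3 + (1 + sz (g (f a))))))"
      by (intro exec.Seq[OF 1] exec.Seq[OF 2(1)] exec.Seq[OF 3(1)] 4)
    moreover have "1 * (sz a + sz (g (f a))) \<le> K * (sz a + sz (g (f a)))"
      by (rule mult_le_mono1) (simp add: K_def)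
    then have "(1 + sz a) + (t2 + (t3 + (1 + sz (g (f a))))) \<le>
      K + K * (sz a + sz (g (f a))) + Tf a + Tg (f a)"
      using 2(2) 3(2) using eq_refl[OF K_def[symmetric]] by (simp add: distrib_left)
    ultimately show ?thesis by (rule runsI) simp
  qed
  then show ?thesis unfolding computes_def by blast
qed

lemma computes_Pair:
  assumes "computes cf f Tf" "computes cg g Tg"
  shows "\<exists>c K. computes c (\<lambda>x. (f x, g x)) (\<lambda>x. K + K * (sz x + sz (f x) + sz (g x)) + Tf x + Tg x)"
proof -
  \<comment> \<open>Calls work from variable 3 upwards, which preserves the input in variable 0 and
    the first result in variable 1.\<close>
  let ?c = "Seq (Assign 3 (Var 0)) (Seq (call 3 cf) (Seq (Assign 1 (Var 3)) (Seq (Assign 3 (Var 0))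
    (Seq (call 3 cg) (Assign 0 (Pair (Var 1) (Var 3)))))))"
  define K where "K = 2 * (prog_bound cf + 1) + 2 * (prog_bound cg + 1) + 8"
  have "\<exists>t\<le>K + K * (sz a + sz (f a) + sz (g a)) + Tf a + Tg a. runs ?c (enc a) (enc (f a, g a)) t" for a
  proof -
    let ?s0 = "(\<lambda>_. Tip)(0 := enc a) :: store"
    let ?s1 = "?s0(3 := enc a)"
    have 1: "exec (Assign 3 (Var 0)) ?s0 ?s1 (1 + sz a)"
      by (rule exec_AssignI) (simp_all add: sz_def)
    obtain s2 t2 where 2: "exec (call 3 cf) ?s1 s2 t2" "t2 \<le> 2 * (prog_bound cf + 1) + Tf a"
      "s2 3 = enc (f a)" "s2 0 = enc a"
      using exec_call_computes[OF assms(1), of ?s1 3 a] by auto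
    have 3: "exec (Assign 1 (Var 3)) s2 (s2(1 := enc (f a))) (1 + sz (f a))"
      by (rule exec_AssignI) (use 2 in \<open>simp_all add: sz_def\<close>)
    let ?s4 = "s2(1 := enc (f a), 3 := enc a)"
    have 4: "exec (Assign 3 (Var 0)) (s2(1 := enc (f a))) ?s4 (1 + sz a)"
      by (rule exec_AssignI) (use 2 in \<open>simp_all add: sz_def\<close>)
    obtain s5 t5 where 5: "exec (call 3 cg) ?s4 s5 t5" "t5 \<le> 2 * (prog_bound cg + 1) + Tg a"
      "s5 3 = enc (g a)" "s5 1 = enc (f a)"
      using exec_call_computes[OF assms(2), of ?s4 3 a] by auto
    have 6: "exec (Assign 0 (Pair (Var 1) (Var 3))) s5 (s5(0 := enc (f a, g a))) (2 + 2 * sz (f a) + 2 * sz (g a))"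
      by (rule exec_AssignI) (use 5 in \<open>simp_all add: sz_def\<close>)
    have "exec ?c ?s0 (s5(0 := enc (f a, g a))) ((1 + sz a) + (t2 + ((1 + sz (f a)) + ((1 + sz a) +
      (t5 + (2 + 2 * sz (f a) + 2 * sz (g a)))))))"
      by (intro exec.Seq[OF 1] exec.Seq[OF 2(1)] exec.Seq[OF 3(1)] exec.Seq[OF 4(1)] exec.Seq[OF 5(1)] 6)
    moreover have "4 * (sz a + sz (f a) + sz (g a)) \<le> K * (sz a + sz (f a) + sz (g a))"
      by (rule mult_le_mono1) (simp add: K_def)
    then have "(1 + sz a) + (t2 + ((1 + sz (f a)) + ((1 + sz a) +
      (t5 + (2 + 2 * sz (f a) + 2 * sz (g a)))))) \<le> K + K * (sz a + sz (f a) + sz (g a)) + Tf a + Tg a"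
      using 2(2) 5(2) using eq_refl[OF K_def[symmetric]] by (simp add: distrib_left)
    ultimately show ?thesis by (rule runsI) simp
  qed
  then show ?thesis unfolding computes_def by blast
qed

lemma computes_If:
  assumes "computes cb b Tb" "computes cf f Tf" "computes cg g Tg"
  shows "\<exists>c K. computes c (\<lambda>x. if b x then f x else g x)
    (\<lambda>x. K + K * (sz x + sz (f x) + sz (g x)) + Tb x + Tf x + Tg x)"
proof -
  let ?c = "Seq (Assign 3 (Var 0)) (Seq (call 3 cb)
    (Seq (Cond (Var 3) (Seq (Assign 3 (Var 0)) (call 3 cf)) (Seq (Assign 3 (Var 0)) (call 3 cg)))
      (Assign 0 (Var 3))))"
  define K where "K = 2 * (prog_bound cf + 1) + 2 * (prog_bound cg + 1) + 2 * (prog_bound cb + 1) + 12"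
  have "\<exists>t\<le>K + K * (sz a + sz (f a) + sz (g a)) + Tb a + Tf a + Tg a.
    runs ?c (enc a) (enc (if b a then f a else g a)) t" for a
  proof -
    let ?s0 = "(\<lambda>_. Tip)(0 := enc a) :: store"
    let ?s1 = "?s0(3 := enc a)"
    have 1: "exec (Assign 3 (Var 0)) ?s0 ?s1 (1 + sz a)"
      by (rule exec_AssignI) (simp_all add: sz_def)
    obtain s2 t2 where 2: "exec (call 3 cb) ?s1 s2 t2" "t2 \<le> 2 * (prog_bound cb + 1) + Tb a"
      "s2 3 = enc (b a)" "s2 0 = enc a"
      using exec_call_computes[OF assms(1), of ?s1 3 a] by auto
    let ?s3 = "s2(3 := enc a)"
    have 3: "exec (Assign 3 (Var 0)) s2 ?s3 (1 + sz a)"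
      by (rule exec_AssignI) (use 2 in \<open>simp_all add: sz_def\<close>)
    let ?B = "1 + sz (b a) + (1 + sz a) + (2 * (prog_bound cf + 1) + 2 * (prog_bound cg + 1)) + Tf a + Tg a"
    have "\<exists>s4 t4. exec (Cond (Var 3) (Seq (Assign 3 (Var 0)) (call 3 cf)) (Seq (Assign 3 (Var 0)) (call 3 cg)))
       s2 s4 t4 \<and> t4 \<le> ?B \<and> s4 3 = enc (if b a then f a else g a)"
    proof (cases "b a")
      case True
      obtain s4 t4 where 4: "exec (call 3 cf) ?s3 s4 t4" "t4 \<le> 2 * (prog_bound cf + 1) + Tf a"
        "s4 3 = enc (f a)"
        using exec_call_computes[OF assms(2), of ?s3 3 a] by auto
      have "eval_expr (Var 3) s2 \<noteq> Tip" using 2 True by (simp add: enc_bool_def)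
      from exec.CondTrue[OF this exec.Seq[OF 3 4(1)]] 4 2 True show ?thesis
        by (intro exI[of _ s4] exI conjI) (assumption | simp add: sz_def)+
    next
      case False
      obtain s4 t4 where 4: "exec (call 3 cg) ?s3 s4 t4" "t4 \<le> 2 * (prog_bound cg + 1) + Tg a"
        "s4 3 = enc (g a)"
        using exec_call_computes[OF assms(3), of ?s3 3 a] by auto
      have "eval_expr (Var 3) s2 = Tip" using 2 False by (simp add: enc_bool_def)
      from exec.CondFalse[OF this exec.Seq[OF 3 4(1)]] 4 2 False show ?thesis
        by (intro exI[of _ s4] exI conjI) (assumption | simp add: sz_def)+
    qed
    then obtain s4 t4 where 4: "exec (Cond (Var 3) (Seq (Assign 3 (Var 0)) (call 3 cf)) (Seq (Assign 3 (Var 0)) (call 3 cg)))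
       s2 s4 t4" "t4 \<le> ?B" "s4 3 = enc (if b a then f a else g a)" by blast
    let ?y = "if b a then f a else g a"
    have 5: "exec (Assign 0 (Var 3)) s4 (s4(0 := enc ?y)) (1 + sz ?y)"
      by (rule exec_AssignI) (use 4 in \<open>simp_all add: sz_def\<close>)
    have "exec ?c ?s0 (s4(0 := enc ?y)) ((1 + sz a) + (t2 + (t4 + (1 + sz ?y))))"
      by (intro exec.Seq[OF 1] exec.Seq[OF 2(1)] exec.Seq[OF 4(1)] 5)
    moreover have "4 * (sz a + sz (f a) + sz (g a)) \<le> K * (sz a + sz (f a) + sz (g a))"
      by (rule mult_le_mono1) (simp add: K_def)
    then have "(1 + sz a) + (t2 + (t4 + (1 + sz ?y))) \<le> K + K * (sz a + sz (f a) + sz (g a)) + Tb a + Tf a + Tg a"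
      using 2(2) 4(2) sz_bool_le[of "b a"] eq_refl[OF K_def[symmetric]]
      by (cases "b a") (simp_all add: distrib_left)
    ultimately show ?thesis by (rule runsI) simp
  qed
  then show ?thesis unfolding computes_def by blast
qed

text \<open>The recurrence records the actual accumulators instead of a closed bound, because the
  same loop is analysed for slowly growing accumulators in \<open>pt_foldl\<close> and for
  exponentially growing ones in \<open>advices_fpt\<close>. The 2 pays for the failing loop
  test.\<close>

fun fold_time :: "nat \<Rightarrow> ('x::encodable \<times> 'a::encodable \<times> 'y::encodable \<Rightarrow> nat) \<Rightarrow> ('x \<Rightarrow> 'a \<Rightarrow> 'y \<Rightarrow> 'a)
    \<Rightarrow> 'x \<Rightarrow> 'a \<Rightarrow> 'y list \<Rightarrow> nat" where
  "fold_time K T F x a [] = 2"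
| "fold_time K T F x a (y # l) = K + K * (sz x + sz a + sz (y # l) + sz (F x a y)) + T (x, a, y)
     + fold_time K T F x (F x a y) l"

text \<open>The loop keeps the accumulator in variable 0, the unread list in variable 2 and in
  variable 1 the value \<open>x\<close>, an environment that replaces the free variables of the
  folded function, since the language has no closures.\<close>

lemma computes_foldl:
  assumes "computes cF (\<lambda>(x, a, y). F x a y) T"
  shows "\<exists>c K. computes c (\<lambda>(x, l, a). foldl (F x) a l)
    (\<lambda>(x, l, a). K * sz (x, l, a) + fold_time K T F x a l)"
proof -
  let ?body = "Seq (Assign 3 (Pair (Var 1) (Pair (Var 0) (Left (Var 2))))) (Seq (call 3 cF)
    (Seq (Assign 0 (Var 3)) (Assign 2 (Right (Var 2)))))"
  let ?loop = "While (Var 2) ?body"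
  \<comment> \<open>Variable 0 holds the whole input and is therefore overwritten last.\<close>
  let ?init = "Seq (Assign 1 (Left (Var 0))) (Seq (Assign 2 (Left (Right (Var 0)))) (Assign 0 (Right (Right (Var 0)))))"
  let ?c = "Seq ?init ?loop"
  define K where "K = 2 * (prog_bound cF + 1) + 20"
  have loop: "\<exists>s' t. exec ?loop s s' t \<and> t \<le> fold_time K T F x a l \<and> s' 0 = enc (foldl (F x) a l)"
    if "s 1 = enc x" "s 2 = enc l" "s 0 = enc a" for s x l a
    using that
  proof (induction l arbitrary: a s)
    case Nil
    have "eval_expr (Var 2) s = Tip" using Nil by simp
    from exec.WhileFalse[OF this, of ?body] have "exec ?loop s s (1 + cost (Var 2) s)" .
    moreover have "1 + cost (Var 2) s \<le> fold_time K T F x a []" using Nil by simp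
    moreover have "s 0 = enc (foldl (F x) a [])" using Nil by simp
    ultimately show ?case by blast
  next
    case (Cons y l)
    let ?s1 = "s(3 := enc (x, a, y))"
    have 1: "exec (Assign 3 (Pair (Var 1) (Pair (Var 0) (Left (Var 2))))) s ?s1
      (4 + 2 * sz x + 3 * sz a + sz (y # l) + 3 * sz y)"
      by (rule exec_AssignI) (use Cons.prems in \<open>simp_all add: sz_def\<close>)
    obtain s2 t2 where 2: "exec (call 3 cF) ?s1 s2 t2" "t2 \<le> 2 * (prog_bound cF + 1) + T (x, a, y)"
      "s2 3 = enc (F x a y)" "\<forall>v<3. s2 v = s v"
      using exec_call_computes[OF assms(1), of ?s1 3 "(x, a, y)"] by auto
    have 3: "exec (Assign 0 (Var 3)) s2 (s2(0 := enc (F x a y))) (1 + sz (F x a y))"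
      by (rule exec_AssignI) (use 2 in \<open>simp_all add: sz_def\<close>)
    let ?s4 = "s2(0 := enc (F x a y), 2 := enc l)"
    have 4: "exec (Assign 2 (Right (Var 2))) (s2(0 := enc (F x a y))) ?s4 (1 + sz (y # l) + sz l)"
      by (rule exec_AssignI) (use 2 Cons.prems in \<open>simp_all add: sz_def\<close>)
    have "?s4 1 = enc x" "?s4 2 = enc l" "?s4 0 = enc (F x a y)"
      using 2(4) Cons.prems(1) by simp_all
    from Cons.IH[OF this] obtain s5 t5 where 5: "exec ?loop ?s4 s5 t5"
      "t5 \<le> fold_time K T F x (F x a y) l" "s5 0 = enc (foldl (F x) (F x a y) l)"
      by blast
    have b: "exec ?body s ?s4 ((4 + 2 * sz x + 3 * sz a + sz (y # l) + 3 * sz y) + (t2 + ((1 + sz (F x a y)) + (1 + sz (y # l) + sz l))))"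
      by (intro exec.Seq[OF 1] exec.Seq[OF 2(1)] exec.Seq[OF 3] 4)
    have ne: "eval_expr (Var 2) s \<noteq> Tip" using Cons.prems by simp
    have "cost (Var 2) s = sz (y # l)" using Cons.prems by (simp add: sz_def)
    with exec.WhileTrue[OF ne b 5(1)] have "exec ?loop s s5 (1 + sz (y # l) +
      ((4 + 2 * sz x + 3 * sz a + sz (y # l) + 3 * sz y) + (t2 + ((1 + sz (F x a y)) + (1 + sz (y # l) + sz l)))) + t5)"
      by simp
    moreover have "10 * (sz x + sz a + sz (y # l) + sz (F x a y)) \<le> K * (sz x + sz a + sz (y # l) + sz (F x a y))"
      by (rule mult_le_mono1) (simp add: K_def)
    then have "1 + sz (y # l) +
      ((4 + 2 * sz x + 3 * sz a + sz (y # l) + 3 * sz y) + (t2 + ((1 + sz (F x a y)) + (1 + sz (y # l) + sz l)))) + t5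
      \<le> fold_time K T F x a (y # l)"
      using 2(2) 5(2) sz_Cons[of y l] using eq_refl[OF K_def[symmetric]] unfolding fold_time.simps by (simp add: distrib_left)
    ultimately show ?case using 5(3) unfolding foldl_Cons by blast
  qed
  have "\<exists>t\<le>K * sz (x, l, a) + fold_time K T F x a l. runs ?c (enc (x, l, a)) (enc (foldl (F x) a l)) t" for x l a
  proof -
    let ?s0 = "(\<lambda>_. Tip)(0 := enc (x, l, a)) :: store"
    let ?s1 = "?s0(1 := enc x)"
    let ?s2 = "?s1(2 := enc l)"
    let ?s3 = "?s2(0 := enc a)"
    have 1: "exec (Assign 1 (Left (Var 0))) ?s0 ?s1 (1 + (sz (x, l, a) + sz x))"
      by (rule exec_AssignI) (simp_all add: sz_def)
    have 2: "exec (Assign 2 (Left (Right (Var 0)))) ?s1 ?s2 (1 + (sz (x, l, a) + sz (l, a) + sz l))"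
      by (rule exec_AssignI) (simp_all add: sz_def)
    have 3: "exec (Assign 0 (Right (Right (Var 0)))) ?s2 ?s3 (1 + (sz (x, l, a) + sz (l, a) + sz a))"
      by (rule exec_AssignI) (simp_all add: sz_def)
    obtain s' t where 4: "exec ?loop ?s3 s' t" "t \<le> fold_time K T F x a l" "s' 0 = enc (foldl (F x) a l)"
      using loop[of ?s3 x l a] by (auto simp del: fold_time.simps)
    have "exec ?c ?s0 s' ((1 + (sz (x, l, a) + sz x)) + ((1 + (sz (x, l, a) + sz (l, a) + sz l)) +
       (1 + (sz (x, l, a) + sz (l, a) + sz a))) + t)"
      by (intro exec.Seq[OF exec.Seq[OF 1 exec.Seq[OF 2 3]] 4(1)])
    moreover have "10 * sz (x, l, a) \<le> K * sz (x, l, a)"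
      by (rule mult_le_mono1) (simp add: K_def)
    then have "(1 + (sz (x, l, a) + sz x)) + ((1 + (sz (x, l, a) + sz (l, a) + sz l)) +
       (1 + (sz (x, l, a) + sz (l, a) + sz a))) + t \<le> K * sz (x, l, a) + fold_time K T F x a l"
      using 4(2) sz_Pair[of x "(l, a)"] sz_Pair[of l a] using eq_refl[OF K_def[symmetric]] by (simp add: distrib_left)
    ultimately show ?thesis by (rule runsI) (use 4(3) in simp)
  qed
  then show ?thesis unfolding computes_def by (intro exI[of _ ?c] exI[of _ K]) auto
qed

section \<open>Polynomial-time functions\<close>

definition polyb :: "('a::encodable \<Rightarrow> nat) \<Rightarrow> bool" where
  "polyb B \<longleftrightarrow> (\<exists>K e. \<forall>a. B a \<le> K * sz a ^ e)"

lemma polyb_const: "polyb (\<lambda>_. n)"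
  unfolding polyb_def by (intro exI[of _ n] exI[of _ 0]) simp

lemma polyb_sz: "polyb sz"
  unfolding polyb_def by (intro exI[of _ 1] exI[of _ 1]) simp

lemma polyb_mono: "polyb B \<Longrightarrow> (\<And>a. B' a \<le> B a) \<Longrightarrow> polyb B'"
  unfolding polyb_def by (meson order_trans)

lemma polyb_add:
  assumes "polyb A" "polyb B"
  shows "polyb (\<lambda>a. A a + B a)"
proof -
  from assms obtain K e K' e' where *: "\<And>a. A a \<le> K * sz a ^ e" "\<And>a. B a \<le> K' * sz a ^ e'"
    unfolding polyb_def by blast
  have "A a + B a \<le> (K + K') * sz a ^ (e + e')" for a
  proof -
    have "K * sz a ^ e \<le> K * sz a ^ (e + e')" "K' * sz a ^ e' \<le> K' * sz a ^ (e + e')"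
      using sz_ge_1[of a] by (auto intro: power_increasing)
    then show ?thesis using add_mono[OF *[of a]] unfolding add_mult_distrib by linarith
  qed
  then show ?thesis unfolding polyb_def by blast
qed

lemma polyb_mult:
  assumes "polyb A" "polyb B"
  shows "polyb (\<lambda>a. A a * B a)"
proof -
  from assms obtain K e K' e' where *: "\<And>a. A a \<le> K * sz a ^ e" "\<And>a. B a \<le> K' * sz a ^ e'"
    unfolding polyb_def by blast
  have "A a * B a \<le> (K * K') * sz a ^ (e + e')" for a
    using mult_le_mono[OF *(1)[of a] *(2)[of a]] by (simp add: power_add mult_ac)
  then show ?thesis unfolding polyb_def by blast
qed

lemma polyb_power: "polyb A \<Longrightarrow> polyb (\<lambda>a. A a ^ n)"
  by (induction n) (simp_all add: polyb_const polyb_mult)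

lemma polyb_comp:
  assumes "polyb B" "polyb (\<lambda>a. sz (f a))"
  shows "polyb (\<lambda>a. B (f a))"
proof -
  from assms(1) obtain K e where *: "\<And>a. B a \<le> K * sz a ^ e"
    unfolding polyb_def by blast
  have "polyb (\<lambda>a. K * sz (f a) ^ e)"
    by (intro polyb_mult polyb_const polyb_power assms)
  then show ?thesis by (rule polyb_mono) (rule *)
qed

lemma polyb_sz_fst: "polyb (\<lambda>z. sz (f z)) \<Longrightarrow> polyb (\<lambda>z. sz (fst (f z)))"
  by (erule polyb_mono) (simp add: sz_def enc_prod_def)

lemma polyb_sz_snd: "polyb (\<lambda>z. sz (f z)) \<Longrightarrow> polyb (\<lambda>z. sz (snd (f z)))"
  by (erule polyb_mono) (simp add: sz_def enc_prod_def)

lemmas polyb_intros = polyb_const polyb_add polyb_mult polyb_power polyb_sz polyb_sz_fst polyb_sz_snd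

definition pt :: "('a::encodable \<Rightarrow> 'b::encodable) \<Rightarrow> bool" where
  "pt f \<longleftrightarrow> (\<exists>c T. computes c f T \<and> polyb T)"

named_theorems pt_intros

text \<open>A program cannot write more than its time allows, so the closure rules get the size of
  intermediate results for free.\<close>

lemma pt_polyb_sz:
  assumes "pt f"
  shows "polyb (\<lambda>a. sz (f a))"
proof -
  from assms obtain c T where T: "computes c f T" "polyb T" unfolding pt_def by blast
  have "polyb (\<lambda>a. sz a + T a)" by (intro polyb_add polyb_sz T)
  then show ?thesis by (rule polyb_mono) (rule computes_size[OF T(1)])
qed

text \<open>Only encodings are compared, and \<open>f\<close> and \<open>g\<close> may have
  different result types: values with the same tree are converted at no cost. Most rules below
  reinterpret data in this way.\<close>

lemma pt_cong: "pt g \<Longrightarrow> (\<And>a. enc (f a) = enc (g a)) \<Longrightarrow> pt f"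
  unfolding pt_def computes_def by simp

lemma pt_comp:
  assumes "pt g" "pt f"
  shows "pt (\<lambda>x. g (f x))"
proof -
  from assms obtain cf Tf cg Tg where *: "computes cf f Tf" "polyb Tf" "computes cg g Tg" "polyb Tg"
    unfolding pt_def by blast
  have sf: "polyb (\<lambda>x. sz (f x))" and sg: "polyb (\<lambda>x. sz (g (f x)))"
    using pt_polyb_sz[OF assms(2)] polyb_comp[OF pt_polyb_sz[OF assms(1)]] by auto
  from computes_comp[OF *(1,3)] obtain c K where
    "computes c (\<lambda>x. g (f x)) (\<lambda>x. K + K * (sz x + sz (g (f x))) + Tf x + Tg (f x))" by blast
  moreover have "polyb (\<lambda>x. K + K * (sz x + sz (g (f x))) + Tf x + Tg (f x))"
    by (intro polyb_intros sf sg * polyb_comp[OF *(4)])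
  ultimately show ?thesis unfolding pt_def by blast
qed

lemma pt_Pair [pt_intros]:
  assumes "pt f" "pt g"
  shows "pt (\<lambda>x. (f x, g x))"
proof -
  from assms obtain cf Tf cg Tg where *: "computes cf f Tf" "polyb Tf" "computes cg g Tg" "polyb Tg"
    unfolding pt_def by blast
  from computes_Pair[OF *(1,3)] obtain c K where
    "computes c (\<lambda>x. (f x, g x)) (\<lambda>x. K + K * (sz x + sz (f x) + sz (g x)) + Tf x + Tg x)" by blast
  moreover have "polyb (\<lambda>x. K + K * (sz x + sz (f x) + sz (g x)) + Tf x + Tg x)"
    by (intro polyb_intros * assms[THEN pt_polyb_sz])
  ultimately show ?thesis unfolding pt_def by blast
qed

lemma pt_If [pt_intros]:
  assumes "pt b" "pt f" "pt g"
  shows "pt (\<lambda>x. if b x then f x else g x)"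
proof -
  from assms obtain cb Tb cf Tf cg Tg where *: "computes cb b Tb" "polyb Tb"
    "computes cf f Tf" "polyb Tf" "computes cg g Tg" "polyb Tg"
    unfolding pt_def by blast
  from computes_If[OF *(1,3,5)] obtain c K where
    "computes c (\<lambda>x. if b x then f x else g x) (\<lambda>x. K + K * (sz x + sz (f x) + sz (g x)) + Tb x + Tf x + Tg x)" by blast
  moreover have "polyb (\<lambda>x. K + K * (sz x + sz (f x) + sz (g x)) + Tb x + Tf x + Tg x)"
    by (intro polyb_intros * assms(2-3)[THEN pt_polyb_sz])
  ultimately show ?thesis unfolding pt_def by blast
qed

lemma pt_Assign:
  fixes f :: "'a::encodable \<Rightarrow> 'b::encodable"
  assumes "\<And>a. eval_expr e ((\<lambda>_. Tip)(0 := enc a)) = enc (f a)"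
    and "\<And>a :: 'a. cost e ((\<lambda>_. Tip)(0 := enc a)) \<le> K * sz a"
  shows "pt f"
proof -
  have "computes (Assign 0 e) f (\<lambda>a. 1 + K * sz a)"
    by (rule computes_Assign) (rule assms(1), use assms(2) in \<open>intro add_left_mono\<close>)
  moreover have "polyb (\<lambda>a::'a. 1 + K * sz a)" by (intro polyb_intros)
  ultimately show ?thesis unfolding pt_def by blast
qed

lemma pt_id [pt_intros]: "pt (\<lambda>x. x)"
  by (rule pt_Assign[of "Var 0" _ 1]) (simp_all add: sz_def)

lemma pt_const [pt_intros]: "pt (\<lambda>_. v)"
proof (rule pt_Assign[of "Quote (enc v)" _ "sz v"])
  show "cost (Quote (enc v)) ((\<lambda>_. Tip)(0 := enc a)) \<le> sz v * sz a" for a :: 'a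
    using sz_ge_1[of a] by (simp add: sz_def)
qed simp

lemma tsize_left_sub: "tsize (left_sub t) \<le> tsize t"
  by (cases t) auto

lemma tsize_right_sub: "tsize (right_sub t) \<le> tsize t"
  by (cases t) auto

lemma pt_left_sub [pt_intros]: "pt f \<Longrightarrow> pt (\<lambda>x. left_sub (f x))"
proof (rule pt_comp[of left_sub f])
  show "pt left_sub"
    by (rule pt_Assign[of "Left (Var 0)" _ 2])
      (use tsize_left_sub in \<open>auto simp: sz_def enc_tree_def mult_2\<close>)
qed

lemma pt_right_sub [pt_intros]: "pt f \<Longrightarrow> pt (\<lambda>x. right_sub (f x))"
proof (rule pt_comp[of right_sub f])
  show "pt right_sub"
    by (rule pt_Assign[of "Right (Var 0)" _ 2])
      (use tsize_right_sub in \<open>auto simp: sz_def enc_tree_def mult_2\<close>)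
qed

lemma pt_enc [pt_intros]: "pt f \<Longrightarrow> pt (\<lambda>x. enc (f x))"
  by (erule pt_cong) (simp add: enc_tree_def)

lemma pt_fst [pt_intros]: "pt f \<Longrightarrow> pt (\<lambda>x. fst (f x))"
  by (rule pt_cong[of "\<lambda>x. left_sub (enc (f x))"], (intro pt_intros; assumption)) (simp add: enc_tree_def enc_prod_def)

lemma pt_snd [pt_intros]: "pt f \<Longrightarrow> pt (\<lambda>x. snd (f x))"
  by (rule pt_cong[of "\<lambda>x. right_sub (enc (f x))"], (intro pt_intros; assumption)) (simp add: enc_tree_def enc_prod_def)

text \<open>By these rules the body of a definition is treated just once, with projections as
  arguments. Below the binder of a \<open>map\<close> or \<open>filter\<close>, an argument
  \<open>f x\<close> would turn into \<open>f (fst z)\<close>, which no introduction rule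
  matches.\<close>

lemma pt_comp2:
  assumes "pt (\<lambda>z. F (fst z) (snd z))" "pt f" "pt g"
  shows "pt (\<lambda>x. F (f x) (g x))"
  using pt_comp[OF assms(1) pt_Pair[OF assms(2,3)]] by simp

lemma pt_comp3:
  assumes "pt (\<lambda>z. F (fst z) (fst (snd z)) (snd (snd z)))" "pt f" "pt g" "pt h"
  shows "pt (\<lambda>x. F (f x) (g x) (h x))"
  using pt_comp[OF assms(1) pt_Pair[OF assms(2) pt_Pair[OF assms(3,4)]]] by simp

lemma pt_comp4:
  assumes "pt (\<lambda>z. F (fst z) (fst (snd z)) (fst (snd (snd z))) (snd (snd (snd z))))" "pt f" "pt g" "pt h" "pt i"
  shows "pt (\<lambda>x. F (f x) (g x) (h x) (i x))"
  using pt_comp[OF assms(1) pt_Pair[OF assms(2) pt_Pair[OF assms(3) pt_Pair[OF assms(4,5)]]]] by simp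

text \<open>Injectivity of the encoding reduces equality at every type to the comparison of trees by
  \<open>Eq\<close>.\<close>

lemma pt_eq [pt_intros]:
  assumes "pt f" "pt g"
  shows "pt (\<lambda>x. f x = g x)"
proof (rule pt_comp2[of "(=)", OF _ assms])
  have "tsize (left_sub (enc a)) + tsize (right_sub (enc a)) + 3 \<le> 3 * sz a" for a :: "'b \<times> 'b"
    using sz_ge_1[of "fst a"] sz_ge_1[of "snd a"] by (simp add: sz_def enc_prod_def)
  then show "pt (\<lambda>z :: 'b \<times> 'b. fst z = snd z)"
    by (intro pt_Assign[of "Eq (Left (Var 0)) (Right (Var 0))" _ 5])
      (auto simp: sz_def enc_prod_def enc_bool_def)
qed

lemma pt_not [pt_intros]: "pt f \<Longrightarrow> pt (\<lambda>x. \<not> f x)"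
  by (rule pt_cong[of "\<lambda>x. if f x then False else True"], (intro pt_intros; assumption)) simp

lemma pt_conj [pt_intros]: "pt f \<Longrightarrow> pt g \<Longrightarrow> pt (\<lambda>x. f x \<and> g x)"
  by (rule pt_cong[of "\<lambda>x. if f x then g x else False"], (intro pt_intros; assumption)) simp

lemma pt_disj [pt_intros]: "pt f \<Longrightarrow> pt g \<Longrightarrow> pt (\<lambda>x. f x \<or> g x)"
  by (rule pt_cong[of "\<lambda>x. if f x then True else g x"], (intro pt_intros; assumption)) simp

lemma pt_imp [pt_intros]: "pt f \<Longrightarrow> pt g \<Longrightarrow> pt (\<lambda>x. f x \<longrightarrow> g x)"
  by (rule pt_cong[of "\<lambda>x. if f x then g x else True"], (intro pt_intros; assumption)) simp

subsection \<open>Lists\<close>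

lemma pt_Cons [pt_intros]: "pt f \<Longrightarrow> pt g \<Longrightarrow> pt (\<lambda>x. f x # g x)"
  by (rule pt_cong[of "\<lambda>x. (f x, g x)"], (intro pt_intros; assumption)) simp

lemma pt_hd [pt_intros]:
  assumes "pt f"
  shows "pt (\<lambda>x. hd (f x))"
proof (rule pt_cong)
  \<comment> \<open>\<open>hd []\<close> is unspecified but one fixed value, so the program may
    contain its encoding as a constant.\<close>
  show "pt (\<lambda>x. if f x = [] then enc (hd []::'b) else left_sub (enc (f x)))"
    by (intro pt_intros assms)
  show "enc (hd (f x)) = enc (if f x = [] then enc (hd []::'b) else left_sub (enc (f x)))" for x
    by (cases "f x") (auto simp: enc_tree_def)
qed

lemma pt_tl [pt_intros]:
  assumes "pt f"
  shows "pt (\<lambda>x. tl (f x))"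
proof (rule pt_cong)
  show "pt (\<lambda>x. right_sub (enc (f x)))"
    by (intro pt_intros assms)
  show "enc (tl (f x)) = enc (right_sub (enc (f x)))" for x
    by (cases "f x") (auto simp: enc_tree_def)
qed

lemma length_le_sz: "length l \<le> sz l"
  by (induction l) auto

lemma sz_elem: "y \<in> set l \<Longrightarrow> sz y + 2 \<le> sz l"
proof (induction l)
  case (Cons a l)
  then show ?case using sz_ge_1[of l] by auto
qed simp

text \<open>Every step is charged for the old and for the new accumulator, hence
  \<open>2 * M\<close>, and hence the bound on all of them up to the final one.\<close>

lemma fold_time_le:
  assumes "\<And>i. i \<le> length l \<Longrightarrow> sz (foldl (F x) a (take i l)) \<le> M"
    and "\<And>i. i < length l \<Longrightarrow> T (x, foldl (F x) a (take i l), l ! i) \<le> B"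
    and "sz l \<le> L"
  shows "fold_time K T F x a l \<le> 2 + length l * (K + K * (sz x + 2 * M + L) + B)"
  using assms
proof (induction l arbitrary: a)
  case (Cons y l)
  have arith: "K + c + t + r \<le> 2 + Suc n * (K + A + B)"
    if "c \<le> A" "t \<le> B" "r \<le> 2 + n * (K + A + B)" for c A t r n :: nat
    using that by simp
  have "fold_time K T F x (F x a y) l \<le> 2 + length l * (K + K * (sz x + 2 * M + L) + B)"
  proof (rule Cons.IH)
    show "sz (foldl (F x) (F x a y) (take i l)) \<le> M" if "i \<le> length l" for i
      using Cons.prems(1)[of "Suc i"] that by simp
    show "T (x, foldl (F x) (F x a y) (take i l), l ! i) \<le> B" if "i < length l" for i
      using Cons.prems(2)[of "Suc i"] that by simp
    show "sz l \<le> L" using Cons.prems(3) by simp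
  qed
  moreover have "K * (sz x + sz a + sz (y # l) + sz (F x a y)) \<le> K * (sz x + 2 * M + L)"
  proof (rule mult_le_mono2)
    have "sz a \<le> M" using Cons.prems(1)[of 0] by simp
    moreover have "sz (F x a y) \<le> M" using Cons.prems(1)[of 1] by simp
    ultimately show "sz x + sz a + sz (y # l) + sz (F x a y) \<le> sz x + 2 * M + L"
      using Cons.prems(3) by linarith
  qed
  moreover have "T (x, a, y) \<le> B" using Cons.prems(2)[of 0] by simp
  ultimately show ?case unfolding fold_time.simps length_Cons by (intro arith)
qed simp

lemma sz_foldl_le:
  assumes "\<And>a y. y \<in> set l \<Longrightarrow> sz (F a y) \<le> sz a + g"
  shows "sz (foldl F a l) \<le> sz a + length l * g"
  using assms
proof (induction l arbitrary: a)
  case (Cons y l)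
  have "sz (foldl F (F a y) l) \<le> sz (F a y) + length l * g" by (rule Cons.IH) (use Cons.prems in auto)
  then show ?case using Cons.prems[of y a] by simp
qed simp

lemma pt_foldl:
  fixes F :: "'x::encodable \<Rightarrow> 'a::encodable \<Rightarrow> 'y::encodable \<Rightarrow> 'a"
  assumes F: "pt (\<lambda>z. F (fst z) (fst (snd z)) (snd (snd z)))"
    and G: "\<And>x a y. sz (F x a y) \<le> sz a + G (x, y)" "polyb G"
    and l: "pt l" and a: "pt a"
  shows "pt (\<lambda>x. foldl (\<lambda>a y. F x a y) (a x) (l x))"
proof -
  have F': "(\<lambda>z. F (fst z) (fst (snd z)) (snd (snd z))) = (\<lambda>(x, a, y). F x a y)" by auto
  from F[unfolded F'] obtain cF T where T: "computes cF (\<lambda>(x, a, y). F x a y) T" "polyb T"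
    unfolding pt_def by blast
  from computes_foldl[OF T(1)] obtain c K where c: "computes c (\<lambda>(x, l, a). foldl (F x) a l)
    (\<lambda>(x, l, a). K * sz (x, l, a) + fold_time K T F x a l)" by blast
  from T(2) obtain KT eT where KT: "\<And>z. T z \<le> KT * sz z ^ eT" unfolding polyb_def by blast
  from G(2) obtain KG eG where KG: "\<And>z. G z \<le> KG * sz z ^ eG" unfolding polyb_def by blast
  \<comment> \<open>An element is smaller than its list by at least 2, so the size
    \<open>1 + sz x + sz y\<close> of the pair is at most \<open>sz x + sz l\<close>. This gives all
    steps one common bound on the increment.\<close>
  let ?g = "\<lambda>z :: 'x \<times> 'y list \<times> 'a. KG * (sz (fst z) + sz (fst (snd z))) ^ eG"
  let ?M = "\<lambda>z :: 'x \<times> 'y list \<times> 'a. sz (snd (snd z)) + sz (fst (snd z)) * ?g z"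
  let ?B = "\<lambda>z :: 'x \<times> 'y list \<times> 'a. KT * (2 + sz (fst z) + ?M z + sz (fst (snd z))) ^ eT"
  let ?S = "\<lambda>z :: 'x \<times> 'y list \<times> 'a. K * sz z +
    (2 + sz (fst (snd z)) * (K + K * (sz (fst z) + 2 * ?M z + sz (fst (snd z))) + ?B z))"
  have bound: "fold_time K T F x a l \<le> 2 + length l * (K + K * (sz x + 2 * ?M (x, l, a) + sz l) + ?B (x, l, a))" for x l a
  proof (rule fold_time_le[OF _ _ order_refl])
    have g: "sz (F x a y) \<le> sz a + ?g (x, l, a')" if "y \<in> set l" for y a a'
    proof -
      have "sz (x, y) \<le> sz x + sz l" using sz_elem[OF that] by simp
      then have "KG * sz (x, y) ^ eG \<le> ?g (x, l, a')" by (simp add: power_mono del: sz_Pair)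
      then show ?thesis using G(1)[of x a y] KG[of "(x, y)"] by linarith
    qed
    show M: "sz (foldl (F x) a (take i l)) \<le> ?M (x, l, a)" for i
    proof -
      have "sz (foldl (F x) a (take i l)) \<le> sz a + length (take i l) * ?g (x, l, a)"
        by (rule sz_foldl_le) (use g in_set_takeD in fast)
      also have "length (take i l) * ?g (x, l, a) \<le> sz l * ?g (x, l, a)"
        using length_le_sz[of l] by (intro mult_le_mono1) simp
      finally show ?thesis by simp
    qed
    show "T (x, foldl (F x) a (take i l), l ! i) \<le> ?B (x, l, a)" if "i < length l" for i
    proof -
      have "sz (x, foldl (F x) a (take i l), l ! i) \<le> 2 + sz x + ?M (x, l, a) + sz l"
        using M[of i] sz_elem[of "l ! i" l] that by simp
      then have "KT * sz (x, foldl (F x) a (take i l), l ! i) ^ eT \<le> ?B (x, l, a)"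
        by (simp add: power_mono del: sz_Pair)
      then show ?thesis using KT order_trans by blast
    qed
  qed
  have "computes c (\<lambda>(x, l, a). foldl (F x) a l) ?S"
  proof (rule computes_mono[OF c], clarify)
    fix x :: 'x and l :: "'y list" and a :: 'a
    have "length l * (K + K * (sz x + 2 * ?M (x, l, a) + sz l) + ?B (x, l, a))
      \<le> sz l * (K + K * (sz x + 2 * ?M (x, l, a) + sz l) + ?B (x, l, a))"
      by (intro mult_le_mono1 length_le_sz)
    then show "K * sz (x, l, a) + fold_time K T F x a l \<le> ?S (x, l, a)"
      using bound[of x a l] by (simp only: fst_conv snd_conv)
  qed
  moreover have "polyb ?S" by (intro polyb_intros)
  ultimately have "pt (\<lambda>(x, l, a). foldl (F x) a l)" unfolding pt_def by blast
  from pt_comp[OF this pt_Pair[OF pt_id pt_Pair[OF l a]]] show ?thesis by simp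
qed

lemma pt_rev [pt_intros]:
  assumes "pt f"
  shows "pt (\<lambda>x. rev (f x))"
proof -
  have "foldl (\<lambda>a y. y # a) ys xs = rev xs @ ys" for xs ys :: "'b list"
    by (induction xs arbitrary: ys) auto
  from this[of "[]"] have "rev xs = foldl (\<lambda>a y. y # a) [] xs" for xs :: "'b list"
    by (metis append_Nil2)
  moreover have "pt (\<lambda>x. foldl (\<lambda>a y. y # a) [] (f x))"
  proof (rule pt_foldl[of "\<lambda>x a y. y # a" "\<lambda>z. 1 + sz (snd z)"])
    show "sz (y # a) \<le> sz a + (1 + sz (snd (x, y)))" for x :: 'a and a and y :: 'b
      by simp
  qed (intro pt_intros polyb_intros assms)+
  ultimately show ?thesis by simp
qed

lemma sz_append: "sz (xs @ ys) + 1 = sz xs + sz ys"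
  by (induction xs) auto

lemma pt_append [pt_intros]:
  assumes "pt f" "pt g"
  shows "pt (\<lambda>x. f x @ g x)"
proof -
  have "xs @ ys = foldl (\<lambda>a y. y # a) ys (rev xs)" for xs ys :: "'b list"
    by (induction xs) auto
  moreover have "pt (\<lambda>x. foldl (\<lambda>a y. y # a) (g x) (rev (f x)))"
  proof (rule pt_foldl[of "\<lambda>x a y. y # a" "\<lambda>z. 1 + sz (snd z)"])
    show "sz (y # a) \<le> sz a + (1 + sz (snd (x, y)))" for x :: 'a and a and y :: 'b
      by simp
  qed (intro pt_intros polyb_intros assms)+
  ultimately show ?thesis by simp
qed

lemma pt_concat [pt_intros]:
  assumes "pt f"
  shows "pt (\<lambda>x. concat (f x))"
proof -
  have "foldl (\<lambda>a y. a @ y) ys xss = ys @ concat xss" for ys and xss :: "'b list list"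
    by (induction xss arbitrary: ys) auto
  from this[of "[]"] have "concat xss = foldl (\<lambda>a y. a @ y) [] xss" for xss :: "'b list list"
    by simp
  moreover have "pt (\<lambda>x. foldl (\<lambda>a y. a @ y) [] (f x))"
  proof (rule pt_foldl[of "\<lambda>x a y. a @ y" "\<lambda>z. sz (snd z)"])
    show "sz (a @ y) \<le> sz a + sz (snd (x, y))" for x :: 'a and a y :: "'b list"
      using sz_append[of a y] by simp
  qed (intro pt_intros polyb_intros assms)+
  ultimately show ?thesis by simp
qed

lemma pt_map [pt_intros]:
  assumes "pt (\<lambda>z. F (fst z) (snd z))" "pt l"
  shows "pt (\<lambda>x. map (\<lambda>y. F x y) (l x))"
proof -
  have "rev (foldl (\<lambda>a y. F x y # a) b ys) = rev b @ map (F x) ys" for x ys b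
    by (induction ys arbitrary: b) auto
  from this[of _ "[]"] have "map (F x) ys = rev (foldl (\<lambda>a y. F x y # a) [] ys)" for x ys by simp
  moreover have "pt (\<lambda>x. rev (foldl (\<lambda>a y. F x y # a) [] (l x)))"
  proof (rule pt_rev, rule pt_foldl[of "\<lambda>x a y. F x y # a" "\<lambda>z. 1 + sz (F (fst z) (snd z))"])
    show "polyb (\<lambda>z. 1 + sz (F (fst z) (snd z)))"
      by (intro polyb_intros pt_polyb_sz[OF assms(1)])
    show "pt (\<lambda>z. F (fst z) (snd (snd z)) # fst (snd z))"
      by (intro pt_intros pt_comp2[OF assms(1)])
  qed (simp, rule assms, intro pt_intros)
  ultimately show ?thesis by simp
qed

lemma pt_filter [pt_intros]:
  assumes "pt (\<lambda>z. P (fst z) (snd z))" "pt l"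
  shows "pt (\<lambda>x. filter (\<lambda>y. P x y) (l x))"
proof -
  have "filter (P x) ys = concat (map (\<lambda>y. if P x y then [y] else []) ys)" for x ys
    by (induction ys) auto
  moreover have "pt (\<lambda>x. concat (map (\<lambda>y. if P x y then [y] else []) (l x)))"
    by (intro pt_intros assms)
  ultimately show ?thesis by simp
qed

lemma pt_Bex [pt_intros]:
  assumes "pt (\<lambda>z. P (fst z) (snd z))" "pt l"
  shows "pt (\<lambda>x. \<exists>y\<in>set (l x). P x y)"
proof -
  have "pt (\<lambda>x. filter (\<lambda>y. P x y) (l x) \<noteq> [])"
    by (intro pt_intros assms)
  then show ?thesis by (rule pt_cong) (simp add: filter_empty_conv)
qed

lemma pt_Ball [pt_intros]:
  assumes "pt (\<lambda>z. P (fst z) (snd z))" "pt l"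
  shows "pt (\<lambda>x. \<forall>y\<in>set (l x). P x y)"
proof -
  have "pt (\<lambda>x. filter (\<lambda>y. \<not> P x y) (l x) = [])"
    by (intro pt_intros assms)
  then show ?thesis by (rule pt_cong) (simp add: filter_empty_conv)
qed

lemma pt_mem [pt_intros]:
  assumes "pt f" "pt l"
  shows "pt (\<lambda>x. f x \<in> set (l x))"
proof -
  have "pt (\<lambda>x. \<exists>y\<in>set (l x). f x = y)"
    by (intro pt_intros pt_comp[OF assms(1)] assms)
  then show ?thesis by simp
qed

lemma pt_last [pt_intros]:
  assumes "pt f"
  shows "pt (\<lambda>x. last (f x))"
proof -
  have "pt (\<lambda>x. if f x = [] then last [] else hd (rev (f x)))"
    by (intro pt_intros assms)
  then show ?thesis by (rule pt_cong) (simp add: hd_rev)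
qed

subsection \<open>Unary arithmetic\<close>

text \<open>A number in unary is the tree of a list of units, so arithmetic becomes list processing:
  addition is append, truncated subtraction is \<open>drop\<close>.\<close>

lemma enc_nat_list: "enc n = enc (replicate n ())"
  by (induction n) (simp_all add: enc_unit_def)

lemma pt_replicate_unit [pt_intros]: "pt f \<Longrightarrow> pt (\<lambda>x. replicate (f x) ())"
  by (erule pt_cong) (simp add: enc_nat_list)

lemma pt_length [pt_intros]: "pt f \<Longrightarrow> pt (\<lambda>x. length (f x))"
  by (rule pt_cong[of "\<lambda>x. map (\<lambda>_. ()) (f x)"], (intro pt_intros; assumption)) (simp add: enc_nat_list map_replicate_const)

lemma pt_Suc [pt_intros]: "pt f \<Longrightarrow> pt (\<lambda>x. Suc (f x))"
  by (rule pt_cong[of "\<lambda>x. (Tip, f x)"], (intro pt_intros; assumption)) (simp add: enc_tree_def)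

lemma pt_add [pt_intros]: 
  assumes "pt f" "pt g"
  shows "pt (\<lambda>x. f x + g x :: nat)"
proof -
  have "pt (\<lambda>x. length (replicate (f x) () @ replicate (g x) ()))"
    by (intro pt_intros assms)
  then show ?thesis by simp
qed

lemma pt_mult [pt_intros]:
  assumes "pt f" "pt g"
  shows "pt (\<lambda>x. f x * g x :: nat)"
proof -
  have "m * n = length (concat (map (\<lambda>_. replicate n ()) (replicate m ())))" for m n
    by (induction m) auto
  moreover have "pt (\<lambda>x. length (concat (map (\<lambda>_. replicate (g x) ()) (replicate (f x) ()))))"
    by (intro pt_intros pt_comp[OF assms(2)] assms)
  ultimately show ?thesis by simp
qed

lemma pt_power [pt_intros]: "pt f \<Longrightarrow> pt (\<lambda>x. f x ^ n :: nat)"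
  by (induction n) (simp_all add: pt_const pt_mult)

lemma sz_tl: "sz (tl xs) \<le> sz xs"
  by (cases xs) auto

lemma pt_drop [pt_intros]:
  assumes "pt f" "pt n"
  shows "pt (\<lambda>x. drop (n x) (f x))"
proof -
  have "foldl (\<lambda>a _. tl a) xs (replicate m ()) = drop m xs" for m and xs :: "'b list"
    by (induction m arbitrary: xs) (auto simp: drop_Suc)
  moreover have "pt (\<lambda>x. foldl (\<lambda>a _. tl a) (f x) (replicate (n x) ()))"
    by (rule pt_foldl[of "\<lambda>x a y. tl a" "\<lambda>z. 0"], intro pt_intros, simp add: sz_tl, (intro pt_intros polyb_intros assms)+)
  ultimately show ?thesis by simp
qed

lemma pt_diff [pt_intros]:
  assumes "pt f" "pt g"
  shows "pt (\<lambda>x. f x - g x :: nat)"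
proof -
  have "pt (\<lambda>x. length (drop (g x) (replicate (f x) ())))"
    by (intro pt_intros assms)
  then show ?thesis by simp
qed

lemma pt_less [pt_intros]:
  assumes "pt f" "pt g"
  shows "pt (\<lambda>x. (f x :: nat) < g x)"
proof -
  have "pt (\<lambda>x. g x - f x \<noteq> 0)"
    by (intro pt_intros assms)
  then show ?thesis by (rule pt_cong) (simp add: not_le)
qed

lemma pt_le [pt_intros]:
  assumes "pt f" "pt g"
  shows "pt (\<lambda>x. (f x :: nat) \<le> g x)"
proof -
  have "pt (\<lambda>x. f x - g x = 0)"
    by (intro pt_intros assms)
  then show ?thesis by (rule pt_cong) simp
qed

lemma pt_upt [pt_intros]:
  assumes "pt f"
  shows "pt (\<lambda>x. [0..<f x])"
proof -
  \<comment> \<open>The appended number is the length of the accumulator; the guard bounds it by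
    \<open>n\<close>, so that the increment is independent of the accumulator as
    \<open>pt_foldl\<close> requires.\<close>
  let ?F = "\<lambda>n a (_::unit). if length a < n then a @ [length a] else a"
  have "foldl (?F n) [] (replicate m ()) = [0..<m]" if "m \<le> n" for m n
    using that
  proof (induction m)
    case (Suc m)
    have "replicate (Suc m) () = replicate m () @ [()]"
      by (simp add: replicate_append_same)
    then show ?case using Suc by simp
  qed simp
  then have "foldl (?F n) [] (replicate n ()) = [0..<n]" for n by simp
  moreover have "pt (\<lambda>x. foldl (\<lambda>a y. ?F (f x) a y) [] (replicate (f x) ()))"
  proof (rule pt_foldl[of "\<lambda>x a y. ?F (f x) a y" "\<lambda>z. 1 + sz (f (fst z))"])
    show "polyb (\<lambda>z. 1 + sz (f (fst z)))"
      by (intro polyb_intros pt_polyb_sz pt_comp[OF assms] pt_intros)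
    show "sz (?F (f x) a y) \<le> sz a + (1 + sz (f (fst (x, y))))" for x :: 'a and a y
      using sz_append[of a "[length a]"] by simp
  qed (intro pt_intros pt_comp[OF assms] assms)+
  ultimately show ?thesis by simp
qed

text \<open>A total variant of indexing: unlike \<open>xs ! i\<close>, its value out of range is one fixed element,
  so that it is computable.\<close>

definition get :: "'a list \<Rightarrow> nat \<Rightarrow> 'a" where
  "get xs i = hd (drop i xs)"

lemma get_nth [simp]: "i < length xs \<Longrightarrow> get xs i = xs ! i"
  by (simp add: get_def hd_drop_conv_nth)

lemma pt_get [pt_intros]: "pt f \<Longrightarrow> pt g \<Longrightarrow> pt (\<lambda>x. get (f x) (g x))"
  unfolding get_def by (intro pt_intros)

section \<open>Computable functions\<close>

text \<open>With an arbitrary \<open>T\<close> this claims no more than termination on every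
  input.\<close>

definition ct :: "('a::encodable \<Rightarrow> 'b::encodable) \<Rightarrow> bool" where
  "ct f \<longleftrightarrow> (\<exists>c T. computes c f T)"

lemma computable_iff_ct: "computable f \<longleftrightarrow> ct f"
proof
  assume "computable f"
  then obtain c where "\<forall>n. \<exists>t. runs c (enc_nat n) (enc_nat (f n)) t" unfolding computable_def by blast
  then obtain T where "\<forall>n. runs c (enc_nat n) (enc_nat (f n)) (T n)" by metis
  then show "ct f" unfolding ct_def computes_def enc_nat_def by blast
next
  assume "ct f"
  then show "computable f" unfolding ct_def computes_def computable_def enc_nat_def by metis
qed

lemma pt_imp_ct: "pt f \<Longrightarrow> ct f"
  unfolding pt_def ct_def by blast

lemma ct_comp: "ct g \<Longrightarrow> ct f \<Longrightarrow> ct (\<lambda>x. g (f x))"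
  unfolding ct_def using computes_comp by blast

lemma ct_Pair: "ct f \<Longrightarrow> ct g \<Longrightarrow> ct (\<lambda>x. (f x, g x))"
  unfolding ct_def using computes_Pair by blast

lemma ct_comp2:
  assumes "pt (\<lambda>z. F (fst z) (snd z))" "ct f" "ct g"
  shows "ct (\<lambda>x. F (f x) (g x))"
  using ct_comp[OF pt_imp_ct[OF assms(1)] ct_Pair[OF assms(2,3)]] by simp

text \<open>The step is polynomial but the accumulator may grow at any rate, as it does in
  \<open>ct_power\<close>.\<close>

lemma ct_foldl:
  assumes "pt (\<lambda>z. F (fst z) (fst (snd z)) (snd (snd z)))" "ct l" "ct a"
  shows "ct (\<lambda>x. foldl (\<lambda>a y. F x a y) (a x) (l x))"
proof -
  have F': "(\<lambda>z. F (fst z) (fst (snd z)) (snd (snd z))) = (\<lambda>(x, a, y). F x a y)" by auto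
  have "ct (\<lambda>(x, l, a). foldl (F x) a l)"
    using assms(1)[unfolded F'] computes_foldl unfolding pt_def ct_def by blast
  from ct_comp[OF this ct_Pair[OF pt_imp_ct[OF pt_id] ct_Pair[OF assms(2,3)]]] show ?thesis by simp
qed

lemma ct_const: "ct (\<lambda>_. v)"
  by (intro pt_imp_ct pt_intros)

lemma ct_id: "ct (\<lambda>x. x)"
  by (intro pt_imp_ct pt_intros)

lemma ct_add: "ct f \<Longrightarrow> ct g \<Longrightarrow> ct (\<lambda>x. f x + g x :: nat)"
  by (rule ct_comp2[of plus]) (intro pt_intros)

lemma ct_mult: "ct f \<Longrightarrow> ct g \<Longrightarrow> ct (\<lambda>x. f x * g x :: nat)"
  by (rule ct_comp2[of times]) (intro pt_intros)

lemma ct_power: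
  assumes "ct f" "ct g"
  shows "ct (\<lambda>x. f x ^ g x :: nat)"
proof -
  have "foldl (\<lambda>a _. a * b) c (replicate m ()) = c * b ^ m" for b c m :: nat
    by (induction m arbitrary: c) (auto simp: mult_ac)
  from this[of _ 1] have "b ^ m = foldl (\<lambda>a _. a * b) 1 (replicate m ())" for b m :: nat
    by simp
  moreover have "ct (\<lambda>z. foldl (\<lambda>a _. a * fst z) (1::nat) (replicate (snd z) ()))"
    by (rule ct_foldl[of "\<lambda>z a _. a * fst z :: nat"]) (intro pt_intros, (intro pt_imp_ct pt_intros)+)
  ultimately have "ct (\<lambda>z. fst z ^ snd z :: nat)" by simp
  from ct_comp[OF this ct_Pair[OF assms]] show ?thesis by simp
qed

lemmas ct_intros = ct_const ct_id ct_add ct_mult ct_power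

section \<open>From cliques to anchored cores\<close>

lemma degree_induced:
  assumes "\<forall>e\<in>E. card e = 2" "v \<in> H"
  shows "degree (induced_edges E H) v = card {u \<in> H. {v, u} \<in> E}"
proof -
  have "bij_betw (\<lambda>u. {v, u}) {u \<in> H. {v, u} \<in> E} {e \<in> induced_edges E H. v \<in> e}"
  proof (rule bij_betw_imageI)
    show "inj_on (\<lambda>u. {v, u}) {u \<in> H. {v, u} \<in> E}"
      by (auto simp: inj_on_def doubleton_eq_iff)
    show "(\<lambda>u. {v, u}) ` {u \<in> H. {v, u} \<in> E} = {e \<in> induced_edges E H. v \<in> e}"
    proof (intro equalityI subsetI)
      fix e assume e: "e \<in> {e \<in> induced_edges E H. v \<in> e}"
      then have "card e = 2" using assms(1) by (auto simp: induced_edges_def)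
      then obtain x y where "e = {x, y}" by (auto simp: card_2_iff)
      with e show "e \<in> (\<lambda>u. {v, u}) ` {u \<in> H. {v, u} \<in> E}"
        by (auto simp: induced_edges_def insert_commute)
    qed (use assms(2) in \<open>auto simp: induced_edges_def\<close>)
  qed
  then show ?thesis by (simp add: degree_def bij_betw_same_card)
qed

text \<open>Gadget \<open>t\<close> owns a block of \<open>k + 1\<close> consecutive numbers, placed
  after the \<open>m\<close> original vertices.\<close>

definition gvert :: "nat \<Rightarrow> nat \<Rightarrow> nat \<Rightarrow> nat \<Rightarrow> nat" where
  "gvert m k t j = m + t * (k + 1) + j"

definition attach :: "nat \<Rightarrow> nat \<Rightarrow> nat \<Rightarrow> (nat \<times> nat) list \<Rightarrow> nat \<Rightarrow> nat \<Rightarrow> nat" where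
  "attach m k s ed t j =
     (if j < s then fst (get ed t) else if j < 2 * s then snd (get ed t) else gvert m k t k)"

text \<open>Edges inside a gadget clique are listed in both orientations, which
  \<open>edges_of\<close> identifies.\<close>

definition akc_edges :: "nat \<Rightarrow> nat \<Rightarrow> nat \<Rightarrow> (nat \<times> nat) list \<Rightarrow> (nat \<times> nat) list" where
  "akc_edges m k s ed = concat (map (\<lambda>t. concat (map (\<lambda>j.
     (gvert m k t j, attach m k s ed t j)
     # map (\<lambda>j'. (gvert m k t j, gvert m k t j')) (filter (\<lambda>j'. j' \<noteq> j) [0..<k]))
     [0..<k])) [0..<length ed])"

lemma akc_edges_iff:
  "(u, v) \<in> set (akc_edges m k s ed) \<longleftrightarrow> (\<exists>t<length ed. \<exists>j<k. u = gvert m k t j \<and>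
     (v = attach m k s ed t j \<or> (\<exists>j'<k. j' \<noteq> j \<and> v = gvert m k t j')))"
proof -
  have concat: "y \<in> set (concat (map f [0..<i])) \<longleftrightarrow> (\<exists>x<i. y \<in> set (f x))" for y :: "nat \<times> nat" and f i
    by auto
  have "(u, v) \<in> set ((gvert m k t j, attach m k s ed t j)
      # map (\<lambda>j'. (gvert m k t j, gvert m k t j')) (filter (\<lambda>j'. j' \<noteq> j) [0..<k])) \<longleftrightarrow>
    u = gvert m k t j \<and> (v = attach m k s ed t j \<or> (\<exists>j'<k. j' \<noteq> j \<and> v = gvert m k t j'))" for t j
    by auto
  then show ?thesis unfolding akc_edges_def concat by (simp only: conj_assoc)
qed

text \<open>One anchor for each of the \<open>q\<close> vertices of a clique, and one for the
  further vertex of the gadget of each of its \<open>q * q\<close> ordered pairs.\<close>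

definition akc_budget :: "nat \<Rightarrow> nat" where
  "akc_budget q = q + q * q"

definition akc_slots :: "nat \<Rightarrow> nat" where
  "akc_slots q = akc_budget q + 1"

text \<open>Every gadget that meets a core uses up an anchor and offers an original vertex at most
  \<open>2 * akc_slots q\<close> neighbours in it. As \<open>akc_slots\<close> exceeds the budget,
  all of them together stay below this degree.\<close>

definition akc_degree :: "nat \<Rightarrow> nat" where
  "akc_degree q = 2 * akc_slots q * akc_slots q"

text \<open>All anchors, and the unanchored clique vertices of \<open>q * q\<close> gadgets.\<close>

definition akc_target :: "nat \<Rightarrow> nat" where
  "akc_target q = akc_budget q + akc_degree q * (q * q)"

definition akc_order :: "nat \<Rightarrow> nat \<Rightarrow> (nat \<times> nat) list \<Rightarrow> nat" where
  "akc_order m k ed = m + length ed * (k + 1)"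

text \<open>The pair \<open>ed ! t\<close> is represented by a gadget: a clique on \<open>k = akc_degree q\<close> vertices
  together with one further vertex \<open>gvert m k t k\<close>. Every clique vertex has degree exactly \<open>k\<close>: it has
  one neighbour outside the clique, which is the first component of the pair, the second one, or the
  further vertex. The first two cases occur more often than there are anchors.\<close>

locale gadgets =
  fixes m q :: nat and ed :: "(nat \<times> nat) list"
  assumes dist: "distinct ed" and range: "set ed \<subseteq> {..<m} \<times> {..<m}" and q: "1 \<le> q"
begin

abbreviation "b \<equiv> akc_budget q"
abbreviation "s \<equiv> akc_slots q"
abbreviation "k \<equiv> akc_degree q"
abbreviation "p \<equiv> akc_target q"
abbreviation "n \<equiv> akc_order m k ed"
abbreviation "E \<equiv> edges_of (akc_edges m k s ed)"
abbreviation "gv \<equiv> gvert m k"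
abbreviation "at \<equiv> attach m k s ed"

section \<open>Inequalities between the constants, numbering of the gadget vertices\<close>

lemma b_ge: "2 \<le> b"
proof -
  have "1 * 1 \<le> q * q" using q by (intro mult_le_mono) auto
  then show ?thesis using q unfolding akc_budget_def by linarith
qed

lemma s_ge: "3 \<le> s"
  using b_ge by (simp add: akc_slots_def)

lemma b_less_s: "b < s"
  by (simp add: akc_slots_def)

lemma k_ge: "4 * s \<le> k"
proof -
  have "2 * s * 2 \<le> 2 * s * s" using s_ge by (intro mult_le_mono2) simp
  then show ?thesis unfolding akc_degree_def by simp
qed

lemma k_ge_3: "3 \<le> k"
  using k_ge s_ge by linarith

lemma gv_div: "j \<le> k \<Longrightarrow> (gv t j - m) div (k + 1) = t"
  using div_mult_self1[of "k + 1" j t] by (simp add: gvert_def add.commute del: mult_Suc_right)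

lemma gv_inj [simp]: "j \<le> k \<Longrightarrow> j' \<le> k \<Longrightarrow> gv t j = gv t' j' \<longleftrightarrow> t = t' \<and> j = j'"
  using gv_div[of j t] gv_div[of j' t'] by (auto simp: gvert_def)

lemma gv_ge: "m \<le> gv t j"
  by (simp add: gvert_def)

lemma gv_neq [simp]: "a < m \<Longrightarrow> gv t j \<noteq> a" "a < m \<Longrightarrow> a \<noteq> gv t j"
  using gv_ge[of t j] by auto

lemma gv_less: "t < length ed \<Longrightarrow> j \<le> k \<Longrightarrow> gv t j < n"
proof -
  assume "t < length ed" "j \<le> k"
  then have "Suc t * (k + 1) \<le> length ed * (k + 1)" by (intro mult_le_mono1) simp
  then show ?thesis using \<open>j \<le> k\<close> by (simp add: gvert_def akc_order_def)
qed

lemma vertex_cases: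
  assumes "v < n"
  obtains "v < m" | t j where "t < length ed" "j < k" "v = gv t j" | t where "t < length ed" "v = gv t k"
proof (cases "v < m")
  case False
  define t where "t = (v - m) div (k + 1)"
  define j where "j = (v - m) mod (k + 1)"
  have v: "v = gv t j" using False unfolding gvert_def t_def j_def
    by (metis add.assoc div_mult_mod_eq le_add_diff_inverse not_less)
  have "j \<le> k" unfolding j_def using mod_less_divisor[of "k + 1" "v - m"] by linarith
  moreover have "t < length ed" unfolding t_def using assms False
    unfolding akc_order_def by (intro less_mult_imp_div_less) linarith
  ultimately show ?thesis using that v by (cases "j = k") auto
qed (use that in auto)

lemma ed_range: "t < length ed \<Longrightarrow> fst (ed ! t) < m \<and> snd (ed ! t) < m"
  using subsetD[OF range nth_mem[of t ed]] by (simp add: mem_Times_iff)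

lemma at_neq: "t < length ed \<Longrightarrow> j < k \<Longrightarrow> at t j \<noteq> gv t' j'" if "j' < k"
  using ed_range[of t] that by (auto simp: attach_def)

section \<open>Edges and neighbourhoods of the gadget graph\<close>

lemma E_attach: "t < length ed \<Longrightarrow> j < k \<Longrightarrow> {gv t j, at t j} \<in> E"
  unfolding edges_of_def mem_Collect_eq
  by (intro exI conjI) (rule refl, unfold akc_edges_iff, intro exI conjI, assumption+, rule refl, rule disjI1, rule refl)

lemma E_clique: "t < length ed \<Longrightarrow> j < k \<Longrightarrow> j' < k \<Longrightarrow> j' \<noteq> j \<Longrightarrow> {gv t j, gv t j'} \<in> E"
  unfolding edges_of_def mem_Collect_eq
  by (intro exI conjI) (rule refl, unfold akc_edges_iff, intro exI conjI, assumption+, rule refl,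
    rule disjI2, intro exI conjI, assumption+, rule refl)

lemma E_cases:
  assumes "e \<in> E"
  obtains t j where "t < length ed" "j < k" "e = {gv t j, at t j}"
  | t j j' where "t < length ed" "j < k" "j' < k" "j' \<noteq> j" "e = {gv t j, gv t j'}"
proof -
  from assms obtain u v where e: "e = {u, v}" "(u, v) \<in> set (akc_edges m k s ed)"
    unfolding edges_of_def by auto
  from e(2) obtain t j where t: "t < length ed" "j < k" "u = gv t j"
    and v: "v = at t j \<or> (\<exists>j'<k. j' \<noteq> j \<and> v = gv t j')"
    unfolding akc_edges_iff by blast
  from v show thesis
  proof
    assume "v = at t j"
    then show thesis using that(1)[OF t(1,2)] e t by simp
  next
    assume "\<exists>j'<k. j' \<noteq> j \<and> v = gv t j'"
    then obtain j' where "j' < k" "j' \<noteq> j" "v = gv t j'" by blast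
    then show thesis using that(2)[OF t(1,2)] e t by simp
  qed
qed

lemma at_less: "t < length ed \<Longrightarrow> j < k \<Longrightarrow> at t j < n"
  using ed_range[of t] gv_less[of t k] by (auto simp: attach_def akc_order_def)

lemma simple: "simple_graph {..<n} E"
  unfolding simple_graph_def
proof (intro conjI ballI)
  fix e assume "e \<in> E"
  then show "e \<subseteq> {..<n}"
    by (cases rule: E_cases) (auto intro: gv_less at_less)
  show "card e = 2"
    using \<open>e \<in> E\<close> by (cases rule: E_cases) (use at_neq in \<open>simp_all add: card_insert_if eq_commute\<close>)
qed simp

lemma card_edge: "\<forall>e\<in>E. card e = 2"
  using simple by (simp add: simple_graph_def)

definition nbs :: "nat \<Rightarrow> nat \<Rightarrow> nat set" where
  "nbs t j = insert (at t j) (gv t ` ({..<k} - {j}))"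

lemma nbs: "t < length ed \<Longrightarrow> j < k \<Longrightarrow> {u. {gv t j, u} \<in> E} = nbs t j"
proof (intro equalityI subsetI)
  fix u assume t: "t < length ed" "j < k" and "u \<in> {u. {gv t j, u} \<in> E}"
  then have "{gv t j, u} \<in> E" by simp
  then show "u \<in> nbs t j"
  proof (cases rule: E_cases)
    case (1 t' j')
    have "at t' j' \<noteq> gv t j" using at_neq t 1 by simp
    then have "gv t j = gv t' j' \<and> u = at t' j'" using 1(3) by (auto simp: doubleton_eq_iff)
    then show ?thesis using t 1 by (auto simp: nbs_def)
  next
    case (2 t' i j')
    then have "gv t j = gv t' i \<and> u = gv t' j' \<or> gv t j = gv t' j' \<and> u = gv t' i"
      by (auto simp: doubleton_eq_iff)
    then show ?thesis using t 2 by (auto simp: nbs_def)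
  qed
next
  fix u assume t: "t < length ed" "j < k" and "u \<in> nbs t j"
  then show "u \<in> {u. {gv t j, u} \<in> E}" using E_attach[OF t(1,2)] E_clique[OF t(1,2)] by (auto simp: nbs_def)
qed

text \<open>The degree equals the bound with nothing to spare: a clique vertex that is not anchored
  pulls all its neighbours into the core.\<close>

lemma card_nbs: "t < length ed \<Longrightarrow> j < k \<Longrightarrow> card (nbs t j) = k"
proof -
  assume t: "t < length ed" "j < k"
  have "at t j \<notin> gv t ` ({..<k} - {j})" using at_neq t by auto
  moreover have "card (gv t ` ({..<k} - {j})) = k - 1"
    using t by (subst card_image) (auto simp: inj_on_def)
  ultimately show ?thesis using t by (simp add: nbs_def)
qed

lemma finite_nbs [simp]: "finite (nbs t j)"
  by (simp add: nbs_def)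

text \<open>This leaves at most \<open>k - 2 * s\<close> neighbours, so the further vertex can be in
  a core only as an anchor. It is the fee for using the gadget.\<close>

lemma nbs_further: "{u. {gv t k, u} \<in> E} \<subseteq> gv t ` {2 * s..<k}"
proof
  fix u assume "u \<in> {u. {gv t k, u} \<in> E}"
  then have "{gv t k, u} \<in> E" by simp
  then show "u \<in> gv t ` {2 * s..<k}"
  proof (cases rule: E_cases)
    case (1 t' j')
    then have "gv t k = at t' j' \<and> u = gv t' j'" by (auto simp: doubleton_eq_iff)
    then show ?thesis using 1 ed_range[of t'] by (auto simp: attach_def split: if_splits)
  qed (auto simp: doubleton_eq_iff)
qed

lemma nbs_vertex: "a < m \<Longrightarrow> {u. {a, u} \<in> E} \<subseteq> {gv t j | t j. t < length ed \<and> j < 2 * s}"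
proof
  fix u assume a: "a < m" "u \<in> {u. {a, u} \<in> E}"
  then have "{a, u} \<in> E" by simp
  then show "u \<in> {gv t j | t j. t < length ed \<and> j < 2 * s}"
  proof (cases rule: E_cases)
    case (1 t' j')
    then have eq: "a = at t' j' \<and> u = gv t' j'" using a by (auto simp: doubleton_eq_iff)
    have "j' < 2 * s"
    proof (rule ccontr)
      assume "\<not> j' < 2 * s"
      then have "at t' j' = gv t' k" by (simp add: attach_def)
      then show False using eq a gv_ge[of t' k] by simp
    qed
    then show ?thesis using 1 eq by blast
  qed (use a in \<open>auto simp: doubleton_eq_iff\<close>)
qed

text \<open>The core consists of \<open>R\<close> and the gadgets of all pairs in
  \<open>R \<times> R\<close>; anchored are \<open>R\<close> and the further vertices. Its size is
  exactly the target.\<close>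

lemma clique_imp_core:
  assumes R: "R \<subseteq> {..<m}" "card R = q" "R \<times> R \<subseteq> set ed"
  shows "anchored_core {..<n} E b k p"
proof -
  have fR: "finite R" using R(1) finite_subset by blast
  define T where "T = {t. t < length ed \<and> ed ! t \<in> R \<times> R}"
  have fT: "finite T" by (simp add: T_def)
  have "bij_betw ((!) ed) T (R \<times> R)"
  proof (rule bij_betw_imageI)
    show "inj_on ((!) ed) T" using dist by (auto simp: inj_on_def T_def nth_eq_iff_index_eq)
    show "(!) ed ` T = R \<times> R"
      using R(3) by (force simp: T_def in_set_conv_nth subset_iff image_iff)
  qed
  then have cT: "card T = q * q" using R(2) by (simp add: bij_betw_same_card card_cartesian_product)
  define G where "G = (\<lambda>(t, j). gv t j) ` (T \<times> {..k})"
  define B where "B = R \<union> (\<lambda>t. gv t k) ` T"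
  define H where "H = R \<union> G"
  have inj: "inj_on (\<lambda>(t, j). gv t j) (T \<times> {..k})" by (auto simp: inj_on_def)
  have cG: "card G = q * q * (k + 1)"
    unfolding G_def by (subst card_image[OF inj]) (simp add: card_cartesian_product cT)
  have gvR: "gv t j \<notin> R" for t j
    using subsetD[OF R(1), of "gv t j"] gv_ge[of t j] by auto
  then have "R \<inter> G = {}" by (auto simp: G_def)
  then have "card H = q + q * q * (k + 1)"
    unfolding H_def using fR R(2) cG by (subst card_Un_disjoint) (simp_all add: G_def fT)
  then have 1: "p \<le> card H" by (simp add: akc_target_def akc_budget_def algebra_simps)
  have "card B \<le> card R + card ((\<lambda>t. gv t k) ` T)" unfolding B_def by (rule card_Un_le)
  also have "card ((\<lambda>t. gv t k) ` T) \<le> card T" by (rule card_image_le[OF fT])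
  finally have 2: "card B \<le> b" using R(2) cT by (simp add: akc_budget_def)
  have 3: "B \<subseteq> H" by (auto simp: B_def H_def G_def)
  have "v < n" if "v \<in> H" for v
  proof -
    have "v \<in> R \<or> (\<exists>t\<in>T. \<exists>j\<le>k. v = gv t j)" using that by (auto simp: H_def G_def)
    then show ?thesis
    proof
      assume "v \<in> R"
      then have "v < m" using R(1) by auto
      then show ?thesis by (simp add: akc_order_def)
    qed (use gv_less in \<open>auto simp: T_def\<close>)
  qed
  then have 4: "H \<subseteq> {..<n}" by auto
  have 5: "degree (induced_edges E H) v \<ge> k" if v: "v \<in> H - B" for v
  proof -
    from v obtain t j where t: "t \<in> T" "j \<le> k" "v = gv t j" by (auto simp: H_def G_def B_def)
    then have j: "j < k" using v by (auto simp: B_def le_less)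
    have tl: "t < length ed" and et: "fst (ed ! t) \<in> R" "snd (ed ! t) \<in> R"
      using t(1) by (auto simp: T_def mem_Times_iff)
    have "nbs t j \<subseteq> H"
      using t(1) et tl unfolding nbs_def attach_def H_def G_def by auto
    then have "{u \<in> H. {v, u} \<in> E} = nbs t j" using nbs[OF tl j] t(3) by auto
    then show ?thesis using degree_induced[OF card_edge, of v H] v card_nbs[OF tl j] by simp
  qed
  show ?thesis unfolding anchored_core_def using 1 2 3 4 5 by blast
qed

text \<open>Let \<open>x\<close> be the number of original vertices in the core, all of them
  anchored, and \<open>y\<close> that of the gadgets with an unanchored clique vertex in it. The
  budget gives \<open>x + y \<le> q + q * q\<close>, the target gives \<open>q * q \<le> y\<close>,
  and as the pairs are distinct, \<open>y \<le> x * x\<close>. Together \<open>x = q\<close> and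
  \<open>y = q * q\<close>, so all pairs over the \<open>x\<close> vertices occur.\<close>

lemma core_imp_clique:
  assumes "anchored_core {..<n} E b k p"
  obtains R where "R \<subseteq> {..<m}" "card R = q" "R \<times> R \<subseteq> set ed"
proof -
  from assms obtain B H where BH: "B \<subseteq> H" "H \<subseteq> {..<n}" "card B \<le> b" "card H \<ge> p"
    and deg: "\<And>v. v \<in> H - B \<Longrightarrow> k \<le> degree (induced_edges E H) v"
    unfolding anchored_core_def by blast
  have fH: "finite H" using BH(2) finite_subset by blast
  have fB: "finite B" using BH(1) fH finite_subset by blast
  have deg': "k \<le> card {u \<in> H. {v, u} \<in> E}" if "v \<in> H" "v \<notin> B" for v
    using deg[of v] degree_induced[OF card_edge that(1)] that by simp
  have nbsH: "nbs t j \<subseteq> H" if "t < length ed" "j < k" "gv t j \<in> H" "gv t j \<notin> B" for t j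
  proof -
    have "{u \<in> H. {gv t j, u} \<in> E} \<subseteq> nbs t j" using nbs[OF that(1,2)] by auto
    moreover have "card (nbs t j) \<le> card {u \<in> H. {gv t j, u} \<in> E}"
      using deg'[OF that(3,4)] card_nbs[OF that(1,2)] by simp
    ultimately have "{u \<in> H. {gv t j, u} \<in> E} = nbs t j" by (intro card_seteq) auto
    then show ?thesis by auto
  qed
  have further: "gv t k \<in> B" if "gv t k \<in> H" for t
  proof (rule ccontr)
    assume "gv t k \<notin> B"
    from deg'[OF that this] have "k \<le> card {u \<in> H. {gv t k, u} \<in> E}" .
    also have "\<dots> \<le> card (gv t ` {2 * s..<k})"
      using nbs_further[of t] by (intro card_mono) auto
    also have "\<dots> \<le> card {2 * s..<k}" by (rule card_image_le) simp
    finally show False using k_ge s_ge by simp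
  qed
  have unanchored: "\<exists>j\<in>I. gv t j \<notin> B" if "I \<subseteq> {..<k}" "b < card I" for I t
  proof (rule ccontr)
    assume "\<not> (\<exists>j\<in>I. gv t j \<notin> B)"
    then have "gv t ` I \<subseteq> B" by auto
    then have "card (gv t ` I) \<le> card B" by (rule card_mono[OF fB])
    moreover have "card (gv t ` I) = card I"
      by (intro card_image) (simp add: inj_on_def gvert_def)
    ultimately show False using that(2) BH(3) by simp
  qed
  define Full where "Full = {t. t < length ed \<and> (\<exists>j<k. gv t j \<in> H \<and> gv t j \<notin> B)}"
  have full: "fst (ed ! t) \<in> H \<and> snd (ed ! t) \<in> H \<and> gv t k \<in> B" if "t \<in> Full" for t
  proof -
    from that obtain j where j: "t < length ed" "j < k" "gv t j \<in> H" "gv t j \<notin> B"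
      by (auto simp: Full_def)
    have all: "gv t j' \<in> H" if "j' < k" for j'
      using nbsH[OF j] j(3) that by (cases "j' = j") (auto simp: nbs_def)
    \<comment> \<open>Used for the positions attached to the first component, to the second one and
      to the further vertex. Each class has more than \<open>b\<close> members, hence an unanchored
      one, which pulls its attachment into \<open>H\<close>.\<close>
    have att: "\<exists>j'\<in>I. at t j' \<in> H" if "I \<subseteq> {..<k}" "b < card I" for I
    proof -
      from unanchored[OF that, of t] obtain j' where j': "j' \<in> I" "gv t j' \<notin> B" by blast
      then have "nbs t j' \<subseteq> H" using that all by (intro nbsH[OF j(1)]) auto
      then show ?thesis using j' by (auto simp: nbs_def)
    qed
    have "\<exists>j'\<in>{..<s}. at t j' \<in> H" by (rule att) (use k_ge b_less_s in auto)
    moreover have "\<exists>j'\<in>{s..<2 * s}. at t j' \<in> H" by (rule att) (use k_ge b_less_s in auto)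
    moreover have "\<exists>j'\<in>{2 * s..<k}. at t j' \<in> H" by (rule att) (use k_ge b_less_s in auto)
    ultimately show ?thesis using further[of t] j(1) by (auto simp: attach_def)
  qed
  define Touched where "Touched = {t. t < length ed \<and> (\<exists>j\<le>k. gv t j \<in> H)}"
  \<comment> \<open>A touched gadget contains an anchor: its further vertex is in \<open>H\<close>
    only as an anchor, and an unanchored clique vertex in \<open>H\<close> makes the gadget full,
    which anchors the further vertex.\<close>
  have "Touched \<subseteq> (\<lambda>x. (x - m) div (k + 1)) ` B"
  proof
    fix t assume "t \<in> Touched"
    then obtain j where j: "t < length ed" "j \<le> k" "gv t j \<in> H" by (auto simp: Touched_def)
    have "\<exists>j\<le>k. gv t j \<in> B"
    proof (cases "gv t j \<in> B \<or> j = k")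
      case True
      then show ?thesis using j further[of t] by auto
    next
      case False
      then have "j < k" using j by simp
      then have "t \<in> Full" using j False unfolding Full_def by blast
      then show ?thesis using full by blast
    qed
    then obtain i where i: "i \<le> k" "gv t i \<in> B" by blast
    show "t \<in> (\<lambda>x. (x - m) div (k + 1)) ` B"
      by (rule image_eqI[OF _ i(2)]) (rule gv_div[OF i(1), symmetric])
  qed
  then have "card Touched \<le> card B" using surj_card_le[OF fB] by blast
  then have cTouched: "card Touched \<le> b" using BH(3) by simp
  have vertex: "a \<in> B" if "a < m" "a \<in> H" for a
  proof (rule ccontr)
    assume "a \<notin> B"
    from deg'[OF that(2) this] have "k \<le> card {u \<in> H. {a, u} \<in> E}" .
    also have "\<dots> \<le> card ((\<lambda>(t, j). gv t j) ` (Touched \<times> {..<2 * s}))"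
    proof (rule card_mono)
      show "{u \<in> H. {a, u} \<in> E} \<subseteq> (\<lambda>(t, j). gv t j) ` (Touched \<times> {..<2 * s})"
      proof
        fix u assume u: "u \<in> {u \<in> H. {a, u} \<in> E}"
        with nbs_vertex[OF that(1)] obtain t j where t: "t < length ed" "j < 2 * s" "u = gv t j"
          by auto
        then have "t \<in> Touched" using u k_ge by (auto simp: Touched_def intro!: exI[of _ j])
        then show "u \<in> (\<lambda>(t, j). gv t j) ` (Touched \<times> {..<2 * s})" using t by auto
      qed
    qed (simp add: Touched_def)
    also have "\<dots> \<le> card (Touched \<times> {..<2 * s})" by (rule card_image_le) (simp add: Touched_def)
    also have "\<dots> \<le> b * (2 * s)" using cTouched by (simp add: card_cartesian_product)
    also have "\<dots> < s * (2 * s)" using b_less_s s_ge by (intro mult_less_mono1) auto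
    finally show False by (simp add: akc_degree_def mult.commute)
  qed
  define R where "R = {a \<in> H. a < m}"
  have fR: "finite R" and RB: "R \<subseteq> B" using fH vertex by (auto simp: R_def)
  have fF: "finite Full" by (simp add: Full_def)
  have "card ((\<lambda>t. gv t k) ` Full) = card Full" by (intro card_image) (auto simp: inj_on_def)
  moreover have "card (R \<union> (\<lambda>t. gv t k) ` Full) = card R + card ((\<lambda>t. gv t k) ` Full)"
    using fR fF gv_ge by (intro card_Un_disjoint) (auto simp: R_def not_less[symmetric])
  moreover have "card (R \<union> (\<lambda>t. gv t k) ` Full) \<le> card B"
    using RB full fB by (intro card_mono) auto
  ultimately have sum: "card R + card Full \<le> q + q * q" using BH(3) by (simp add: akc_budget_def)
  have "H - B \<subseteq> (\<lambda>(t, j). gv t j) ` (Full \<times> {..<k})"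
  proof
    fix v assume v: "v \<in> H - B"
    then have "v < n" using BH(2) by auto
    then show "v \<in> (\<lambda>(t, j). gv t j) ` (Full \<times> {..<k})"
    proof (cases rule: vertex_cases)
      case (2 t j)
      then show ?thesis using v by (auto simp: Full_def)
    qed (use v vertex further in auto)
  qed
  then have "card (H - B) \<le> card ((\<lambda>(t, j). gv t j) ` (Full \<times> {..<k}))"
    by (rule card_mono[rotated]) (simp add: fF)
  also have "\<dots> \<le> card (Full \<times> {..<k})" by (rule card_image_le) (simp add: fF)
  finally have "card (H - B) \<le> k * card Full" by (simp add: card_cartesian_product mult.commute)
  moreover have "p - b \<le> card (H - B)" using BH fB by (simp add: card_Diff_subset)
  ultimately have "k * (q * q) \<le> k * card Full" unfolding akc_target_def by linarith
  then have Full_ge: "q * q \<le> card Full" using k_ge_3 by simp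
  have inj: "inj_on ((!) ed) Full"
    using dist by (auto simp: inj_on_def Full_def nth_eq_iff_index_eq)
  have sub: "(!) ed ` Full \<subseteq> R \<times> R"
  proof (intro image_subsetI)
    fix t assume "t \<in> Full"
    then show "ed ! t \<in> R \<times> R"
      using full[of t] ed_range[of t] by (simp add: R_def mem_Times_iff Full_def)
  qed
  have "card ((!) ed ` Full) \<le> card (R \<times> R)" by (rule card_mono) (use fR sub in auto)
  then have "card Full \<le> card R * card R" using card_image[OF inj] by (simp add: card_cartesian_product)
  then have "q * q \<le> card R * card R" using Full_ge by simp
  then have "q \<le> card R" using mult_strict_mono'[of "card R" q "card R" q] by (meson not_le zero_le)
  moreover have "card R \<le> q" using sum Full_ge by simp
  ultimately have cR: "card R = q" by simp
  have "(!) ed ` Full = R \<times> R"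
    by (rule card_seteq) (use fR sub card_image[OF inj] Full_ge cR in \<open>auto simp: card_cartesian_product\<close>)
  moreover have "(!) ed ` Full \<subseteq> set ed" by (auto simp: Full_def)
  ultimately show ?thesis using that[of R] cR by (auto simp: R_def)
qed

end

section \<open>Recognising circuits\<close>

text \<open>The number that \<open>enc_gate\<close> stores in the left subtree, so that a program
  can distinguish the constructors.\<close>

definition gate_tag :: "gate \<Rightarrow> nat" where
  "gate_tag g = (case g of Input \<Rightarrow> 0 | NotG _ \<Rightarrow> 1 | AndG _ \<Rightarrow> 2 | OrG _ \<Rightarrow> 3)"

lemma gate_tag_eq_0: "gate_tag g = 0 \<longleftrightarrow> g = Input"
  by (cases g) (auto simp: gate_tag_def)

lemma pt_gate_tag [pt_intros]: "pt f \<Longrightarrow> pt (\<lambda>x. gate_tag (f x))"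
proof (rule pt_cong)
  assume "pt f"
  then show "pt (\<lambda>x. left_sub (enc (f x)))" by (intro pt_intros)
  show "enc (gate_tag (f x)) = enc (left_sub (enc (f x)))" for x
    by (cases "f x") (auto simp: gate_tag_def enc_tree_def enc_gate_def enc_nat_def)
qed

lemma pt_gate_args [pt_intros]: "pt f \<Longrightarrow> pt (\<lambda>x. gate_args (f x))"
proof (rule pt_cong)
  assume "pt f"
  \<comment> \<open>A negation stores a bare number, which is wrapped into a singleton list; for an
    input the right subtree \<open>Tip\<close> already is the empty list.\<close>
  then show "pt (\<lambda>x. if gate_tag (f x) = 1 then enc [right_sub (enc (f x))] else right_sub (enc (f x)))"
    by (intro pt_intros)
  show "enc (gate_args (f x)) = enc (if gate_tag (f x) = 1 then enc [right_sub (enc (f x))] else right_sub (enc (f x)))" for x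
    by (cases "f x") (auto simp: gate_tag_def enc_tree_def enc_gate_def enc_list_def enc_nat_def[abs_def])
qed

text \<open>Every tree encodes the list of the left subtrees along its rightmost branch. This view
  costs nothing and reduces the recognition of encoded lists to a test of the elements.\<close>

fun spine :: "tree \<Rightarrow> tree list" where
  "spine Tip = []"
| "spine (Br a b) = a # spine b"

lemma enc_spine [simp]: "enc (spine t) = t"
  by (induction t) (auto simp: enc_tree_def)

lemma pt_spine [pt_intros]: "pt f \<Longrightarrow> pt (\<lambda>x. spine (f x))"
  by (erule pt_cong) (simp, simp add: enc_tree_def)

lemma spine_range: "t \<in> range (enc_list e) \<longleftrightarrow> (\<forall>u\<in>set (spine t). u \<in> range e)"
proof
  assume "t \<in> range (enc_list e)"
  then obtain xs where "t = enc_list e xs" by blast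
  then show "\<forall>u\<in>set (spine t). u \<in> range e" by (induction xs arbitrary: t) auto
next
  assume "\<forall>u\<in>set (spine t). u \<in> range e"
  then show "t \<in> range (enc_list e)"
  proof (induction t)
    case Tip
    then show ?case using rangeI[of "enc_list e" "[]"] by simp
  next
    case (Br a b)
    then obtain x xs where "a = e x" "b = enc_list e xs" by auto
    then show ?case using rangeI[of "enc_list e" "x # xs"] by simp
  qed
qed

definition is_nat :: "tree \<Rightarrow> bool" where
  "is_nat t \<longleftrightarrow> (\<forall>u\<in>set (spine t). u = Tip)"

lemma is_nat_iff: "is_nat t \<longleftrightarrow> t \<in> range enc_nat"
proof -
  have 1: "enc_nat n = enc_list (\<lambda>_. Tip) (replicate n ())" for n
    by (induction n) auto
  have 2: "enc_list (\<lambda>_. Tip) xs = enc_nat (length xs)" for xs :: "unit list"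
    by (induction xs) auto
  have "range enc_nat = range (enc_list (\<lambda>_::unit. Tip))"
  proof (intro equalityI image_subsetI)
    show "enc_nat n \<in> range (enc_list (\<lambda>_::unit. Tip))" for n
      unfolding 1[of n] by (rule rangeI)
    show "enc_list (\<lambda>_::unit. Tip) xs \<in> range enc_nat" for xs
      unfolding 2[of xs] by (rule rangeI)
  qed
  then show ?thesis by (simp add: is_nat_def spine_range)
qed

definition is_gate :: "tree \<Rightarrow> bool" where
  "is_gate t \<longleftrightarrow> t \<noteq> Tip \<and>
     (left_sub t = enc_nat 0 \<and> right_sub t = Tip
      \<or> left_sub t = enc_nat 1 \<and> is_nat (right_sub t)
      \<or> (left_sub t = enc_nat 2 \<or> left_sub t = enc_nat 3) \<and> (\<forall>u\<in>set (spine (right_sub t)). is_nat u))"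

lemma is_gate_iff: "is_gate t \<longleftrightarrow> t \<in> range enc_gate"
proof
  assume g: "is_gate t"
  then obtain a b where t: "t = Br a b" by (cases t) (auto simp: is_gate_def)
  have list: "\<forall>u\<in>set (spine b). is_nat u \<Longrightarrow> \<exists>js. b = enc_list enc_nat js"
    using spine_range[of b enc_nat] by (auto simp: is_nat_iff)
  from g t consider "t = enc_gate Input" | j where "t = enc_gate (NotG j)"
    | js where "t = enc_gate (AndG js)" | js where "t = enc_gate (OrG js)"
    using list by (auto simp: is_gate_def is_nat_iff)
  then show "t \<in> range enc_gate" by cases (simp_all only: rangeI)
next
  assume "t \<in> range enc_gate"
  then obtain g where t: "t = enc_gate g" by blast
  have "\<forall>u\<in>set (spine (enc_list enc_nat js)). is_nat u" for js
    using spine_range[of "enc_list enc_nat js" enc_nat] by (auto simp: is_nat_iff)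
  then show "is_gate t" unfolding t by (cases g) (auto simp: is_gate_def is_nat_iff)
qed

definition is_circuit :: "tree \<Rightarrow> bool" where
  "is_circuit t \<longleftrightarrow> (\<forall>u\<in>set (spine t). is_gate u)"

lemma is_circuit_iff: "is_circuit t \<longleftrightarrow> t \<in> range enc_circuit"
  unfolding enc_circuit_def spine_range by (simp add: is_circuit_def is_gate_iff)

lemma pt_is_circuit [pt_intros]: "pt f \<Longrightarrow> pt (\<lambda>x. is_circuit (f x))"
proof (rule pt_comp[of is_circuit])
  have 1: "pt is_nat" unfolding is_nat_def by (intro pt_intros)
  have 2: "pt is_gate" unfolding is_gate_def by (intro pt_intros pt_comp[OF 1])
  show "pt is_circuit" unfolding is_circuit_def by (intro pt_intros pt_comp[OF 2])
qed

text \<open>On trees that encode circuits this does not change the tree, so its computation amounts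
  to the test \<open>is_circuit\<close>. The value elsewhere is not a well-formed circuit.\<close>

definition circuit_of :: "tree \<Rightarrow> circuit" where
  "circuit_of t = (if is_circuit t then inv enc_circuit t else [])"

lemma inj_enc_circuit: "inj enc_circuit"
  by (rule injI) (simp add: enc_circuit_inject)

lemma circuit_of_enc [simp]: "circuit_of (enc_circuit C) = C"
  by (simp add: circuit_of_def is_circuit_iff inj_enc_circuit)

lemma enc_circuit_of: "enc (circuit_of t) = (if is_circuit t then t else Tip)"
proof -
  have "enc C = enc_circuit C" for C :: circuit
    by (simp add: enc_list_def enc_circuit_def enc_gate_def[abs_def])
  moreover have "enc_circuit [] = Tip" by (simp add: enc_circuit_def)
  ultimately show ?thesis by (auto simp: circuit_of_def is_circuit_iff f_inv_into_f)
qed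

lemma pt_circuit_of [pt_intros]: "pt f \<Longrightarrow> pt (\<lambda>x. circuit_of (f x))"
proof (rule pt_comp[of circuit_of])
  show "pt circuit_of"
  proof (rule pt_cong)
    show "pt (\<lambda>t. if is_circuit t then t else Tip)" by (intro pt_intros)
  qed (simp add: enc_circuit_of enc_tree_def)
qed

lemma wf_circuit_get: "wf_circuit C \<longleftrightarrow> C \<noteq> [] \<and>
  (\<forall>i\<in>set [0..<length C]. (\<forall>j\<in>set (gate_args (get C i)). j < i) \<and>
     (gate_tag (get C i) \<noteq> 0 \<longrightarrow> gate_args (get C i) \<noteq> []))"
  by (auto simp: wf_circuit_def gate_tag_eq_0)

lemma pt_wf_circuit [pt_intros]: "pt f \<Longrightarrow> pt (\<lambda>x. wf_circuit (f x))"
proof (rule pt_comp[of wf_circuit])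
  show "pt wf_circuit" unfolding wf_circuit_get by (intro pt_intros)
qed

section \<open>Normal forms of circuits of weft one\<close>

text \<open>In a clause \<open>(P, N)\<close> the variables in \<open>P\<close> occur negated, those in \<open>N\<close> unnegated.\<close>

type_synonym clause = "nat list \<times> nat list"
type_synonym cnf = "clause list"

definition sat_clause :: "nat set \<Rightarrow> clause \<Rightarrow> bool" where
  "sat_clause X c \<longleftrightarrow> (set (fst c) \<subseteq> X \<longrightarrow> set (snd c) \<inter> X \<noteq> {})"

definition sat_cnf :: "nat set \<Rightarrow> cnf \<Rightarrow> bool" where
  "sat_cnf X U \<longleftrightarrow> (\<forall>c\<in>set U. sat_clause X c)"

definition sat_some :: "nat set \<Rightarrow> cnf list \<Rightarrow> bool" where
  "sat_some X A \<longleftrightarrow> (\<exists>U\<in>set A. sat_cnf X U)"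

text \<open>A representation \<open>(ok, small, A, A')\<close> of a gate expresses the gate by \<open>A\<close> and its negation by
  \<open>A'\<close>. It is \<open>small\<close> if no large gate is involved; then \<open>A\<close> and \<open>A'\<close> consist of one formula each.
  If \<open>ok\<close> is false, the bound on the depth or on the weft is violated and the rest is meaningless.\<close>

type_synonym rep = "bool \<times> bool \<times> cnf list \<times> cnf list"

definition rep_ok :: "rep \<Rightarrow> bool" where "rep_ok r = fst r"
definition rep_small :: "rep \<Rightarrow> bool" where "rep_small r = fst (snd r)"
definition rep_pos :: "rep \<Rightarrow> cnf list" where "rep_pos r = fst (snd (snd r))"
definition rep_neg :: "rep \<Rightarrow> cnf list" where "rep_neg r = snd (snd (snd r))"

lemmas rep_sel = rep_ok_def rep_small_def rep_pos_def rep_neg_def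

definition rep_not :: "rep \<Rightarrow> rep" where
  "rep_not r = (rep_ok r, rep_small r, rep_neg r, rep_pos r)"

text \<open>Distributivity: clauses are joined pairwise and their widths add up.\<close>

definition cnf_or :: "cnf \<Rightarrow> cnf \<Rightarrow> cnf" where
  "cnf_or U V = concat (map (\<lambda>c. map (\<lambda>c'. (fst c @ fst c', snd c @ snd c')) V) U)"

definition cnf_prod :: "cnf list \<Rightarrow> cnf list \<Rightarrow> cnf list" where
  "cnf_prod A B = concat (map (\<lambda>U. map (\<lambda>V. U @ V) B) A)"

text \<open>For small arguments the negation is merged into a single formula by distributivity,
  which keeps the result small. Otherwise the disjunction remains a list of alternatives, to which
  nothing wider is added.\<close>

definition rep_and2 :: "rep \<Rightarrow> rep \<Rightarrow> rep" where
  "rep_and2 r r' = (rep_ok r \<and> rep_ok r', rep_small r \<and> rep_small r',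
     cnf_prod (rep_pos r) (rep_pos r'),
     if rep_small r \<and> rep_small r' then [cnf_or (concat (rep_neg r)) (concat (rep_neg r'))]
     else rep_neg r @ rep_neg r')"

text \<open>\<open>hd\<close> and \<open>last\<close> cover gates with one and with two arguments
  alike. A large gate insists on small arguments: their single formulas can be concatenated, whereas
  a product of unboundedly many lists of alternatives would have exponential size.\<close>

definition rep_and :: "rep list \<Rightarrow> rep" where
  "rep_and rs = (if 2 < length rs
     then (\<forall>r\<in>set rs. rep_ok r \<and> rep_small r, False,
       [concat (map (\<lambda>r. concat (rep_pos r)) rs)], concat (map rep_neg rs))
     else rep_and2 (hd rs) (last rs))"

definition rep_input :: "nat \<Rightarrow> rep" where
  "rep_input i = (True, True, [[([], [i])]], [[([i], [])]])"

definition rep_bad :: rep where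
  "rep_bad = (False, True, [], [])"

text \<open>The number \<open>h\<close> bounds the depth. It is a constant of the reduction, so that the
  recursion preserves polynomial time.\<close>

fun rep_gate :: "circuit \<Rightarrow> nat \<Rightarrow> nat \<Rightarrow> rep" where
  "rep_gate C 0 i = (if gate_tag (get C i) = 0 then rep_input i else rep_bad)"
| "rep_gate C (Suc h) i =
    (if gate_tag (get C i) = 0 then rep_input i
     else if gate_tag (get C i) = 1 then rep_not (rep_and (map (\<lambda>j. rep_gate C h j) (gate_args (get C i))))
     else if gate_tag (get C i) = 2 then rep_and (map (\<lambda>j. rep_gate C h j) (gate_args (get C i)))
     else rep_not (rep_and (map rep_not (map (\<lambda>j. rep_gate C h j) (gate_args (get C i))))))"

lemma pt_rep_sel [pt_intros]:
  "pt f \<Longrightarrow> pt (\<lambda>x. rep_ok (f x))"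
  "pt f \<Longrightarrow> pt (\<lambda>x. rep_small (f x))"
  "pt f \<Longrightarrow> pt (\<lambda>x. rep_pos (f x))"
  "pt f \<Longrightarrow> pt (\<lambda>x. rep_neg (f x))"
  unfolding rep_sel by (intro pt_intros; assumption)+

lemma pt_rep_not [pt_intros]: "pt f \<Longrightarrow> pt (\<lambda>x. rep_not (f x))"
  unfolding rep_not_def by (intro pt_intros)

lemma pt_cnf_or [pt_intros]: "pt f \<Longrightarrow> pt g \<Longrightarrow> pt (\<lambda>x. cnf_or (f x) (g x))"
  by (rule pt_comp2[of cnf_or]) (unfold cnf_or_def, intro pt_intros)

lemma pt_cnf_prod [pt_intros]: "pt f \<Longrightarrow> pt g \<Longrightarrow> pt (\<lambda>x. cnf_prod (f x) (g x))"
  by (rule pt_comp2[of cnf_prod]) (unfold cnf_prod_def, intro pt_intros)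

lemma pt_rep_and2 [pt_intros]: "pt f \<Longrightarrow> pt g \<Longrightarrow> pt (\<lambda>x. rep_and2 (f x) (g x))"
  by (rule pt_comp2[of rep_and2]) (unfold rep_and2_def, intro pt_intros)

lemma pt_rep_and [pt_intros]: "pt f \<Longrightarrow> pt (\<lambda>x. rep_and (f x))"
  by (rule pt_comp[of rep_and]) (unfold rep_and_def, intro pt_intros)

lemma pt_rep_input [pt_intros]: "pt f \<Longrightarrow> pt (\<lambda>x. rep_input (f x))"
  unfolding rep_input_def by (intro pt_intros)

lemma pt_rep_gate [pt_intros]: "pt f \<Longrightarrow> pt g \<Longrightarrow> pt (\<lambda>x. rep_gate (f x) h (g x))"
proof (rule pt_comp2[of "\<lambda>C. rep_gate C h"])
  show "pt (\<lambda>z. rep_gate (fst z) h (snd z))"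
  proof (induction h)
    case 0
    show ?case unfolding rep_gate.simps by (intro pt_intros)
  next
    case (Suc h)
    show ?case unfolding rep_gate.simps by (intro pt_intros pt_comp2[OF Suc])
  qed
qed

section \<open>Correctness and clause width of the representations\<close>

definition rep_sem :: "nat \<Rightarrow> nat set \<Rightarrow> nat \<Rightarrow> bool \<Rightarrow> rep \<Rightarrow> bool" where
  "rep_sem M X w v r \<longleftrightarrow> (rep_ok r \<longrightarrow>
     sat_some X (rep_pos r) = v \<and> sat_some X (rep_neg r) = (\<not> v) \<and>
     (rep_small r \<longrightarrow> length (rep_pos r) = 1 \<and> length (rep_neg r) = 1) \<and>
     (\<forall>U\<in>set (rep_pos r) \<union> set (rep_neg r). \<forall>c\<in>set U.
        length (fst c) \<le> w \<and> length (snd c) \<le> w \<and> set (fst c) \<union> set (snd c) \<subseteq> {..<M}))"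

lemma rep_sem_not: "rep_sem M X w v r \<Longrightarrow> rep_sem M X w (\<not> v) (rep_not r)"
  by (auto simp: rep_sem_def rep_not_def rep_sel)

lemma sat_cnf_append: "sat_cnf X (U @ V) \<longleftrightarrow> sat_cnf X U \<and> sat_cnf X V"
  by (auto simp: sat_cnf_def)

lemma sat_cnf_or: "sat_cnf X (cnf_or U V) \<longleftrightarrow> sat_cnf X U \<or> sat_cnf X V"
proof -
  have "sat_clause X (fst c @ fst c', snd c @ snd c') \<longleftrightarrow> sat_clause X c \<or> sat_clause X c'" for c c'
    by (auto simp: sat_clause_def)
  then have "sat_cnf X (cnf_or U V) \<longleftrightarrow> (\<forall>c\<in>set U. \<forall>c'\<in>set V. sat_clause X c \<or> sat_clause X c')"
    by (simp add: sat_cnf_def cnf_or_def)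
  then show ?thesis by (auto simp: sat_cnf_def)
qed

lemma sat_some_prod: "sat_some X (cnf_prod A B) \<longleftrightarrow> sat_some X A \<and> sat_some X B"
  by (auto simp: sat_some_def cnf_prod_def sat_cnf_append)

lemma sat_some_append: "sat_some X (A @ B) \<longleftrightarrow> sat_some X A \<or> sat_some X B"
  by (auto simp: sat_some_def)

lemma sat_some_concat: "sat_some X (concat As) \<longleftrightarrow> (\<exists>A\<in>set As. sat_some X A)"
  by (auto simp: sat_some_def)

lemma sat_cnf_concat: "sat_cnf X (concat Us) \<longleftrightarrow> (\<forall>U\<in>set Us. sat_cnf X U)"
  by (auto simp: sat_cnf_def)

lemma sat_cnf_concat_single: "length A = 1 \<Longrightarrow> sat_cnf X (concat A) \<longleftrightarrow> sat_some X A"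
  by (auto simp: length_Suc_conv sat_some_def)

lemma rep_and2_sel:
  "rep_ok (rep_and2 r r') \<longleftrightarrow> rep_ok r \<and> rep_ok r'"
  "rep_small (rep_and2 r r') \<longleftrightarrow> rep_small r \<and> rep_small r'"
  "rep_pos (rep_and2 r r') = cnf_prod (rep_pos r) (rep_pos r')"
  "rep_neg (rep_and2 r r') = (if rep_small r \<and> rep_small r'
     then [cnf_or (concat (rep_neg r)) (concat (rep_neg r'))] else rep_neg r @ rep_neg r')"
  by (simp_all add: rep_and2_def rep_sel)

lemma rep_sem_and2:
  assumes "rep_sem M X w v r" "rep_sem M X w v' r'"
  shows "rep_sem M X (2 * w) (v \<and> v') (rep_and2 r r')"
proof (cases "rep_ok r \<and> rep_ok r'")
  case True
  let ?W = "\<lambda>w c. length (fst c) \<le> w \<and> length (snd c) \<le> w \<and> set (fst c) \<union> set (snd c) \<subseteq> {..<M}"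
  note r = assms[unfolded rep_sem_def, rule_format]
  have w: "?W w c" if "U \<in> set (rep_pos r) \<union> set (rep_neg r) \<union> set (rep_pos r') \<union> set (rep_neg r')"
    "c \<in> set U" for U c
    using r that True by blast
  have wpos: "?W (2 * w) c" if "U \<in> set (rep_pos (rep_and2 r r'))" "c \<in> set U" for U c
  proof -
    from that have "\<exists>V \<in> set (rep_pos r) \<union> set (rep_pos r'). c \<in> set V"
      unfolding rep_and2_sel cnf_prod_def by auto
    then obtain V where "V \<in> set (rep_pos r) \<union> set (rep_pos r')" "c \<in> set V" by blast
    then show ?thesis using w[of V c] by auto
  qed
  have wneg: "?W (2 * w) c" if c: "U \<in> set (rep_neg (rep_and2 r r'))" "c \<in> set U" for U c
  proof (cases "rep_small r \<and> rep_small r'")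
    case True
    then have "c \<in> set (cnf_or (concat (rep_neg r)) (concat (rep_neg r')))"
      using c by (simp add: rep_and2_sel)
    then have "\<exists>d\<in>set (concat (rep_neg r)). \<exists>d'\<in>set (concat (rep_neg r')). c = (fst d @ fst d', snd d @ snd d')"
      unfolding cnf_or_def by auto
    then obtain V V' d d' where "V \<in> set (rep_neg r)" "d \<in> set V" "V' \<in> set (rep_neg r')" "d' \<in> set V'"
      "c = (fst d @ fst d', snd d @ snd d')"
      by auto
    then show ?thesis using w[of V d] w[of V' d'] by auto
  next
    case False
    then have "U \<in> set (rep_neg r) \<union> set (rep_neg r')"
      using c(1) by (auto simp add: rep_and2_sel)
    then show ?thesis using w[of U c] c(2) by auto
  qed
  have pos: "sat_some X (rep_pos (rep_and2 r r')) = (v \<and> v')"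
    using r True by (simp add: rep_and2_sel sat_some_prod)
  have neg: "sat_some X (rep_neg (rep_and2 r r')) = (\<not> (v \<and> v'))"
  proof (cases "rep_small r \<and> rep_small r'")
    case s: True
    have "sat_some X (rep_neg (rep_and2 r r')) = (sat_cnf X (concat (rep_neg r)) \<or> sat_cnf X (concat (rep_neg r')))"
      using s by (simp add: rep_and2_sel sat_some_def sat_cnf_or)
    then show ?thesis using r True s by (simp add: sat_cnf_concat_single)
  next
    case False
    then have "rep_neg (rep_and2 r r') = rep_neg r @ rep_neg r'"
      by (auto simp add: rep_and2_sel)
    then show ?thesis using r True by (simp add: sat_some_append)
  qed
  have small: "length (rep_pos (rep_and2 r r')) = 1 \<and> length (rep_neg (rep_and2 r r')) = 1"
    if "rep_small (rep_and2 r r')"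
  proof -
    have s: "rep_small r" "rep_small r'" using that by (auto simp: rep_and2_sel)
    then have "length (rep_pos r) = 1" "length (rep_pos r') = 1" using r True by auto
    then show ?thesis using s by (auto simp: rep_and2_sel cnf_prod_def length_Suc_conv)
  qed
  show ?thesis unfolding rep_sem_def using wpos wneg pos neg small by blast
qed (auto simp add: rep_sem_def rep_and2_sel)

lemma list_le_2:
  assumes "js \<noteq> []" "\<not> 2 < length js"
  shows "set js = {hd js, last js}"
proof (cases js)
  case (Cons a l)
  then show ?thesis using assms by (cases l) auto
qed (use assms in simp)

lemma rep_sem_and:
  assumes "\<And>j. j \<in> set js \<Longrightarrow> rep_sem M X w (v j) (R j)" "js \<noteq> []"
  shows "rep_sem M X (2 * w) (\<forall>j\<in>set js. v j) (rep_and (map R js))"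
proof (cases "2 < length js")
  case True
  let ?r = "rep_and (map R js)"
  have r: "?r = (\<forall>j\<in>set js. rep_ok (R j) \<and> rep_small (R j), False,
    [concat (map (\<lambda>j. concat (rep_pos (R j))) js)], concat (map (\<lambda>j. rep_neg (R j)) js))"
    using True by (simp add: rep_and_def comp_def)
  show ?thesis
  proof (cases "\<forall>j\<in>set js. rep_ok (R j) \<and> rep_small (R j)")
    case ok: True
    note j = assms(1)[unfolded rep_sem_def, rule_format]
    have pos: "sat_some X (rep_pos ?r) = (\<forall>j\<in>set js. v j)"
    proof -
      have "sat_some X (rep_pos ?r) = (\<forall>j\<in>set js. sat_cnf X (concat (rep_pos (R j))))"
        unfolding r by (simp add: rep_pos_def[of "(_, _)"] sat_some_def sat_cnf_concat)
      \<comment> \<open>A small argument has a single alternative, so flattening its list does not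
        turn a disjunction into a conjunction.\<close>
      also have "\<dots> = (\<forall>j\<in>set js. v j)"
        using ok j by (intro ball_cong refl) (simp add: sat_cnf_concat_single)
      finally show ?thesis .
    qed
    have neg: "sat_some X (rep_neg ?r) = (\<not> (\<forall>j\<in>set js. v j))"
    proof -
      have "sat_some X (rep_neg ?r) = (\<exists>j\<in>set js. sat_some X (rep_neg (R j)))"
        unfolding r by (auto simp add: rep_neg_def[of "(_, _)"] sat_some_concat)
      also have "\<dots> = (\<exists>j\<in>set js. \<not> v j)"
        using ok j by (intro bex_cong refl) simp
      finally show ?thesis by blast
    qed
    have w: "length (fst c) \<le> 2 * w \<and> length (snd c) \<le> 2 * w \<and> set (fst c) \<union> set (snd c) \<subseteq> {..<M}"
      if U: "U \<in> set (rep_pos ?r) \<union> set (rep_neg ?r)" "c \<in> set U" for U c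
    proof -
      from U have "\<exists>i\<in>set js. \<exists>V\<in>set (rep_pos (R i)) \<union> set (rep_neg (R i)). c \<in> set V"
        unfolding r rep_pos_def[of "(_, _)"] rep_neg_def[of "(_, _)"] by fastforce
      then obtain i V where V: "i \<in> set js" "V \<in> set (rep_pos (R i)) \<union> set (rep_neg (R i))" "c \<in> set V"
        by blast
      then have "length (fst c) \<le> w \<and> length (snd c) \<le> w \<and> set (fst c) \<union> set (snd c) \<subseteq> {..<M}"
        using ok j by blast
      then show ?thesis by simp
    qed
    have "\<not> rep_small ?r" unfolding r by (simp add: rep_small_def)
    then show ?thesis unfolding rep_sem_def using pos neg w by blast
  next
    case ok: False
    then have "\<not> rep_ok ?r" unfolding r by (simp add: rep_ok_def[of "(_, _)"])
    then show ?thesis by (simp add: rep_sem_def)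
  qed
next
  case False
  have "set js = {hd js, last js}" by (rule list_le_2[OF assms(2) False])
  then have hl: "hd js \<in> set js" "last js \<in> set js" "(\<forall>j\<in>set js. v j) = (v (hd js) \<and> v (last js))"
    by auto
  have "rep_and (map R js) = rep_and2 (R (hd js)) (R (last js))"
    using False assms(2) by (simp add: rep_and_def hd_map last_map)
  then show ?thesis using rep_sem_and2[OF assms(1)[OF hl(1)] assms(1)[OF hl(2)]] hl(3) by simp
qed

lemma wf_circuitD:
  assumes "wf_circuit C" "i < length C"
  shows "\<And>j. j \<in> set (gate_args (C ! i)) \<Longrightarrow> j < i"
    and "C ! i \<noteq> Input \<Longrightarrow> gate_args (C ! i) \<noteq> []"
  using assms by (auto simp: wf_circuit_def)

lemma rep_sem_input: "i < M \<Longrightarrow> 1 \<le> w \<Longrightarrow> rep_sem M X w (i \<in> X) (rep_input i)"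
  by (auto simp: rep_sem_def rep_input_def rep_sel sat_some_def sat_cnf_def sat_clause_def)

text \<open>Each level at most doubles the width, whence \<open>2 ^ h\<close>. A negation is treated
  as a negated conjunction of one argument and a disjunction by De Morgan, so the conjunction is the
  only connective to analyse.\<close>

lemma rep_sem_gate:
  assumes wf: "wf_circuit C"
  shows "i < length C \<Longrightarrow> rep_sem (length C) X (2 ^ h) (gate_val C X i) (rep_gate C h i)"
proof (induction h arbitrary: i)
  case 0
  show ?case
  proof (cases "C ! i")
    case Input
    then have "gate_val C X i = (i \<in> X)" by (simp add: gate_val.simps)
    then show ?thesis using Input 0 rep_sem_input[of i "length C" 1 X] by (simp add: gate_tag_def)
  qed (use 0 in \<open>simp_all add: gate_tag_def rep_sem_def rep_bad_def rep_ok_def\<close>)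
next
  case (Suc h)
  have args: "j < i" "rep_sem (length C) X (2 ^ h) (gate_val C X j) (rep_gate C h j)"
    if "j \<in> set (gate_args (C ! i))" for j
    using Suc.IH[of j] wf_circuitD(1)[OF wf Suc.prems that] Suc.prems by auto
  have ne: "C ! i \<noteq> Input \<Longrightarrow> gate_args (C ! i) \<noteq> []" using wf_circuitD(2)[OF wf Suc.prems] .
  show ?case
  proof (cases "C ! i")
    case Input
    then have "gate_val C X i = (i \<in> X)" by (simp add: gate_val.simps)
    then show ?thesis using Input Suc.prems rep_sem_input[of i "length C" "2 ^ Suc h" X] by (simp add: gate_tag_def)
  next
    case (NotG j)
    have "gate_val C X i = (\<not> (\<forall>j\<in>set [j]. gate_val C X j))"
      using NotG args(1)[of j] by (simp add: gate_val.simps[of C X i])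
    then show ?thesis
      using NotG Suc.prems rep_sem_not[OF rep_sem_and[of "[j]", OF args(2)]] by (simp add: gate_tag_def)
  next
    case (AndG js)
    have "gate_val C X i = (\<forall>j\<in>set js. gate_val C X j)"
      using AndG args(1) by (auto simp add: gate_val.simps[of C X i])
    then show ?thesis
      using AndG Suc.prems ne rep_sem_and[of js, OF args(2)] by (simp add: gate_tag_def)
  next
    case (OrG js)
    have "gate_val C X i = (\<not> (\<forall>j\<in>set js. \<not> gate_val C X j))"
      using OrG args(1) by (auto simp add: gate_val.simps[of C X i])
    then show ?thesis
      using OrG Suc.prems ne rep_sem_not[OF rep_sem_and[of js, OF rep_sem_not[OF args(2)]]]
      by (simp add: gate_tag_def comp_def)
  qed
qed

subsection \<open>Depth and weft\<close>

text \<open>\<open>io_path\<close> with an arbitrary last gate, as an induction along the circuit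
  requires.\<close>

definition gate_path :: "circuit \<Rightarrow> nat list \<Rightarrow> nat \<Rightarrow> bool" where
  "gate_path C p i \<longleftrightarrow> p \<noteq> [] \<and> set p \<subseteq> {..<length C} \<and> hd p \<in> circuit_inputs C \<and> last p = i \<and>
     successively (\<lambda>j i. j \<in> set (gate_args (C ! i))) p"

definition num_large :: "circuit \<Rightarrow> nat list \<Rightarrow> nat" where
  "num_large C p = length (filter (\<lambda>i. large_gate (C ! i)) p)"

lemma io_path_eq: "io_path C p \<longleftrightarrow> gate_path C p (length C - 1)"
  by (auto simp: io_path_def gate_path_def)

lemma gate_path_input:
  assumes "i < length C" "C ! i = Input"
  shows "gate_path C p i \<longleftrightarrow> p = [i]"
proof
  assume p: "gate_path C p i"
  then have "p = butlast p @ [i]" by (metis append_butlast_last_id gate_path_def)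
  moreover have "butlast p = []"
  proof (rule ccontr)
    assume "butlast p \<noteq> []"
    then have "last (butlast p) \<in> set (gate_args (C ! i))"
      using p \<open>p = butlast p @ [i]\<close> successively_append_iff[of _ "butlast p" "[i]"]
      unfolding gate_path_def by (metis list.sel(1) list.distinct(1))
    then show False using assms(2) by simp
  qed
  ultimately show "p = [i]" by simp
qed (use assms in \<open>auto simp: gate_path_def circuit_inputs_def\<close>)

lemma gate_path_step:
  assumes "i < length C" "C ! i \<noteq> Input"
  shows "gate_path C p i \<longleftrightarrow> (\<exists>q j. j \<in> set (gate_args (C ! i)) \<and> gate_path C q j \<and> p = q @ [i])"
proof
  assume p: "gate_path C p i"
  then have eq: "p = butlast p @ [i]" by (metis append_butlast_last_id gate_path_def)
  have ne: "butlast p \<noteq> []"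
  proof
    assume "butlast p = []"
    then have "p = [i]" using eq by simp
    then show False using p assms by (simp add: gate_path_def circuit_inputs_def)
  qed
  let ?q = "butlast p"
  have "successively (\<lambda>j i. j \<in> set (gate_args (C ! i))) (?q @ [i])" using p eq by (simp add: gate_path_def)
  then have "successively (\<lambda>j i. j \<in> set (gate_args (C ! i))) ?q" "last ?q \<in> set (gate_args (C ! i))"
    using ne by (auto simp: successively_append_iff)
  moreover have "set ?q \<subseteq> {..<length C}" using p by (auto simp: gate_path_def dest: in_set_butlastD)
  moreover have "hd ?q \<in> circuit_inputs C" using p eq ne by (metis gate_path_def hd_append2)
  ultimately have "gate_path C ?q (last ?q)" "last ?q \<in> set (gate_args (C ! i))"
    using ne by (auto simp: gate_path_def)
  then show "\<exists>q j. j \<in> set (gate_args (C ! i)) \<and> gate_path C q j \<and> p = q @ [i]" using eq by blast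
next
  assume "\<exists>q j. j \<in> set (gate_args (C ! i)) \<and> gate_path C q j \<and> p = q @ [i]"
  then show "gate_path C p i" using assms by (auto simp: gate_path_def successively_append_iff)
qed

text \<open>Nonempty argument lists lead back to an input. For the output gate this ensures that the
  maxima in \<open>depth\<close> and \<open>weft\<close> are not taken over the empty set.\<close>

lemma gate_path_exists: "wf_circuit C \<Longrightarrow> i < length C \<Longrightarrow> \<exists>p. gate_path C p i"
proof (induction i rule: less_induct)
  case (less i)
  show ?case
  proof (cases "C ! i = Input")
    case False
    then obtain j where j: "j \<in> set (gate_args (C ! i))"
      using wf_circuitD(2)[OF less.prems] by (meson last_in_set)
    then have "j < i" by (rule wf_circuitD(1)[OF less.prems])
    then obtain q where "gate_path C q j" using less by (meson less_trans)
    then show ?thesis using gate_path_step[OF less.prems(2) False] j by blast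
  qed (use gate_path_input less.prems in blast)
qed

lemma rep_and_ok:
  assumes "js \<noteq> []"
  shows "rep_ok (rep_and (map R js)) \<longleftrightarrow> (\<forall>j\<in>set js. rep_ok (R j) \<and> (2 < length js \<longrightarrow> rep_small (R j)))"
    and "rep_small (rep_and (map R js)) \<longleftrightarrow> \<not> 2 < length js \<and> (\<forall>j\<in>set js. rep_small (R j))"
proof -
  have *: "\<not> 2 < length js \<Longrightarrow> rep_and (map R js) = rep_and2 (R (hd js)) (R (last js)) \<and> set js = {hd js, last js}"
    using list_le_2[OF assms] assms by (simp add: rep_and_def hd_map last_map)
  show "rep_ok (rep_and (map R js)) \<longleftrightarrow> (\<forall>j\<in>set js. rep_ok (R j) \<and> (2 < length js \<longrightarrow> rep_small (R j)))"
  proof (cases "2 < length js")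
    case False
    then show ?thesis using * by (simp add: rep_and2_sel)
  qed (simp add: rep_and_def rep_ok_def[of "(_, _)"])
  show "rep_small (rep_and (map R js)) \<longleftrightarrow> \<not> 2 < length js \<and> (\<forall>j\<in>set js. rep_small (R j))"
  proof (cases "2 < length js")
    case False
    then show ?thesis using * by (simp add: rep_and2_sel)
  qed (simp add: rep_and_def rep_small_def[of "(_, _)"])
qed

text \<open>Depth counts edges and \<open>length p\<close> counts gates, hence \<open>Suc h\<close>.
  The description of \<open>rep_small\<close> carries the induction: below a large gate no path may
  contain another one. It is stated for valid representations only, since the flag means nothing
  otherwise.\<close>

lemma rep_gate_ok:
  assumes wf: "wf_circuit C"
  shows "i < length C \<Longrightarrow>
    (rep_ok (rep_gate C h i) \<longleftrightarrow> (\<forall>p. gate_path C p i \<longrightarrow> length p \<le> Suc h \<and> num_large C p \<le> 1)) \<and>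
    (rep_ok (rep_gate C h i) \<longrightarrow> (rep_small (rep_gate C h i) \<longleftrightarrow> (\<forall>p. gate_path C p i \<longrightarrow> num_large C p = 0)))"
proof (induction h arbitrary: i)
  case 0
  show ?case
  proof (cases "C ! i = Input")
    case True
    then show ?thesis using 0
      by (simp add: gate_path_input gate_tag_eq_0 rep_input_def rep_ok_def rep_small_def num_large_def large_gate_def)
  next
    case False
    then obtain j where j: "j \<in> set (gate_args (C ! i))"
      using wf_circuitD(2)[OF wf 0] by (meson last_in_set)
    then have "j < length C" using wf_circuitD(1)[OF wf 0 j] 0 by simp
    then obtain q where q: "j \<in> set (gate_args (C ! i))" "gate_path C q j"
      using gate_path_exists[OF wf] j by blast
    then have "gate_path C (q @ [i]) i" using gate_path_step[OF 0 False] by blast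
    moreover have "\<not> length (q @ [i]) \<le> 1" using q(2) by (simp add: gate_path_def)
    ultimately have "\<not> (\<forall>p. gate_path C p i \<longrightarrow> length p \<le> Suc 0 \<and> num_large C p \<le> 1)"
      unfolding One_nat_def by blast
    moreover have "\<not> rep_ok (rep_gate C 0 i)" using 0 False by (simp add: gate_tag_eq_0 rep_bad_def rep_ok_def)
    ultimately show ?thesis by blast
  qed
next
  case (Suc h)
  show ?case
  proof (cases "C ! i = Input")
    case True
    then show ?thesis using Suc.prems
      by (simp add: gate_path_input gate_tag_eq_0 rep_input_def rep_ok_def rep_small_def num_large_def large_gate_def)
  next
    case False
    let ?js = "gate_args (C ! i)"
    let ?L = "large_gate (C ! i)"
    have ne: "?js \<noteq> []" using wf_circuitD(2)[OF wf Suc.prems False] .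
    have IH: "(rep_ok (rep_gate C h j) \<longleftrightarrow> (\<forall>p. gate_path C p j \<longrightarrow> length p \<le> Suc h \<and> num_large C p \<le> 1))"
      "rep_ok (rep_gate C h j) \<Longrightarrow> (rep_small (rep_gate C h j) \<longleftrightarrow> (\<forall>p. gate_path C p j \<longrightarrow> num_large C p = 0))"
      if "j \<in> set ?js" for j
    proof -
      have "j < length C" using wf_circuitD(1)[OF wf Suc.prems that] Suc.prems by simp
      note IHj = Suc.IH[OF this]
      show "rep_ok (rep_gate C h j) \<longleftrightarrow> (\<forall>p. gate_path C p j \<longrightarrow> length p \<le> Suc h \<and> num_large C p \<le> 1)"
        by (rule IHj[THEN conjunct1])
      show "rep_ok (rep_gate C h j) \<Longrightarrow> (rep_small (rep_gate C h j) \<longleftrightarrow> (\<forall>p. gate_path C p j \<longrightarrow> num_large C p = 0))"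
        by (rule IHj[THEN conjunct2, rule_format])
    qed
    have not: "rep_ok (rep_not r) = rep_ok r" "rep_small (rep_not r) = rep_small r" for r
      by (simp_all add: rep_not_def rep_ok_def rep_small_def)
    have ok: "rep_ok (rep_gate C (Suc h) i) \<longleftrightarrow> (\<forall>j\<in>set ?js. rep_ok (rep_gate C h j) \<and> (?L \<longrightarrow> rep_small (rep_gate C h j)))"
      and small: "rep_small (rep_gate C (Suc h) i) \<longleftrightarrow> \<not> ?L \<and> (\<forall>j\<in>set ?js. rep_small (rep_gate C h j))"
      using Suc.prems False
      by (simp_all add: gate_tag_eq_0 not rep_and_ok[OF ne] large_gate_def comp_def)
    have large: "num_large C (q @ [i]) = num_large C q + (if ?L then 1 else 0)" for q
      by (simp add: num_large_def)
    have all: "(\<forall>p. gate_path C p i \<longrightarrow> Q p) \<longleftrightarrow> (\<forall>j\<in>set ?js. \<forall>q. gate_path C q j \<longrightarrow> Q (q @ [i]))" for Q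
      unfolding gate_path_step[OF Suc.prems False] by blast
    have "rep_ok (rep_gate C (Suc h) i) \<longleftrightarrow> (\<forall>p. gate_path C p i \<longrightarrow> length p \<le> Suc (Suc h) \<and> num_large C p \<le> 1)"
    proof (cases ?L)
      case True
      have "rep_ok (rep_gate C (Suc h) i) \<longleftrightarrow>
        (\<forall>j\<in>set ?js. \<forall>q. gate_path C q j \<longrightarrow> length q \<le> Suc h \<and> num_large C q = 0)"
        unfolding ok
      proof (intro ball_cong refl)
        fix j assume j: "j \<in> set ?js"
        show "rep_ok (rep_gate C h j) \<and> (?L \<longrightarrow> rep_small (rep_gate C h j)) \<longleftrightarrow>
          (\<forall>q. gate_path C q j \<longrightarrow> length q \<le> Suc h \<and> num_large C q = 0)"
        proof (cases "rep_ok (rep_gate C h j)")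
          case r: True
          then show ?thesis using IH(1)[OF j] IH(2)[OF j r] True by simp
        next
          case r: False
          \<comment> \<open>An argument with invalid representation has a path that is too long or
            contains two large gates, so both sides are false.\<close>
          then obtain p where "gate_path C p j" "\<not> (length p \<le> Suc h \<and> num_large C p \<le> 1)"
            using IH(1)[OF j] by blast
          then have "\<not> (\<forall>q. gate_path C q j \<longrightarrow> length q \<le> Suc h \<and> num_large C q = 0)"
            by auto
          then show ?thesis using r by blast
        qed
      qed
      then show ?thesis unfolding all large using True by simp
    next
      case False
      then show ?thesis unfolding ok all large using IH(1) by simp
    qed
    moreover have "rep_small (rep_gate C (Suc h) i) \<longleftrightarrow> (\<forall>p. gate_path C p i \<longrightarrow> num_large C p = 0)"
      if "rep_ok (rep_gate C (Suc h) i)"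
    proof (cases ?L)
      case True
      obtain p where p: "gate_path C p i" using gate_path_exists[OF wf Suc.prems] by blast
      then obtain q where "p = q @ [i]" using gate_path_step[OF Suc.prems False] by blast
      then have ne0: "num_large C p \<noteq> 0" using True large by simp
      have "\<not> (\<forall>p. gate_path C p i \<longrightarrow> num_large C p = 0)"
      proof
        assume H: "\<forall>p. gate_path C p i \<longrightarrow> num_large C p = 0"
        have "num_large C p = 0" by (rule H[rule_format, OF p])
        then show False using ne0 by contradiction
      qed
      moreover have "\<not> rep_small (rep_gate C (Suc h) i)" unfolding small using True by simp
      ultimately show ?thesis by (simp only: simp_thms)
    next
      case False
      have okj: "rep_ok (rep_gate C h j)" if "j \<in> set ?js" for j
        using bspec[OF iffD1[OF ok \<open>rep_ok (rep_gate C (Suc h) i)\<close>] that] by (rule conjunct1)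
      have "rep_small (rep_gate C (Suc h) i) \<longleftrightarrow> (\<forall>j\<in>set ?js. rep_small (rep_gate C h j))"
        unfolding small using False by (simp only: not_False_eq_True simp_thms)
      also have "\<dots> \<longleftrightarrow> (\<forall>j\<in>set ?js. \<forall>q. gate_path C q j \<longrightarrow> num_large C q = 0)"
        by (rule ball_cong[OF refl]) (rule IH(2)[OF _ okj])
      finally show ?thesis unfolding all large using False by (simp only: if_False add_0_right)
    qed
    ultimately show ?thesis by (intro conjI impI)
  qed
qed

text \<open>Arguments precede their gate, so a path is strictly increasing and cannot repeat a
  gate.\<close>

lemma finite_io_paths:
  assumes "wf_circuit C"
  shows "finite {p. io_path C p}"
proof (rule finite_subset)
  show "{p. io_path C p} \<subseteq> {p. set p \<subseteq> {..<length C} \<and> length p \<le> length C}"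
  proof clarify
    fix p assume p: "io_path C p"
    then have sub: "set p \<subseteq> {..<length C}"
      and "successively (\<lambda>j i. j \<in> set (gate_args (C ! i))) p" by (auto simp: io_path_def)
    from this(2) have "successively (<) p"
    proof (rule successively_mono)
      fix j i assume "i \<in> set p" "j \<in> set (gate_args (C ! i))"
      then show "j < i" using wf_circuitD(1)[OF assms] sub by blast
    qed
    then have "sorted_wrt (<) p" by (simp add: successively_conv_sorted_wrt)
    then have "distinct p" by (simp add: strict_sorted_iff)
    then have "length p = card (set p)" by (simp add: distinct_card)
    also have "\<dots> \<le> card {..<length C}" by (rule card_mono) (use sub in auto)
    finally show "set p \<subseteq> {..<length C} \<and> length p \<le> length C" using sub by simp
  qed
  show "finite {p. set p \<subseteq> {..<length C} \<and> length p \<le> length C}"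
    by (rule finite_lists_length_le) simp
qed

lemma rep_gate_output_ok:
  assumes "wf_circuit C"
  shows "rep_ok (rep_gate C d (length C - 1)) \<longleftrightarrow> depth C \<le> d \<and> weft C \<le> 1"
proof -
  have C: "length C - 1 < length C" using assms by (simp add: wf_circuit_def)
  have fin: "finite {p. io_path C p}" by (rule finite_io_paths[OF assms])
  have ne: "{p. io_path C p} \<noteq> {}" using gate_path_exists[OF assms C] io_path_eq by auto
  have "depth C \<le> d \<longleftrightarrow> (\<forall>p. io_path C p \<longrightarrow> length p \<le> Suc d)"
    unfolding depth_def using fin ne by (subst Max_le_iff) auto
  moreover have "weft C \<le> 1 \<longleftrightarrow> (\<forall>p. io_path C p \<longrightarrow> num_large C p \<le> 1)"
    unfolding weft_def num_large_def using fin ne by (subst Max_le_iff) auto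
  ultimately show ?thesis using rep_gate_ok[OF assms C, of d] io_path_eq by auto
qed

section \<open>Weft one as a constraint satisfaction problem\<close>

text \<open>The empty list is satisfied by no assignment; it takes care of all trees that are not
  well-formed circuits within the bounds.\<close>

definition alternatives :: "nat \<Rightarrow> tree \<Rightarrow> cnf list" where
  "alternatives d t =
    (if is_circuit t \<and> wf_circuit (circuit_of t) \<and> rep_ok (rep_gate (circuit_of t) d (length (circuit_of t) - 1))
     then rep_pos (rep_gate (circuit_of t) d (length (circuit_of t) - 1)) else [])"

definition input_list :: "tree \<Rightarrow> nat list" where
  "input_list t = filter (\<lambda>i. gate_tag (get (circuit_of t) i) = 0) [0..<length (circuit_of t)]"

lemma pt_alternatives [pt_intros]: "pt f \<Longrightarrow> pt (\<lambda>x. alternatives d (f x))"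
  by (rule pt_comp[of "alternatives d"]) (unfold alternatives_def, intro pt_intros)

lemma pt_input_list [pt_intros]: "pt f \<Longrightarrow> pt (\<lambda>x. input_list (f x))"
  by (rule pt_comp[of input_list]) (unfold input_list_def, intro pt_intros)

lemma WCS_iff: "(t, k) \<in> WCS 1 d \<longleftrightarrow>
  (\<exists>X \<subseteq> set (input_list t). card X = k \<and> sat_some X (alternatives d t))"
proof (cases "is_circuit t \<and> wf_circuit (circuit_of t)")
  case True
  then obtain C where t: "t = enc_circuit C" by (auto simp: is_circuit_iff)
  with True have wf: "wf_circuit C" by simp
  then have C: "length C - 1 < length C" by (simp add: wf_circuit_def)
  have "circuit_inputs C = set (input_list t)"
    by (auto simp: circuit_inputs_def input_list_def t gate_tag_eq_0)
  moreover have "sat_some X (alternatives d t) \<longleftrightarrow> weft C \<le> 1 \<and> depth C \<le> d \<and> satisfies X C" for X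
    using True rep_gate_output_ok[OF wf, of d] rep_sem_gate[OF wf C, of X d]
    by (auto simp: alternatives_def t rep_sem_def satisfies_def sat_some_def[of _ "[]"])
  ultimately show ?thesis using wf by (auto simp: WCS_def t enc_circuit_inject)
next
  case False
  then have "(t, k) \<notin> WCS 1 d" by (auto simp: WCS_def is_circuit_iff)
  moreover have "alternatives d t = []" using False by (auto simp add: alternatives_def)
  ultimately show ?thesis by (simp add: sat_some_def)
qed

lemma alternatives_bound:
  assumes "U \<in> set (alternatives d t)" "c \<in> set U"
  shows "length (fst c) \<le> 2 ^ d" "length (snd c) \<le> 2 ^ d"
    "set (fst c) \<subseteq> {..<length (circuit_of t)}" "set (snd c) \<subseteq> {..<length (circuit_of t)}"
proof -
  let ?C = "circuit_of t"
  from assms have t: "is_circuit t" "wf_circuit ?C" "rep_ok (rep_gate ?C d (length ?C - 1))"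
    "U \<in> set (rep_pos (rep_gate ?C d (length ?C - 1)))"
    by (auto simp: alternatives_def split: if_splits)
  have "length ?C - 1 < length ?C" using t(2) by (simp add: wf_circuit_def)
  from rep_sem_gate[OF t(2) this, of "{}" d] t(3,4) assms(2)
  have "length (fst c) \<le> 2 ^ d \<and> length (snd c) \<le> 2 ^ d \<and> set (fst c) \<union> set (snd c) \<subseteq> {..<length ?C}"
    unfolding rep_sem_def by blast
  then show "length (fst c) \<le> 2 ^ d" "length (snd c) \<le> 2 ^ d"
    "set (fst c) \<subseteq> {..<length (circuit_of t)}" "set (snd c) \<subseteq> {..<length (circuit_of t)}" by auto
qed

text \<open>The alternative with number \<open>a\<close> is turned into the additional variable
  \<open>length (circuit_of t) + a\<close>, exactly one of which has to be chosen.\<close>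

definition choice_list :: "nat \<Rightarrow> tree \<Rightarrow> nat list" where
  "choice_list d t = map (\<lambda>a. length (circuit_of t) + a) [0..<length (alternatives d t)]"

text \<open>The number of the alternative is added on the negated side, so it acts as a guard, and
  this side may have up to \<open>2 ^ d + 1\<close> variables.\<close>

definition clause_list :: "nat \<Rightarrow> tree \<Rightarrow> cnf" where
  "clause_list d t = concat (map (\<lambda>a. map (\<lambda>c. ((length (circuit_of t) + a) # fst c, snd c))
     (get (alternatives d t) a)) [0..<length (alternatives d t)])"

lemma pt_choice_list [pt_intros]: "pt f \<Longrightarrow> pt (\<lambda>x. choice_list d (f x))"
  by (rule pt_comp[of "choice_list d"]) (unfold choice_list_def, intro pt_intros)

lemma pt_clause_list [pt_intros]: "pt f \<Longrightarrow> pt (\<lambda>x. clause_list d (f x))"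
  by (rule pt_comp[of "clause_list d"]) (unfold clause_list_def, intro pt_intros)

text \<open>\<open>f\<close> enumerates the chosen variables: position 0 holds the alternative, and
  by injectivity positions 1 to \<open>k\<close> hold a set of exactly \<open>k\<close>
  inputs.\<close>

definition csp_solution :: "nat list \<Rightarrow> nat list \<Rightarrow> cnf \<Rightarrow> nat \<Rightarrow> (nat \<Rightarrow> nat) \<Rightarrow> bool" where
  "csp_solution V0 V1 cls k f \<longleftrightarrow> inj_on f {..k} \<and> f 0 \<in> set V0 \<and> (\<forall>i\<in>{1..k}. f i \<in> set V1) \<and>
     sat_cnf (f ` {..k}) cls"

lemma clause_list_iff: "c \<in> set (clause_list d t) \<longleftrightarrow> (\<exists>a<length (alternatives d t).
   \<exists>c'\<in>set (alternatives d t ! a). c = ((length (circuit_of t) + a) # fst c', snd c'))"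
  by (auto simp: clause_list_def)

lemma clause_list_bound:
  assumes "c \<in> set (clause_list d t)"
  shows "length (fst c) \<le> 2 ^ d + 1" "length (snd c) \<le> 2 ^ d"
proof -
  from assms obtain a c' where a: "a < length (alternatives d t)" "c' \<in> set (alternatives d t ! a)"
    "c = ((length (circuit_of t) + a) # fst c', snd c')" by (auto simp: clause_list_iff)
  then show "length (fst c) \<le> 2 ^ d + 1" "length (snd c) \<le> 2 ^ d"
    using alternatives_bound(1,2)[of "alternatives d t ! a" d t c'] by auto
qed

lemma input_list_bound: "set (input_list t) \<subseteq> {..<length (circuit_of t)}"
  by (auto simp: input_list_def)

lemma WCS_iff_csp: "(t, k) \<in> WCS 1 d \<longleftrightarrow>
  (\<exists>f. csp_solution (choice_list d t) (input_list t) (clause_list d t) k f)"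
proof
  let ?N = "length (circuit_of t)"
  let ?A = "alternatives d t"
  assume "(t, k) \<in> WCS 1 d"
  then obtain X where X: "X \<subseteq> set (input_list t)" "card X = k" "sat_some X ?A"
    unfolding WCS_iff by blast
  from X(3) obtain a where a: "a < length ?A" "sat_cnf X (?A ! a)"
    by (auto simp: sat_some_def in_set_conv_nth)
  have "finite X" using X(1) finite_subset by blast
  then obtain g where g: "bij_betw g {1..k} X"
    using X(2) ex_bij_betw_nat_finite_1 by blast
  define f where "f i = (if i = 0 then ?N + a else g i)" for i
  have XN: "x < ?N" if "x \<in> X" for x using that X(1) input_list_bound by blast
  have "f ` {1..k} = X" using g by (auto simp: bij_betw_def f_def image_iff)
  have ins: "{..k} = insert 0 {1..k}" by auto
  have f0: "f 0 = ?N + a" by (simp add: f_def)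
  have im: "f ` {..k} = insert (?N + a) X"
    unfolding ins image_insert f0 \<open>f ` {1..k} = X\<close> ..
  have "inj_on f {1..k} = inj_on g {1..k}" by (rule inj_on_cong) (simp add: f_def)
  then have "inj_on f {1..k}" using bij_betw_imp_inj_on[OF g] by simp
  moreover have "f 0 \<notin> f ` {1..k}" unfolding f0 \<open>f ` {1..k} = X\<close> using XN[of "?N + a"] by auto
  ultimately have inj: "inj_on f {..k}" unfolding ins by simp
  have "sat_clause (insert (?N + a) X) c" if c: "c \<in> set (clause_list d t)" for c
  proof -
    from c obtain a' c' where c': "a' < length ?A" "c' \<in> set (?A ! a')" "c = ((?N + a') # fst c', snd c')"
      by (auto simp: clause_list_iff)
    have b: "set (fst c') \<subseteq> {..<?N}"
      using alternatives_bound(3)[of "?A ! a'" d t c'] c' by auto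
    show ?thesis unfolding sat_clause_def
    proof
      assume s: "set (fst c) \<subseteq> insert (?N + a) X"
      then have "?N + a' \<in> insert (?N + a) X" using c' by simp
      \<comment> \<open>The guard of any other alternative is not chosen, so its clauses hold
        vacuously.\<close>
      then have "a' = a" using XN[of "?N + a'"] by auto
      moreover have "set (fst c') \<subseteq> X" using s b c' by auto
      ultimately have "set (snd c') \<inter> X \<noteq> {}" using a(2) c'(2) by (auto simp: sat_cnf_def sat_clause_def)
      then show "set (snd c) \<inter> insert (?N + a) X \<noteq> {}" using c' by auto
    qed
  qed
  moreover have "f 0 \<in> set (choice_list d t)" using a(1) by (auto simp: f_def choice_list_def)
  moreover have "\<forall>i\<in>{1..k}. f i \<in> set (input_list t)" using \<open>f ` {1..k} = X\<close> X(1) by blast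
  ultimately show "\<exists>f. csp_solution (choice_list d t) (input_list t) (clause_list d t) k f"
    using inj im unfolding csp_solution_def sat_cnf_def by metis
next
  let ?N = "length (circuit_of t)"
  let ?A = "alternatives d t"
  assume "\<exists>f. csp_solution (choice_list d t) (input_list t) (clause_list d t) k f"
  then obtain f where f: "inj_on f {..k}" "f 0 \<in> set (choice_list d t)" "\<forall>i\<in>{1..k}. f i \<in> set (input_list t)"
    "sat_cnf (f ` {..k}) (clause_list d t)" by (auto simp: csp_solution_def)
  from f(2) have "f 0 \<in> (\<lambda>a. ?N + a) ` {0..<length ?A}" unfolding choice_list_def set_map set_upt .
  then obtain a where a: "a < length ?A" "f 0 = ?N + a" unfolding image_iff by auto
  define X where "X = f ` {1..k}"
  have X: "X \<subseteq> set (input_list t)" using f(3) by (auto simp: X_def)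
  have "{1..k} \<subseteq> {..k}" by auto
  then have card: "card X = k" unfolding X_def using f(1) by (subst card_image) (auto intro: inj_on_subset)
  have "{..k} = insert 0 {1..k}" by auto
  then have im: "f ` {..k} = insert (?N + a) X" by (simp add: X_def a(2))
  have "sat_cnf X (?A ! a)"
    unfolding sat_cnf_def sat_clause_def
  proof (intro ballI impI)
    fix c assume c: "c \<in> set (?A ! a)" "set (fst c) \<subseteq> X"
    have "((?N + a) # fst c, snd c) \<in> set (clause_list d t)" using c a(1) by (auto simp: clause_list_iff)
    then have "set (snd c) \<inter> insert (?N + a) X \<noteq> {}"
      using f(4) c(2) unfolding im sat_cnf_def sat_clause_def by fastforce
    \<comment> \<open>The choice variables lie above all gates, so the clause is hit by a proper
      input and not by the chosen alternative.\<close>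
    moreover have "set (snd c) \<subseteq> {..<?N}"
      using alternatives_bound(4)[of "?A ! a" d t c] c a(1) by auto
    ultimately show "set (snd c) \<inter> X \<noteq> {}" by auto
  qed
  then have "sat_some X ?A" using a(1) by (auto simp: sat_some_def)
  then show "(t, k) \<in> WCS 1 d" using X card unfolding WCS_iff by blast
qed

section \<open>From constraint satisfaction to cliques\<close>

fun tuples :: "nat \<Rightarrow> 'a list \<Rightarrow> 'a list list" where
  "tuples 0 xs = [[]]"
| "tuples (Suc n) xs = concat (map (\<lambda>x. map (\<lambda>l. x # l) (tuples n xs)) xs)"

lemma set_tuples: "set (tuples n xs) = {l. length l = n \<and> set l \<subseteq> set xs}"
proof (induction n)
  case (Suc n)
  have "l \<in> set (tuples (Suc n) xs) \<longleftrightarrow> (\<exists>x\<in>set xs. \<exists>l'\<in>set (tuples n xs). l = x # l')" for l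
    by auto
  then have "l \<in> set (tuples (Suc n) xs) \<longleftrightarrow> length l = Suc n \<and> set l \<subseteq> set xs" for l
    unfolding Suc by (cases l) auto
  then show ?case by blast
qed auto

lemma pt_tuples [pt_intros]: "pt f \<Longrightarrow> pt (\<lambda>x. tuples n (f x))"
proof (rule pt_comp[of "tuples n"])
  show "pt (tuples n :: 'b list \<Rightarrow> 'b list list)"
  proof (induction n)
    case 0
    show ?case unfolding tuples.simps by (intro pt_intros)
  next
    case (Suc n)
    show ?case unfolding tuples.simps by (intro pt_intros pt_comp[OF Suc])
  qed
qed

text \<open>An assignment is a list of pairs of a position and a value.\<close>

type_synonym assignment = "(nat \<times> nat) list"

definition pairs :: "nat list \<Rightarrow> nat list \<Rightarrow> assignment" where
  "pairs ps vs = map (\<lambda>i. (get ps i, get vs i)) [0..<length ps]"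

definition unhit :: "cnf \<Rightarrow> nat list \<Rightarrow> assignment \<Rightarrow> cnf" where
  "unhit cls vs h = filter (\<lambda>c. (\<forall>x\<in>set (fst c). x \<in> set vs) \<and>
     \<not> (\<exists>v\<in>set (snd c). v \<in> set (map snd h))) cls"

definition extend1 :: "cnf \<Rightarrow> nat list \<Rightarrow> assignment \<Rightarrow> nat \<times> nat \<Rightarrow> assignment" where
  "extend1 cls vs h y = (if unhit cls vs h = [] then h
     else if fst y < length (snd (hd (unhit cls vs h)))
     then (snd y, get (snd (hd (unhit cls vs h))) (fst y)) # h else h)"

text \<open>A bounded search tree for hitting sets: an entry \<open>(a, i)\<close> of \<open>advice\<close> says that the first
  clause that ps not yet hit ps hit by its literal with number \<open>a\<close>, which has position \<open>i\<close>.\<close>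

definition extend :: "cnf \<Rightarrow> nat list \<Rightarrow> assignment \<Rightarrow> (nat \<times> nat) list \<Rightarrow> assignment" where
  "extend cls vs h advice = foldl (\<lambda>h y. extend1 cls vs h y) h advice"

text \<open>The equivalence rules out two values at one position as well as one value at two
  positions, so it enforces functions and their injectivity at once. \<open>consistent h h\<close>
  tests a single assignment.\<close>

definition consistent :: "assignment \<Rightarrow> assignment \<Rightarrow> bool" where
  "consistent h h' \<longleftrightarrow> (\<forall>e\<in>set h. \<forall>e'\<in>set h'. (fst e = fst e') = (snd e = snd e'))"

definition well_typed :: "nat list \<Rightarrow> nat list \<Rightarrow> nat \<Rightarrow> assignment \<Rightarrow> bool" where
  "well_typed V0 V1 k h \<longleftrightarrow>
    (\<forall>e\<in>set h. fst e \<le> k \<and> (if fst e = 0 then snd e \<in> set V0 else snd e \<in> set V1))"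

type_synonym csp = "nat list \<times> nat list \<times> cnf"

text \<open>Tuples may repeat positions, so length \<open>D\<close> also covers smaller sets of
  positions. The tuple stays part of the node to make nodes with the same tuple non-adjacent: a
  clique takes at most one guess for each tuple.\<close>

definition nodes :: "nat \<Rightarrow> csp \<Rightarrow> nat \<Rightarrow> (nat \<times> nat) list list \<Rightarrow> (nat list \<times> assignment) list" where
  "nodes D P k advices = concat (map (\<lambda>ps. concat (map (\<lambda>vs. map (\<lambda>h. (ps, h))
     (filter (\<lambda>h. consistent h h \<and> well_typed (fst P) (fst (snd P)) k h \<and> unhit (snd (snd P)) vs h = [])
       (map (\<lambda>advice. extend (snd (snd P)) vs (pairs ps vs) advice) advices)))
     (tuples D (fst P @ fst (snd P))))) (tuples D [0..<Suc k]))"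

definition compatible :: "nat list \<times> assignment \<Rightarrow> nat list \<times> assignment \<Rightarrow> bool" where
  "compatible u v \<longleftrightarrow> fst u \<noteq> fst v \<and> consistent (snd u) (snd v)"

text \<open>Ordered pairs including the diagonal, the form in which the gadgets take a
  graph.\<close>

definition clique_pairs :: "(nat list \<times> assignment) list \<Rightarrow> (nat \<times> nat) list" where
  "clique_pairs ns = filter (\<lambda>p. fst p = snd p \<or> compatible (get ns (fst p)) (get ns (snd p)))
     (concat (map (\<lambda>a. map (\<lambda>c. (a, c)) [0..<length ns]) [0..<length ns]))"

section \<open>Polynomial-time computability of the compatibility graph\<close>

lemma pt_pairs [pt_intros]: "pt f \<Longrightarrow> pt g \<Longrightarrow> pt (\<lambda>x. pairs (f x) (g x))"
  by (rule pt_comp2[of pairs]) (unfold pairs_def, intro pt_intros)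

lemma pt_unhit [pt_intros]: "pt f \<Longrightarrow> pt g \<Longrightarrow> pt h \<Longrightarrow> pt (\<lambda>x. unhit (f x) (g x) (h x))"
  by (rule pt_comp3[of unhit]) (unfold unhit_def, intro pt_intros)

lemma pt_extend1 [pt_intros]:
  "pt f \<Longrightarrow> pt g \<Longrightarrow> pt h \<Longrightarrow> pt i \<Longrightarrow> pt (\<lambda>x. extend1 (f x) (g x) (h x) (i x))"
  by (rule pt_comp4[of extend1]) (unfold extend1_def, intro pt_intros)

lemma sz_prod: "sz p = 1 + sz (fst p) + sz (snd p)"
  by (cases p) simp

text \<open>A step adds at most one entry, with its position from the advice and its value from a
  clause, so the increment does not depend on \<open>h\<close> and \<open>pt_foldl\<close>
  applies.\<close>

lemma sz_extend1: "sz (extend1 cls vs h y) \<le> sz h + (sz y + sz cls)"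
proof (cases "unhit cls vs h = [] \<or> \<not> fst y < length (snd (hd (unhit cls vs h)))")
  case True
  then have "extend1 cls vs h y = h" by (auto simp: extend1_def)
  then show ?thesis by simp
next
  case False
  define c where "c = hd (unhit cls vs h)"
  define v where "v = snd c ! fst y"
  have ext: "extend1 cls vs h y = (snd y, v) # h"
    using False by (simp add: extend1_def c_def v_def)
  have "c \<in> set (unhit cls vs h)" using False unfolding c_def by (intro hd_in_set) blast
  then have "c \<in> set cls" unfolding unhit_def by (rule subsetD[OF filter_is_subset])
  then have 1: "sz c + 2 \<le> sz cls" by (rule sz_elem)
  have "v \<in> set (snd c)" using False unfolding v_def c_def by (intro nth_mem) blast
  then have "sz v + 2 \<le> sz (snd c)" by (rule sz_elem)
  then show ?thesis using 1 sz_prod[of c] sz_prod[of y] unfolding ext sz_Cons sz_Pair by linarith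
qed

lemma pt_extend [pt_intros]:
  "pt f \<Longrightarrow> pt g \<Longrightarrow> pt h \<Longrightarrow> pt i \<Longrightarrow> pt (\<lambda>x. extend (f x) (g x) (h x) (i x))"
proof (rule pt_comp4[of extend])
  show "pt (\<lambda>z. extend (fst z) (fst (snd z)) (fst (snd (snd z))) (snd (snd (snd z))))"
    unfolding extend_def
  proof (rule pt_foldl[of "\<lambda>z h y. extend1 (fst z) (fst (snd z)) h y"])
    show "sz (extend1 (fst z) (fst (snd z)) h y) \<le> sz h + (\<lambda>p. sz (snd p) + sz (fst (fst p))) (z, y)"
      for z :: "cnf \<times> nat list \<times> assignment \<times> (nat \<times> nat) list" and h y
      using sz_extend1[of "fst z" "fst (snd z)" h y] by simp
  qed (intro pt_intros polyb_intros)+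
qed

lemma pt_consistent [pt_intros]: "pt f \<Longrightarrow> pt g \<Longrightarrow> pt (\<lambda>x. consistent (f x) (g x))"
  by (rule pt_comp2[of consistent]) (unfold consistent_def, intro pt_intros)

lemma pt_well_typed [pt_intros]:
  "pt f \<Longrightarrow> pt g \<Longrightarrow> pt h \<Longrightarrow> pt i \<Longrightarrow> pt (\<lambda>x. well_typed (f x) (g x) (h x) (i x))"
  by (rule pt_comp4[of well_typed]) (unfold well_typed_def, intro pt_intros)

lemma pt_nodes [pt_intros]:
  "pt f \<Longrightarrow> pt g \<Longrightarrow> pt h \<Longrightarrow> pt (\<lambda>x. nodes D (f x) (g x) (h x))"
  by (rule pt_comp3[of "nodes D"]) (unfold nodes_def, intro pt_intros)

lemma pt_compatible [pt_intros]: "pt f \<Longrightarrow> pt g \<Longrightarrow> pt (\<lambda>x. compatible (f x) (g x))"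
  unfolding compatible_def by (intro pt_intros)

lemma pt_clique_pairs [pt_intros]: "pt f \<Longrightarrow> pt (\<lambda>x. clique_pairs (f x))"
  by (rule pt_comp[of clique_pairs]) (unfold clique_pairs_def, intro pt_intros)

lemma set_clique_pairs: "set (clique_pairs ns) =
  {(a, c). a < length ns \<and> c < length ns \<and> (a = c \<or> compatible (ns ! a) (ns ! c))}"
proof -
  have "set (concat (map (\<lambda>a. map (\<lambda>c. (a, c)) [0..<length ns]) [0..<length ns]))
    = {..<length ns} \<times> {..<length ns}" by auto
  then show ?thesis unfolding clique_pairs_def set_filter by auto
qed

lemma distinct_pairs:
  "distinct xs \<Longrightarrow> distinct ys \<Longrightarrow> distinct (concat (map (\<lambda>a. map (\<lambda>c. (a, c)) ys) xs))"
  by (induction xs) (auto simp: distinct_map inj_on_def)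

lemma distinct_clique_pairs: "distinct (clique_pairs ns)"
  by (simp add: clique_pairs_def distinct_pairs)

lemma pairs_zip: "length ps = length vs \<Longrightarrow> pairs ps vs = zip ps vs"
  by (rule nth_equalityI) (simp_all add: pairs_def)

lemma nodes_iff: "(ps, h) \<in> set (nodes D (V0, V1, cls) k advices) \<longleftrightarrow>
  length ps = D \<and> set ps \<subseteq> {..k} \<and> (\<exists>vs. length vs = D \<and> set vs \<subseteq> set V0 \<union> set V1 \<and>
    (\<exists>advice\<in>set advices. h = extend cls vs (zip ps vs) advice) \<and>
    consistent h h \<and> well_typed V0 V1 k h \<and> unhit cls vs h = [])"
proof -
  have "set [0..<Suc k] = {..k}" by auto
  then have "(ps, h) \<in> set (nodes D (V0, V1, cls) k advices) \<longleftrightarrow>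
    length ps = D \<and> set ps \<subseteq> {..k} \<and> (\<exists>vs. (length vs = D \<and> set vs \<subseteq> set V0 \<union> set V1) \<and>
    (\<exists>advice\<in>set advices. h = extend cls vs (pairs ps vs) advice) \<and>
    consistent h h \<and> well_typed V0 V1 k h \<and> unhit cls vs h = [])"
    by (auto simp: nodes_def set_tuples)
  also have "\<dots> \<longleftrightarrow> length ps = D \<and> set ps \<subseteq> {..k} \<and> (\<exists>vs. (length vs = D \<and> set vs \<subseteq> set V0 \<union> set V1) \<and>
    (\<exists>advice\<in>set advices. h = extend cls vs (zip ps vs) advice) \<and>
    consistent h h \<and> well_typed V0 V1 k h \<and> unhit cls vs h = [])"
    by (metis pairs_zip)
  finally show ?thesis by (simp only: conj_assoc)
qed

lemma set_extend1: "set h \<subseteq> set (extend1 cls vs h y)"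
  by (auto simp: extend1_def)

lemma set_extend: "set h \<subseteq> set (extend cls vs h advice)"
proof (induction advice arbitrary: h)
  case (Cons y advice)
  then show ?case using set_extend1[of h cls vs y] by (auto simp: extend_def)
qed (simp add: extend_def)

text \<open>A triggered clause is satisfied by \<open>f\<close>, so one of its unnegated variables
  is a value of \<open>f\<close>. Advice that names this variable stays within the graph of
  \<open>f\<close> and adds a new value, because the clause was not hit before. Hence the number of
  values grows with every step until nothing is left to hit.\<close>

lemma extend_exists:
  assumes f: "sat_cnf (f ` {..k}) cls" "set vs \<subseteq> f ` {..k}"
    and w: "\<And>c. c \<in> set cls \<Longrightarrow> length (snd c) \<le> w" "0 < w"
    and h: "set h \<subseteq> (\<lambda>i. (i, f i)) ` {..k}"
  shows "\<exists>advice. length advice = n \<and> set advice \<subseteq> {..<w} \<times> {..k} \<and>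
     set (extend cls vs h advice) \<subseteq> (\<lambda>i. (i, f i)) ` {..k} \<and>
     (unhit cls vs (extend cls vs h advice) = [] \<or>
      card (snd ` set h) + n \<le> card (snd ` set (extend cls vs h advice)))"
  using h
proof (induction n arbitrary: h)
  case 0
  then show ?case by (intro exI[of _ "[]"]) (simp add: extend_def)
next
  case (Suc n)
  show ?case
  proof (cases "unhit cls vs h = []")
    case True
    have "extend cls vs h advice = h" for advice
      by (induction advice) (use True in \<open>simp_all add: extend_def extend1_def\<close>)
    \<comment> \<open>With nothing left to hit every advice is idle; \<open>(0, 0)\<close> pads it
      to the prescribed length.\<close>
    then show ?thesis using True Suc.prems w(2)
      by (intro exI[of _ "replicate (Suc n) (0, 0)"]) auto
  next
    case False
    define c where "c = hd (unhit cls vs h)"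
    have "c \<in> set (unhit cls vs h)" unfolding c_def using False by (rule hd_in_set)
    then have "c \<in> set cls \<and> (\<forall>x\<in>set (fst c). x \<in> set vs) \<and> \<not> (\<exists>v\<in>set (snd c). v \<in> set (map snd h))"
      unfolding unhit_def set_filter mem_Collect_eq .
    then have c: "c \<in> set cls" "set (fst c) \<subseteq> set vs" "set (snd c) \<inter> snd ` set h = {}"
      by auto
    have "sat_clause (f ` {..k}) c" using f(1) c(1) unfolding sat_cnf_def by (rule bspec)
    moreover have "set (fst c) \<subseteq> f ` {..k}" using c(2) f(2) by (rule subset_trans)
    ultimately have "set (snd c) \<inter> f ` {..k} \<noteq> {}" unfolding sat_clause_def by (rule mp)
    then obtain v i where v: "v \<in> set (snd c)" "i \<le> k" "v = f i" by auto
    then obtain a where a: "a < length (snd c)" "snd c ! a = v" unfolding in_set_conv_nth by blast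
    have step: "extend1 cls vs h (a, i) = (i, v) # h"
      using False a by (simp add: extend1_def c_def[symmetric])
    have "set ((i, v) # h) \<subseteq> (\<lambda>i. (i, f i)) ` {..k}" using Suc.prems v by auto
    from Suc.IH[OF this] obtain advice where ad: "length advice = n" "set advice \<subseteq> {..<w} \<times> {..k}"
      "set (extend cls vs ((i, v) # h) advice) \<subseteq> (\<lambda>i. (i, f i)) ` {..k}"
      "unhit cls vs (extend cls vs ((i, v) # h) advice) = [] \<or>
       card (snd ` set ((i, v) # h)) + n \<le> card (snd ` set (extend cls vs ((i, v) # h) advice))"
      by blast
    have ext: "extend cls vs h ((a, i) # advice) = extend cls vs ((i, v) # h) advice"
      by (simp add: extend_def step)
    have "v \<notin> snd ` set h" using c(3) v(1) by auto
    then have "card (snd ` set ((i, v) # h)) = Suc (card (snd ` set h))" by simp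
    moreover have "a < w" using a(1) w(1)[OF c(1)] by simp
    ultimately show ?thesis using ad v(2)
      by (intro exI[of _ "(a, i) # advice"]) (simp add: ext)
  qed
qed

lemma card_tuples: "card (set (tuples D [0..<Suc k])) = (k + 1) ^ D"
proof -
  have "set (tuples D [0..<Suc k]) = {l. set l \<subseteq> {0..<Suc k} \<and> length l = D}"
    unfolding set_tuples set_upt by auto
  then show ?thesis using card_lists_length_eq[of "{0..<Suc k}" D] by simp
qed

text \<open>For each tuple of positions the values of \<open>f\<close> are guessed and extended
  within the graph of \<open>f\<close>. The nodes found in this way describe parts of one injective
  function, so they are pairwise consistent.\<close>

lemma csp_imp_clique:
  assumes f: "csp_solution V0 V1 cls k f"
    and D: "1 \<le> D"
    and w: "\<And>c. c \<in> set cls \<Longrightarrow> length (snd c) \<le> w" "0 < w"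
    and advices: "set advices = {l. length l = Suc k \<and> set l \<subseteq> {..<w} \<times> {..k}}"
    and ns: "ns = nodes D (V0, V1, cls) k advices"
  shows "\<exists>R\<subseteq>{..<length ns}. card R = (k + 1) ^ D \<and> R \<times> R \<subseteq> set (clique_pairs ns)"
proof -
  define T where "T = set (tuples D [0..<Suc k])"
  have T_iff: "ps \<in> T \<longleftrightarrow> length ps = D \<and> set ps \<subseteq> {..k}" for ps
    unfolding T_def set_tuples by auto
  let ?G = "(\<lambda>i. (i, f i)) ` {..k}"
  have inj: "inj_on f {..k}" and sat: "sat_cnf (f ` {..k}) cls" and f0: "f 0 \<in> set V0"
    and f1: "\<And>i. i \<in> {1..k} \<Longrightarrow> f i \<in> set V1"
    using f by (auto simp: csp_solution_def)
  have cons: "consistent h h'" if "set h \<subseteq> ?G" "set h' \<subseteq> ?G" for h h'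
    unfolding consistent_def
  proof (intro ballI)
    fix e e' assume "e \<in> set h" "e' \<in> set h'"
    then have "e \<in> ?G" "e' \<in> ?G" using that by blast+
    then obtain i j where "i \<le> k" "j \<le> k" "e = (i, f i)" "e' = (j, f j)" by auto
    then show "(fst e = fst e') = (snd e = snd e')" using inj by (auto simp: inj_on_def)
  qed
  have good: "\<exists>h. (ps, h) \<in> set ns \<and> set h \<subseteq> ?G" if psT: "ps \<in> T" for ps
  proof -
    have ps: "length ps = D" "set ps \<subseteq> {..k}" using psT T_iff by blast+
    let ?vs = "map f ps"
    have vs: "set ?vs \<subseteq> f ` {..k}" using ps(2) by auto
    have "zip ps ?vs = map (\<lambda>i. (i, f i)) ps" by (simp add: zip_map2 zip_same_conv_map)
    then have z: "set (zip ps ?vs) \<subseteq> ?G" using ps(2) by auto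
    from extend_exists[OF sat vs w z, of "Suc k"] obtain advice where ad:
      "length advice = Suc k" "set advice \<subseteq> {..<w} \<times> {..k}" "set (extend cls ?vs (zip ps ?vs) advice) \<subseteq> ?G"
      "unhit cls ?vs (extend cls ?vs (zip ps ?vs) advice) = [] \<or>
       card (snd ` set (zip ps ?vs)) + Suc k \<le> card (snd ` set (extend cls ?vs (zip ps ?vs) advice))"
      by blast
    let ?h = "extend cls ?vs (zip ps ?vs) advice"
    have "snd ` set ?h \<subseteq> f ` {..k}" using ad(3) by auto
    then have "card (snd ` set ?h) \<le> card (f ` {..k})" by (intro card_mono) auto
    also have "\<dots> \<le> Suc k" using card_image_le[of "{..k}" f] by simp
    finally have "card (snd ` set ?h) \<le> Suc k" .
    moreover have "0 < card (snd ` set (zip ps ?vs))"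
    proof -
      have "zip ps ?vs \<noteq> []" using ps(1) D by (cases ps) auto
      then show ?thesis by (simp add: card_gt_0_iff)
    qed
    \<comment> \<open>At least one value at the start and \<open>k + 1\<close> new ones would exceed
      the at most \<open>k + 1\<close> values of \<open>f\<close>, so advice of length
      \<open>Suc k\<close> suffices.\<close>
    ultimately have 1: "unhit cls ?vs ?h = []" using ad(4) by linarith
    have "f i \<in> set V0 \<union> set V1" if "i \<le> k" for i
      using f0 f1[of i] that by (cases "i = 0") auto
    then have 2: "set ?vs \<subseteq> set V0 \<union> set V1" using ps(2) by auto
    have 3: "well_typed V0 V1 k ?h"
      unfolding well_typed_def
    proof
      fix e assume "e \<in> set ?h"
      then obtain i where "i \<le> k" "e = (i, f i)" using ad(3) by auto
      then show "fst e \<le> k \<and> (if fst e = 0 then snd e \<in> set V0 else snd e \<in> set V1)"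
        using f0 f1[of i] by auto
    qed
    have "(ps, ?h) \<in> set ns" unfolding ns nodes_iff
    proof (intro conjI exI)
      show "\<exists>advice\<in>set advices. ?h = extend cls ?vs (zip ps ?vs) advice"
        using ad advices by blast
    qed (use ps 1 2 3 cons[OF ad(3) ad(3)] in simp_all)
    then show ?thesis using ad(3) by blast
  qed
  have node: "\<exists>a. a < length ns \<and> fst (ns ! a) = ps \<and> set (snd (ns ! a)) \<subseteq> ?G" if "ps \<in> T" for ps
  proof -
    from good[OF that]
    obtain h where h: "(ps, h) \<in> set ns" "set h \<subseteq> ?G" by blast
    from h(1) obtain a where "a < length ns" "ns ! a = (ps, h)" unfolding in_set_conv_nth by blast
    then show ?thesis using h(2) by (intro exI[of _ a]) simp
  qed
  define r where "r ps = (SOME a. a < length ns \<and> fst (ns ! a) = ps \<and> set (snd (ns ! a)) \<subseteq> ?G)" for ps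
  have r: "r ps < length ns" "fst (ns ! r ps) = ps" "set (snd (ns ! r ps)) \<subseteq> ?G" if "ps \<in> T" for ps
  proof -
    have "r ps < length ns \<and> fst (ns ! r ps) = ps \<and> set (snd (ns ! r ps)) \<subseteq> ?G"
      unfolding r_def by (rule someI_ex[OF node[OF that]])
    then show "r ps < length ns" "fst (ns ! r ps) = ps" "set (snd (ns ! r ps)) \<subseteq> ?G" by blast+
  qed
  have "inj_on r T"
  proof (rule inj_onI)
    fix x y assume xy: "x \<in> T" "y \<in> T" "r x = r y"
    have "x = fst (ns ! r x)" by (rule r(2)[OF xy(1), symmetric])
    also have "\<dots> = y" unfolding xy(3) by (rule r(2)[OF xy(2)])
    finally show "x = y" .
  qed
  from card_image[OF this] have "card (r ` T) = (k + 1) ^ D" unfolding T_def card_tuples .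
  moreover have "r ` T \<subseteq> {..<length ns}"
    by (rule image_subsetI) (unfold lessThan_iff, rule r(1))
  moreover have "r ` T \<times> r ` T \<subseteq> set (clique_pairs ns)"
  proof (rule subsetI, elim SigmaE imageE)
    fix p a c i j assume ij: "i \<in> T" "j \<in> T" and p: "p = (a, c)" "a = r i" "c = r j"
    have "(r i, r j) \<in> set (clique_pairs ns)"
    proof (cases "i = j")
      case True
      then show ?thesis unfolding set_clique_pairs using r(1)[OF ij(1)] by simp
    next
      case False
      then have "compatible (ns ! r i) (ns ! r j)"
        unfolding compatible_def r(2)[OF ij(1)] r(2)[OF ij(2)]
        using cons[OF r(3)[OF ij(1)] r(3)[OF ij(2)]] by (rule conjI)
      then show ?thesis unfolding set_clique_pairs using r(1)[OF ij(1)] r(1)[OF ij(2)] by simp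
    qed
    then show "p \<in> set (clique_pairs ns)" unfolding p .
  qed
  ultimately show ?thesis by blast
qed

text \<open>Adjacent nodes have different tuples and there are as many nodes as tuples, so every
  tuple occurs. The union of the assignments is the graph of an injective function, defined at each
  position because of the constant tuples. A clause whose negated variables are all chosen is hit in
  the node whose tuple lists their positions.\<close>

lemma clique_imp_csp:
  assumes R: "R \<subseteq> {..<length ns}" "card R = (k + 1) ^ D" "R \<times> R \<subseteq> set (clique_pairs ns)"
    and D: "1 \<le> D" "\<And>c. c \<in> set cls \<Longrightarrow> length (fst c) \<le> D"
    and ns: "ns = nodes D (V0, V1, cls) k advices"
  shows "\<exists>f. csp_solution V0 V1 cls k f"
proof -
  define T where "T = set (tuples D [0..<Suc k])"
  have T_iff: "ps \<in> T \<longleftrightarrow> length ps = D \<and> set ps \<subseteq> {..k}" for ps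
    unfolding T_def set_tuples by auto
  have cT: "finite T" "card T = (k + 1) ^ D" unfolding T_def card_tuples by simp_all
  have fR: "finite R" using R(1) finite_subset by blast
  have node: "\<exists>vs. length ps = D \<and> set ps \<subseteq> {..k} \<and> length vs = D \<and> set (zip ps vs) \<subseteq> set h \<and>
     consistent h h \<and> well_typed V0 V1 k h \<and> unhit cls vs h = []"
    if "a \<in> R" "ns ! a = (ps, h)" for a ps h
  proof -
    have "(ps, h) \<in> set ns" using that R(1) nth_mem[of a ns] by auto
    then show ?thesis unfolding ns nodes_iff using set_extend by blast
  qed
  have comp: "fst (ns ! a) \<noteq> fst (ns ! c) \<and> consistent (snd (ns ! a)) (snd (ns ! c))"
    if "a \<in> R" "c \<in> R" "a \<noteq> c" for a c
    using R(3) that by (auto simp: set_clique_pairs compatible_def)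
  have inj: "inj_on (\<lambda>a. fst (ns ! a)) R" using comp by (auto simp: inj_on_def)
  have "(\<lambda>a. fst (ns ! a)) ` R \<subseteq> T"
  proof (rule image_subsetI)
    fix a assume "a \<in> R"
    moreover obtain ps h where "ns ! a = (ps, h)" by fastforce
    ultimately show "fst (ns ! a) \<in> T" using node[of a ps h] T_iff[of ps] by auto
  qed
  then have onto: "(\<lambda>a. fst (ns ! a)) ` R = T"
    by (intro card_seteq) (simp_all only: card_image[OF inj] R(2) cT order_refl)
  have cons: "consistent (snd (ns ! a)) (snd (ns ! c))" if "a \<in> R" "c \<in> R" for a c
  proof (cases "a = c")
    case True
    obtain ps h where "ns ! a = (ps, h)" by fastforce
    then show ?thesis using node[OF that(1)] True by auto
  qed (use comp that in blast)
  define H where "H = (\<Union>a\<in>R. set (snd (ns ! a)))"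
  have H: "(fst e = fst e') = (snd e = snd e')" if "e \<in> H" "e' \<in> H" for e e'
    using that cons unfolding H_def consistent_def by blast
  have HI: "set h \<subseteq> H" if "a \<in> R" "ns ! a = (ps, h)" for a ps h
    unfolding H_def by (rule SUP_upper2[OF that(1)]) (simp add: that(2))
  have node': "\<exists>a\<in>R. \<exists>vs h. ns ! a = (ps, h) \<and> length vs = D \<and> set (zip ps vs) \<subseteq> set h \<and> unhit cls vs h = []"
    if "length ps = D" "set ps \<subseteq> {..k}" for ps
  proof -
    have "ps \<in> (\<lambda>a. fst (ns ! a)) ` R" unfolding onto T_iff using that by blast
    then obtain a where a: "a \<in> R" "ps = fst (ns ! a)" by (rule imageE)
    then have eq: "ns ! a = (ps, snd (ns ! a))" by simp
    show ?thesis using node[OF a(1) eq] a(1) eq by blast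
  qed
  have "\<exists>v. (i, v) \<in> H" if "i \<le> k" for i
  proof -
    have "set (replicate D i) \<subseteq> {..k}" using that by (auto simp: in_set_replicate)
    from node'[OF length_replicate this] obtain a vs h where a: "a \<in> R" "ns ! a = (replicate D i, h)"
      "length vs = D" "set (zip (replicate D i) vs) \<subseteq> set h" by blast
    have "0 < length (zip (replicate D i) vs)" using D(1) a(3) by simp
    from nth_mem[OF this] have "(i, vs ! 0) \<in> set (zip (replicate D i) vs)" using D(1) a(3) by simp
    then show ?thesis using a(4) HI[OF a(1,2)] by blast
  qed
  then have "\<forall>i\<in>{..k}. \<exists>v. (i, v) \<in> H" by blast
  from bchoice[OF this] obtain f where f: "\<And>i. i \<le> k \<Longrightarrow> (i, f i) \<in> H" by auto
  have typed: "fst e \<le> k \<and> (if fst e = 0 then snd e \<in> set V0 else snd e \<in> set V1)" if "e \<in> H" for e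
  proof -
    from that obtain a where a: "a \<in> R" "e \<in> set (snd (ns ! a))" by (auto simp: H_def)
    obtain ps h where h: "ns ! a = (ps, h)" by fastforce
    then have "well_typed V0 V1 k h" using node[OF a(1)] by blast
    then show ?thesis using a(2) h by (simp add: well_typed_def)
  qed
  have graph: "snd e = f (fst e)" if "e \<in> H" for e
    using H[OF that f[of "fst e"]] typed[OF that] by simp
  have "inj_on f {..k}"
  proof (rule inj_onI)
    fix i j assume "i \<in> {..k}" "j \<in> {..k}" "f i = f j"
    then show "i = j" using H[OF f[of i] f[of j]] by simp
  qed
  moreover have "f 0 \<in> set V0" using typed[OF f[of 0]] by simp
  moreover have "\<forall>i\<in>{1..k}. f i \<in> set V1" using typed[OF f] by fastforce
  moreover have "sat_cnf (f ` {..k}) cls"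
    unfolding sat_cnf_def sat_clause_def
  proof (intro ballI impI)
    fix c assume c: "c \<in> set cls" "set (fst c) \<subseteq> f ` {..k}"
    then have "\<forall>x\<in>set (fst c). \<exists>i\<le>k. f i = x" by auto
    from bchoice[OF this] obtain g where g: "\<And>x. x \<in> set (fst c) \<Longrightarrow> g x \<le> k \<and> f (g x) = x" by blast
    \<comment> \<open>Padding with position 0 may trigger more clauses, but all triggered clauses
      are hit in this node.\<close>
    let ?ps = "map g (fst c) @ replicate (D - length (fst c)) 0"
    have ps: "length ?ps = D" "set ?ps \<subseteq> {..k}" using D(2)[OF c(1)] g by auto
    from node'[OF ps] obtain a vs h where a: "a \<in> R" "ns ! a = (?ps, h)" "length vs = D"
      "set (zip ?ps vs) \<subseteq> set h" "unhit cls vs h = []" by blast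
    have hH: "set h \<subseteq> H" by (rule HI[OF a(1,2)])
    have "x \<in> set vs" if x: "x \<in> set (fst c)" for x
    proof -
      from x obtain j where j: "j < length (fst c)" "fst c ! j = x" by (auto simp: in_set_conv_nth)
      then have "j < D" using D(2)[OF c(1)] by simp
      have "?ps ! j = g x" using j by (simp add: nth_append)
      moreover have "(?ps ! j, vs ! j) \<in> set (zip ?ps vs)"
        using \<open>j < D\<close> a(3) ps(1) by (auto simp: set_zip simp del: length_append length_map)
      \<comment> \<open>The node made its own guess of values; only consistency throughout the
        clique forces it to agree with \<open>f\<close>.\<close>
      ultimately have "(g x, vs ! j) \<in> H" using a(4) hH by auto
      then have "vs ! j = x" using graph[of "(g x, vs ! j)"] g[OF x] by simp
      then show ?thesis using nth_mem[of j vs] \<open>j < D\<close> a(3) by simp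
    qed
    then have "\<exists>v\<in>set (snd c). v \<in> set (map snd h)"
      using a(5) c(1) by (auto simp: unhit_def filter_empty_conv)
    then obtain e where e: "snd e \<in> set (snd c)" "e \<in> H" using hH by auto
    then have "snd e \<in> f ` {..k}" using graph typed by auto
    then show "set (snd c) \<inter> f ` {..k} \<noteq> {}" using e(1) by blast
  qed
  ultimately show ?thesis unfolding csp_solution_def by blast
qed

section \<open>Fixed-parameter tractable functions\<close>

text \<open>The step of this fold evaluates \<open>f\<close>, which is merely computable, so the
  loop is obtained from \<open>computes_foldl\<close> and not from \<open>ct_foldl\<close>.\<close>

lemma ct_sum:
  fixes f :: "nat \<Rightarrow> nat"
  assumes "ct f"
  shows "ct (\<lambda>n. \<Sum>i\<le>n. f i)"
proof -
  let ?F = "\<lambda>(x::unit) a i. a + f i"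
  have "ct (\<lambda>z :: unit \<times> nat \<times> nat. fst (snd z) + f (snd (snd z)))"
    by (intro ct_add ct_comp[OF assms]) (intro pt_imp_ct pt_intros)+
  then obtain c T where "computes c (\<lambda>(x, a, y). ?F x a y) T"
    unfolding ct_def case_prod_beta by blast
  from computes_foldl[OF this] have fold: "ct (\<lambda>(x, l, a). foldl (?F x) a l)"
    unfolding ct_def by blast
  have "ct (\<lambda>n. ((), [0..<Suc n], 0 :: nat))"
    by (intro pt_imp_ct pt_intros)
  from ct_comp[OF fold this] have "ct (\<lambda>n. foldl (?F ()) 0 [0..<Suc n])"
    unfolding case_prod_conv .
  moreover have "foldl (?F ()) b [0..<n] = b + (\<Sum>i<n. f i)" for b n
    by (induction n) simp_all
  ultimately show ?thesis by (simp add: lessThan_Suc_atMost del: upt_Suc)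
qed

text \<open>A composed reduction evaluates a bound at a parameter known only to be at most
  \<open>h k\<close>, which calls for monotone bounds. The sums of initial segments provide them and
  remain computable.\<close>

lemma ct_mono:
  fixes f :: "nat \<Rightarrow> nat"
  assumes "ct f"
  obtains g where "ct g" "mono g" "\<And>n. f n \<le> g n"
proof (rule that[of "\<lambda>n. \<Sum>i\<le>n. f i"])
  show "mono (\<lambda>n. \<Sum>i\<le>n. f i)"
    by (intro monoI sum_mono2) auto
  show "f n \<le> (\<Sum>i\<le>n. f i)" for n by (rule member_le_sum) auto
qed (rule ct_sum[OF assms])

section \<open>Fixed-parameter time bounds and the functions that obey them\<close>

definition fptb :: "(tree \<times> nat \<Rightarrow> nat) \<Rightarrow> bool" where
  "fptb B \<longleftrightarrow> (\<exists>f e. ct f \<and> (\<forall>z. B z \<le> f (snd z) * sz (fst z) ^ e))"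

lemma fptb_ct: "ct f \<Longrightarrow> fptb (\<lambda>z. f (snd z))"
  unfolding fptb_def by (intro exI[of _ f] exI[of _ 0]) simp

lemma fptb_const: "fptb (\<lambda>_. n)"
  by (rule fptb_ct[of "\<lambda>_. n"]) (rule ct_const)

lemma fptb_mono: "fptb B \<Longrightarrow> (\<And>z. B' z \<le> B z) \<Longrightarrow> fptb B'"
  unfolding fptb_def by (meson order_trans)

lemma fptb_add:
  assumes "fptb A" "fptb B"
  shows "fptb (\<lambda>z. A z + B z)"
proof -
  from assms obtain f e f' e' where *: "ct f" "ct f'" "\<And>z. A z \<le> f (snd z) * sz (fst z) ^ e"
    "\<And>z. B z \<le> f' (snd z) * sz (fst z) ^ e'"
    unfolding fptb_def by blast
  have "A z + B z \<le> (f (snd z) + f' (snd z)) * sz (fst z) ^ (e + e')" for z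
  proof -
    have "f (snd z) * sz (fst z) ^ e \<le> f (snd z) * sz (fst z) ^ (e + e')"
      "f' (snd z) * sz (fst z) ^ e' \<le> f' (snd z) * sz (fst z) ^ (e + e')"
      using sz_ge_1[of "fst z"] by (auto intro: power_increasing)
    then show ?thesis using add_mono[OF *(3)[of z] *(4)[of z]] unfolding add_mult_distrib by linarith
  qed
  moreover have "ct (\<lambda>k. f k + f' k)" by (intro ct_add *)
  ultimately show ?thesis unfolding fptb_def by (intro exI[of _ "\<lambda>k. f k + f' k"] exI[of _ "e + e'"]) blast
qed

lemma fptb_mult:
  assumes "fptb A" "fptb B"
  shows "fptb (\<lambda>z. A z * B z)"
proof -
  from assms obtain f e f' e' where *: "ct f" "ct f'" "\<And>z. A z \<le> f (snd z) * sz (fst z) ^ e"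
    "\<And>z. B z \<le> f' (snd z) * sz (fst z) ^ e'"
    unfolding fptb_def by blast
  have "A z * B z \<le> (f (snd z) * f' (snd z)) * sz (fst z) ^ (e + e')" for z
    using mult_le_mono[OF *(3)[of z] *(4)[of z]] by (simp add: power_add mult_ac)
  moreover have "ct (\<lambda>k. f k * f' k)" by (intro ct_mult *)
  ultimately show ?thesis unfolding fptb_def by (intro exI[of _ "\<lambda>k. f k * f' k"] exI[of _ "e + e'"]) blast
qed

lemma fptb_power: "fptb A \<Longrightarrow> fptb (\<lambda>z. A z ^ n)"
  by (induction n) (simp_all add: fptb_const fptb_mult)

lemma fptb_sz: "fptb sz"
proof -
  have "ct (\<lambda>k::nat. 2 * k + 3)" by (intro ct_intros)
  moreover have "sz z \<le> (2 * snd z + 3) * sz (fst z) ^ 1" for z :: "tree \<times> nat"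
    using sz_prod[of z] sz_ge_1[of "fst z"] by (cases "sz (fst z)") simp_all
  ultimately show ?thesis unfolding fptb_def by (intro exI[of _ "\<lambda>k. 2 * k + 3"] exI[of _ 1]) blast
qed

lemmas fptb_intros = fptb_const fptb_add fptb_mult fptb_power fptb_sz

lemma fptb_comp:
  assumes "polyb B" "fptb (\<lambda>z. sz (f z))"
  shows "fptb (\<lambda>z. B (f z))"
proof -
  from assms(1) obtain K e where *: "\<And>a. B a \<le> K * sz a ^ e" unfolding polyb_def by blast
  have "fptb (\<lambda>z. K * sz (f z) ^ e)" by (intro fptb_intros assms(2))
  then show ?thesis by (rule fptb_mono) (rule *)
qed

lemma polyb_fptb: "polyb B \<Longrightarrow> fptb B"
  by (rule fptb_comp[of B "\<lambda>z. z"]) (simp_all add: fptb_sz)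

definition fptc :: "(tree \<times> nat \<Rightarrow> 'b::encodable) \<Rightarrow> bool" where
  "fptc R \<longleftrightarrow> (\<exists>c T. computes c R T \<and> fptb T)"

lemma fptc_sz:
  assumes "fptc R"
  shows "fptb (\<lambda>z. sz (R z))"
proof -
  from assms obtain c T where T: "computes c R T" "fptb T" unfolding fptc_def by blast
  have "fptb (\<lambda>z. sz z + T z)" by (intro fptb_intros T)
  then show ?thesis by (rule fptb_mono) (rule computes_size[OF T(1)])
qed

lemma pt_imp_fptc: "pt R \<Longrightarrow> fptc R"
  unfolding pt_def fptc_def using polyb_fptb by blast

lemma fptc_Pair:
  assumes "fptc f" "fptc g"
  shows "fptc (\<lambda>z. (f z, g z))"
proof -
  from assms obtain cf Tf cg Tg where *: "computes cf f Tf" "fptb Tf" "computes cg g Tg" "fptb Tg"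
    unfolding fptc_def by blast
  from computes_Pair[OF *(1,3)] obtain c K where
    "computes c (\<lambda>x. (f x, g x)) (\<lambda>x. K + K * (sz x + sz (f x) + sz (g x)) + Tf x + Tg x)" by blast
  moreover have "fptb (\<lambda>x. K + K * (sz x + sz (f x) + sz (g x)) + Tf x + Tg x)"
    by (intro fptb_intros * assms[THEN fptc_sz])
  ultimately show ?thesis unfolding fptc_def by blast
qed

lemma fptc_pt_comp:
  assumes "pt g" "fptc f"
  shows "fptc (\<lambda>z. g (f z))"
proof -
  from assms obtain cf Tf cg Tg where *: "computes cf f Tf" "fptb Tf" "computes cg g Tg" "polyb Tg"
    unfolding fptc_def pt_def by blast
  from computes_comp[OF *(1,3)] obtain c K where
    "computes c (\<lambda>x. g (f x)) (\<lambda>x. K + K * (sz x + sz (g (f x))) + Tf x + Tg (f x))" by blast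
  moreover have "fptb (\<lambda>x. K + K * (sz x + sz (g (f x))) + Tf x + Tg (f x))"
    by (intro fptb_intros * fptb_comp[OF *(4)] fptb_comp[OF pt_polyb_sz[OF assms(1)]] fptc_sz[OF assms(2)])
  ultimately show ?thesis unfolding fptc_def by blast
qed

text \<open>The time bound itself has to be computable, since it becomes the factor that depends on
  the parameter.\<close>

lemma fptc_param:
  assumes "computes c f T" "ct T"
  shows "fptc (\<lambda>z. f (snd z))"
proof -
  have "pt (\<lambda>z :: tree \<times> nat. snd z)" by (intro pt_intros)
  then obtain cs Ts where *: "computes cs (\<lambda>z :: tree \<times> nat. snd z) Ts" "polyb Ts"
    unfolding pt_def by blast
  from computes_comp[OF *(1) assms(1)] obtain c' K where
    "computes c' (\<lambda>z :: tree \<times> nat. f (snd z)) (\<lambda>z. K + K * (sz z + sz (f (snd z))) + Ts z + T (snd z))" by blast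
  moreover have "fptb (\<lambda>z. K + K * (sz z + sz (f (snd z))) + Ts z + T (snd z))"
  proof -
    have T: "fptb (\<lambda>z. T (snd z))" by (rule fptb_ct[OF assms(2)])
    have "fptb (\<lambda>z. (2 * snd z + 1) + T (snd z))"
      by (intro fptb_add T fptb_ct[of "\<lambda>k. 2 * k + 1"] ct_intros)
    then have S: "fptb (\<lambda>z. sz (f (snd z)))"
      by (rule fptb_mono) (use computes_size[OF assms(1)] in simp)
    show ?thesis by (intro fptb_intros T S polyb_fptb[OF *(2)])
  qed
  ultimately show ?thesis unfolding fptc_def by blast
qed

text \<open>The second program is run on an input of fixed-parameter size with parameter at most
  \<open>h (snd z)\<close>; a monotone majorant of its factor yields a bound in the original
  parameter.\<close>

lemma fptc_comp:
  assumes f: "fptc f" and g: "fptc g" and h: "ct h" "\<And>z. snd (f z) \<le> h (snd z)"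
  shows "fptc (\<lambda>z. g (f z))"
proof -
  from f g obtain cf Tf cg Tg where *: "computes cf f Tf" "fptb Tf" "computes cg g Tg" "fptb Tg"
    unfolding fptc_def by blast
  from computes_comp[OF *(1,3)] obtain c K where
    c: "computes c (\<lambda>x. g (f x)) (\<lambda>x. K + K * (sz x + sz (g (f x))) + Tf x + Tg (f x))" by blast
  from *(4) obtain F e where F: "ct F" "\<And>z. Tg z \<le> F (snd z) * sz (fst z) ^ e" unfolding fptb_def by blast
  from ct_mono[OF F(1)] obtain G where G: "ct G" "mono G" "\<And>n. F n \<le> G n" by blast
  have "fptb (\<lambda>z. G (h (snd z)) * sz (f z) ^ e)"
    by (intro fptb_intros fptb_ct[of "\<lambda>k. G (h k)"] ct_comp[OF G(1)] h(1) fptc_sz[OF f])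
  then have Tg: "fptb (\<lambda>z. Tg (f z))"
  proof (rule fptb_mono)
    fix z
    have "F (snd (f z)) \<le> G (h (snd z))" using G(3) monoD[OF G(2) h(2)] order_trans by blast
    moreover have "sz (fst (f z)) ^ e \<le> sz (f z) ^ e" by (rule power_mono) (simp_all add: sz_prod[of "f z"])
    ultimately have "F (snd (f z)) * sz (fst (f z)) ^ e \<le> G (h (snd z)) * sz (f z) ^ e" by (rule mult_le_mono)
    then show "Tg (f z) \<le> G (h (snd z)) * sz (f z) ^ e" using F(2)[of "f z"] by linarith
  qed
  have "fptb (\<lambda>z. sz (f z) + Tg (f z))" by (intro fptb_intros Tg fptc_sz[OF f])
  then have "fptb (\<lambda>z. sz (g (f z)))" by (rule fptb_mono) (rule computes_size[OF *(3)])
  then have "fptb (\<lambda>x. K + K * (sz x + sz (g (f x))) + Tf x + Tg (f x))" by (intro fptb_intros * Tg)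
  with c show ?thesis unfolding fptc_def by blast
qed

text \<open>The outputs of the program are collected into a function \<open>R\<close>, so that
  reductions can be built and composed in the calculus of \<open>fptc\<close>.\<close>

lemma fpt_reducible_iff:
  "fpt_reducible A B \<longleftrightarrow> (\<exists>R h. fptc R \<and> ct h \<and> (\<forall>z. snd (R z) \<le> h (snd z) \<and> (z \<in> A \<longleftrightarrow> R z \<in> B)))"
proof
  assume "fpt_reducible A B"
  then obtain c f g d where *: "ct f" "ct g" and
    red: "\<And>x k. \<exists>y l t. runs c (Br x (enc_nat k)) (Br y (enc_nat l)) t \<and>
           t \<le> f k * tsize x ^ d \<and> l \<le> g k \<and> ((x, k) \<in> A \<longleftrightarrow> (y, l) \<in> B)"
    unfolding fpt_reducible_def computable_iff_ct by blast
  have "\<exists>y. (\<exists>t. runs c (enc z) (enc y) t \<and> t \<le> f (snd z) * sz (fst z) ^ d) \<and> snd y \<le> g (snd z) \<and> (z \<in> A \<longleftrightarrow> y \<in> B)"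
    for z :: "tree \<times> nat"
    using red[of "fst z" "snd z"] by (auto simp: enc_prod_def enc_tree_def enc_nat_def sz_def)
  then obtain R where R: "\<And>z. (\<exists>t. runs c (enc z) (enc (R z)) t \<and> t \<le> f (snd z) * sz (fst z) ^ d)"
    "\<And>z. snd (R z) \<le> g (snd z) \<and> (z \<in> A \<longleftrightarrow> R z \<in> B)" by metis
  have "computes c R (\<lambda>z. f (snd z) * sz (fst z) ^ d)" unfolding computes_def using R(1) by blast
  moreover have "fptb (\<lambda>z. f (snd z) * sz (fst z) ^ d)" unfolding fptb_def using *(1) by blast
  ultimately show "\<exists>R h. fptc R \<and> ct h \<and> (\<forall>z. snd (R z) \<le> h (snd z) \<and> (z \<in> A \<longleftrightarrow> R z \<in> B))"
    unfolding fptc_def using *(2) R(2) by blast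
next
  assume "\<exists>R h. fptc R \<and> ct h \<and> (\<forall>z. snd (R z) \<le> h (snd z) \<and> (z \<in> A \<longleftrightarrow> R z \<in> B))"
  then obtain R h c T f d where *: "ct h" "\<And>z. snd (R z) \<le> h (snd z)" "\<And>z. z \<in> A \<longleftrightarrow> R z \<in> B"
    "computes c R T" "ct f" "\<And>z. T z \<le> f (snd z) * sz (fst z) ^ d"
    unfolding fptc_def fptb_def by blast
  have "\<exists>y l t. runs c (Br x (enc_nat k)) (Br y (enc_nat l)) t \<and>
           t \<le> f k * tsize x ^ d \<and> l \<le> h k \<and> ((x, k) \<in> A \<longleftrightarrow> (y, l) \<in> B)" for x k
  proof -
    from *(4) obtain t where t: "t \<le> T (x, k)" "runs c (enc (x, k)) (enc (R (x, k))) t"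
      unfolding computes_def by blast
    have "t \<le> f k * tsize x ^ d" using t(1) *(6)[of "(x, k)"] by (simp add: sz_def enc_tree_def)
    moreover have "runs c (Br x (enc_nat k)) (Br (fst (R (x, k))) (enc_nat (snd (R (x, k))))) t"
      using t(2) by (simp add: enc_prod_def enc_tree_def enc_nat_def)
    moreover have "snd (R (x, k)) \<le> h k" using *(2)[of "(x, k)"] by simp
    moreover have "(x, k) \<in> A \<longleftrightarrow> (fst (R (x, k)), snd (R (x, k))) \<in> B" using *(3)[of "(x, k)"] by simp
    ultimately show ?thesis by blast
  qed
  then show "fpt_reducible A B"
    unfolding fpt_reducible_def computable_iff_ct using *(1,5) by blast
qed

lemma fpt_reducible_trans:
  assumes "fpt_reducible A B" "fpt_reducible B C"
  shows "fpt_reducible A C"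
proof -
  from assms(1) obtain R h where R: "fptc R" "ct h" "\<And>z. snd (R z) \<le> h (snd z)" "\<And>z. z \<in> A \<longleftrightarrow> R z \<in> B"
    unfolding fpt_reducible_iff by blast
  from assms(2) obtain S i where S: "fptc S" "ct i" "\<And>z. snd (S z) \<le> i (snd z)" "\<And>z. z \<in> B \<longleftrightarrow> S z \<in> C"
    unfolding fpt_reducible_iff by blast
  from ct_mono[OF S(2)] obtain j where j: "ct j" "mono j" "\<And>n. i n \<le> j n" by blast
  have "fptc (\<lambda>z. S (R z))" by (rule fptc_comp[OF R(1) S(1) R(2,3)])
  moreover have "ct (\<lambda>k. j (h k))" by (rule ct_comp[OF j(1) R(2)])
  moreover have "snd (S (R z)) \<le> j (h (snd z))" for z
    using S(3)[of "R z"] j(3)[of "snd (R z)"] monoD[OF j(2) R(3)[of z]] by linarith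
  moreover have "z \<in> A \<longleftrightarrow> S (R z) \<in> C" for z using R(4) S(4) by blast
  ultimately show ?thesis
    unfolding fpt_reducible_iff by (intro exI[of _ "\<lambda>z. S (R z)"] exI[of _ "\<lambda>k. j (h k)"]) blast
qed

section \<open>The reduction\<close>

definition alphabet :: "nat \<Rightarrow> nat \<Rightarrow> (nat \<times> nat) list" where
  "alphabet w k = concat (map (\<lambda>a. map (\<lambda>i. (a, i)) [0..<Suc k]) [0..<w])"

definition advices :: "nat \<Rightarrow> nat \<Rightarrow> (nat \<times> nat) list list" where
  "advices w k = tuples (Suc k) (alphabet w k)"

lemma set_advices: "set (advices w k) = {l. length l = Suc k \<and> set l \<subseteq> {..<w} \<times> {..k}}"
proof -
  have "set (alphabet w k) = {..<w} \<times> {..k}" by (auto simp: alphabet_def simp del: upt_Suc)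
  then show ?thesis by (simp add: advices_def set_tuples del: tuples.simps)
qed

lemma pt_alphabet [pt_intros]: "pt f \<Longrightarrow> pt (\<lambda>x. alphabet w (f x))"
  by (rule pt_comp[of "alphabet w"]) (unfold alphabet_def, intro pt_intros)

section \<open>Size and running time of the list of search branches\<close>

lemma sz_map_Cons: "sz (map (\<lambda>l. x # l) ls) \<le> (2 + sz x) * sz ls"
  by (induction ls) (auto simp: algebra_simps)

lemma sz_tuples_Suc: "sz (tuples (Suc n) xs) \<le> 2 * sz xs * sz (tuples n xs)"
proof -
  have "sz (concat (map (\<lambda>x. map (\<lambda>l. x # l) ls) ys)) \<le> 2 * sz ys * sz ls"
    for ls and ys :: "'a list"
  proof (induction ys)
    case Nil
    then show ?case using sz_ge_1[of ls] by simp
  next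
    case (Cons y ys)
    have "sz (concat (map (\<lambda>x. map (\<lambda>l. x # l) ls) (y # ys))) \<le> 
      sz (map (\<lambda>l. y # l) ls) + sz (concat (map (\<lambda>x. map (\<lambda>l. x # l) ls) ys))"
      using sz_append[of "map (\<lambda>l. y # l) ls" "concat (map (\<lambda>x. map (\<lambda>l. x # l) ls) ys)"]
      by (simp only: list.map concat.simps)
    also have "\<dots> \<le> (2 + sz y) * sz ls + 2 * sz ys * sz ls"
      by (intro add_mono sz_map_Cons Cons.IH)
    also have "\<dots> = (2 + sz y + 2 * sz ys) * sz ls" by (simp add: algebra_simps)
    also have "\<dots> \<le> 2 * sz (y # ys) * sz ls" by (intro mult_le_mono1) simp
    finally show ?case .
  qed
  then show ?thesis by simp
qed

text \<open>3 is the size of \<open>[[]]\<close>, and each further component multiplies the size by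
  at most \<open>2 * sz xs\<close>.\<close>

lemma sz_tuples: "sz (tuples n xs) \<le> 3 * (2 * sz xs) ^ n"
proof (induction n)
  case (Suc n)
  have "sz (tuples (Suc n) xs) \<le> 2 * sz xs * sz (tuples n xs)" by (rule sz_tuples_Suc)
  also have "\<dots> \<le> 2 * sz xs * (3 * (2 * sz xs) ^ n)" by (intro mult_le_mono2 Suc)
  finally show ?case by (simp add: mult_ac del: tuples.simps)
qed simp

text \<open>The length of the tuples varies with \<open>k\<close>, so \<open>pt_tuples\<close> gives
  nothing, and the accumulator is multiplied in every step, which excludes \<open>pt_foldl\<close>.
  Instead the recurrence \<open>fold_time\<close> is estimated by an explicit expression in
  \<open>k\<close> whose computability is evident.\<close>

lemma advices_fpt: "\<exists>c F. computes c (advices w) F \<and> ct F"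
proof -
  let ?F = "\<lambda>(al :: (nat \<times> nat) list) ls (u::unit). concat (map (\<lambda>x. map (\<lambda>l. x # l) ls) al)"
  have fold: "foldl (?F al) [[]] (replicate n ()) = tuples n al" for al n
  proof (induction n)
    case (Suc n)
    have "replicate (Suc n) () = replicate n () @ [()]" by (simp add: replicate_append_same)
    then show ?case using Suc by simp
  qed simp
  have "pt (\<lambda>z. ?F (fst z) (fst (snd z)) (snd (snd z)))" by (intro pt_intros)
  then obtain cF T where T: "computes cF (\<lambda>(x, a, y). ?F x a y) T" "polyb T"
    unfolding pt_def case_prod_beta by blast
  from computes_foldl[OF T(1)] obtain c1 K where c1: "computes c1 (\<lambda>(x, l, a). foldl (?F x) a l)
    (\<lambda>(x, l, a). K * sz (x, l, a) + fold_time K T ?F x a l)" by blast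
  let ?g = "\<lambda>k. (alphabet w k, replicate (Suc k) (), [[]] :: (nat \<times> nat) list list)"
  have "pt ?g" by (intro pt_intros)
  then obtain c0 T0 where c0: "computes c0 ?g T0" "polyb T0" unfolding pt_def by blast
  from computes_comp[OF c0(1) c1] obtain c K' where
    "computes c (\<lambda>k. foldl (?F (alphabet w k)) [[]] (replicate (Suc k) ()))
      (\<lambda>k. K' + K' * (sz k + sz (foldl (?F (alphabet w k)) [[]] (replicate (Suc k) ()))) + T0 k +
         (K * sz (?g k) + fold_time K T ?F (alphabet w k) [[]] (replicate (Suc k) ())))"
    unfolding case_prod_conv by blast
  then have c: "computes c (advices w) (\<lambda>k. K' + K' * (sz k + sz (advices w k)) + T0 k +
         (K * sz (?g k) + fold_time K T ?F (alphabet w k) [[]] (replicate (Suc k) ())))"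
    unfolding fold advices_def[abs_def] .
  from T(2) obtain KT eT where KT: "\<And>z. T z \<le> KT * sz z ^ eT" unfolding polyb_def by blast
  from c0(2) obtain K0 e0 where K0: "\<And>k. T0 k \<le> K0 * sz k ^ e0" unfolding polyb_def by blast
  have "polyb (\<lambda>k. sz (alphabet w k))" by (intro pt_polyb_sz pt_intros)
  then obtain Ks es where Ks: "\<And>k. sz (alphabet w k) \<le> Ks * sz k ^ es" unfolding polyb_def by blast
  define s where "s k = Ks * (2 * k + 1) ^ es" for k
  \<comment> \<open>Since \<open>1 \<le> s k\<close>, the value for \<open>k + 1\<close> components
    dominates those for fewer, so \<open>M k\<close> bounds every accumulator of the fold.\<close>
  define M where "M k = 3 * (2 * s k) ^ (k + 1)" for k
  have s: "sz (alphabet w k) \<le> s k" for k using Ks[of k] by (simp add: s_def)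
  have s1: "1 \<le> s k" for k using s[of k] sz_ge_1[of "alphabet w k"] by linarith
  have M: "sz (tuples i (alphabet w k)) \<le> M k" if "i \<le> k + 1" for i k
  proof -
    have "sz (tuples i (alphabet w k)) \<le> 3 * (2 * sz (alphabet w k)) ^ i" by (rule sz_tuples)
    also have "\<dots> \<le> 3 * (2 * s k) ^ i" by (intro mult_le_mono2 power_mono s) simp
    also have "\<dots> \<le> M k" unfolding M_def using that s1[of k] by (intro mult_le_mono2 power_increasing) auto
    finally show ?thesis .
  qed
  have L: "sz (replicate (Suc k) ()) = 2 * k + 3" for k
    by (induction k) auto
  let ?B = "\<lambda>k. KT * (s k + M k + 3) ^ eT"
  have time: "fold_time K T ?F (alphabet w k) [[]] (replicate (Suc k) ())
     \<le> 2 + (k + 1) * (K + K * (s k + 2 * M k + (2 * k + 3)) + ?B k)" for k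
  proof -
    have "fold_time K T ?F (alphabet w k) [[]] (replicate (Suc k) ())
     \<le> 2 + length (replicate (Suc k) ()) * (K + K * (sz (alphabet w k) + 2 * M k + (2 * k + 3)) + ?B k)"
    proof (rule fold_time_le)
      show "sz (foldl (?F (alphabet w k)) [[]] (take i (replicate (Suc k) ()))) \<le> M k"
        if "i \<le> length (replicate (Suc k) ())" for i
      proof -
        have "take i (replicate (Suc k) ()) = replicate i ()" using that by (simp del: replicate_Suc)
        then have eq: "foldl (?F (alphabet w k)) [[]] (take i (replicate (Suc k) ())) = tuples i (alphabet w k)"
          by (simp only: fold)
        show ?thesis unfolding eq by (rule M) (use that in simp)
      qed
      show "T (alphabet w k, foldl (?F (alphabet w k)) [[]] (take i (replicate (Suc k) ())), replicate (Suc k) () ! i) \<le> ?B k"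
        if "i < length (replicate (Suc k) ())" for i
      proof -
        have "take i (replicate (Suc k) ()) = replicate i ()" using that by (simp del: replicate_Suc)
        then have eq: "foldl (?F (alphabet w k)) [[]] (take i (replicate (Suc k) ())) = tuples i (alphabet w k)"
          by (simp only: fold)
        have "T (alphabet w k, tuples i (alphabet w k), replicate (Suc k) () ! i)
          \<le> KT * sz (alphabet w k, tuples i (alphabet w k), replicate (Suc k) () ! i) ^ eT" by (rule KT)
        also have "\<dots> \<le> ?B k"
          using M[of i k] s[of k] that
          by (intro mult_le_mono2 power_mono) (simp_all del: replicate_Suc tuples.simps)
        finally show ?thesis unfolding eq .
      qed
    qed (simp only: L)
    also have "\<dots> \<le> 2 + (k + 1) * (K + K * (s k + 2 * M k + (2 * k + 3)) + ?B k)"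
      using s[of k] by (intro add_mono mult_le_mono order_refl) simp_all
    finally show ?thesis .
  qed
  let ?T = "\<lambda>k. K' + K' * ((2 * k + 1) + M k) + K0 * (2 * k + 1) ^ e0 + (K * (s k + (2 * k + 3) + 5) +
    (2 + (k + 1) * (K + K * (s k + 2 * M k + (2 * k + 3)) + ?B k)))"
  have "computes c (advices w) ?T"
  proof (rule computes_mono[OF c])
    fix k
    have "sz (?g k) \<le> s k + (2 * k + 3) + 5" using s[of k] by (simp add: L del: replicate_Suc)
    moreover have "sz (advices w k) \<le> M k" unfolding advices_def by (rule M) simp
    moreover have "T0 k \<le> K0 * (2 * k + 1) ^ e0" using K0[of k] by simp
    ultimately show "K' + K' * (sz k + sz (advices w k)) + T0 k +
         (K * sz (?g k) + fold_time K T ?F (alphabet w k) [[]] (replicate (Suc k) ())) \<le> ?T k"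
      using time[of k] by (intro add_mono mult_le_mono order_refl) simp_all
  qed
  moreover have "ct ?T" unfolding M_def s_def by (intro ct_intros)
  ultimately show ?thesis by blast
qed

definition akc_instance :: "nat \<Rightarrow> (nat \<times> nat) list \<Rightarrow> nat \<Rightarrow> ((nat \<times> (nat \<times> nat) list) \<times> nat list) \<times> nat" where
  "akc_instance m ed q =
    (((akc_order m (akc_degree q) ed, akc_edges m (akc_degree q) (akc_slots q) ed),
      [akc_budget q, akc_degree q, akc_target q]),
     akc_budget q + akc_degree q + akc_target q)"

definition csp_of :: "nat \<Rightarrow> tree \<Rightarrow> csp" where
  "csp_of d t = (choice_list d t, input_list t, clause_list d t)"

definition nodes_of :: "nat \<Rightarrow> tree \<times> nat \<Rightarrow> (nat \<times> nat) list list \<Rightarrow> (nat list \<times> assignment) list" where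
  "nodes_of d z advs = nodes (2 ^ d + 1) (csp_of d (fst z)) (snd z) advs"

text \<open>The search branches are an argument and not computed inside, which makes this map
  polynomial in the size of its whole input.\<close>

definition reduction :: "nat \<Rightarrow> (tree \<times> nat) \<times> (nat \<times> nat) list list \<Rightarrow> tree \<times> nat" where
  "reduction d y =
    (enc (fst (akc_instance (length (nodes_of d (fst y) (snd y)))
       (clique_pairs (nodes_of d (fst y) (snd y))) ((snd (fst y) + 1) ^ (2 ^ d + 1)))),
     snd (akc_instance (length (nodes_of d (fst y) (snd y)))
       (clique_pairs (nodes_of d (fst y) (snd y))) ((snd (fst y) + 1) ^ (2 ^ d + 1))))"

section \<open>Polynomial-time computability and correctness of the reduction\<close>

lemma pt_gvert [pt_intros]: "pt f \<Longrightarrow> pt g \<Longrightarrow> pt h \<Longrightarrow> pt i \<Longrightarrow> pt (\<lambda>x. gvert (f x) (g x) (h x) (i x))"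
  unfolding gvert_def by (intro pt_intros)

lemma pt_akc_nums [pt_intros]:
  "pt f \<Longrightarrow> pt (\<lambda>x. akc_budget (f x))"
  "pt f \<Longrightarrow> pt (\<lambda>x. akc_slots (f x))"
  "pt f \<Longrightarrow> pt (\<lambda>x. akc_degree (f x))"
  "pt f \<Longrightarrow> pt (\<lambda>x. akc_target (f x))"
  unfolding akc_target_def akc_degree_def akc_slots_def akc_budget_def by (intro pt_intros; assumption)+

lemma pt_akc_order [pt_intros]: "pt f \<Longrightarrow> pt g \<Longrightarrow> pt h \<Longrightarrow> pt (\<lambda>x. akc_order (f x) (g x) (h x))"
  unfolding akc_order_def by (intro pt_intros)

lemma pt_akc_edges [pt_intros]:
  "pt f \<Longrightarrow> pt g \<Longrightarrow> pt h \<Longrightarrow> pt i \<Longrightarrow> pt (\<lambda>x. akc_edges (f x) (g x) (h x) (i x))"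
  by (rule pt_comp4[of akc_edges]) (unfold akc_edges_def attach_def, intro pt_intros)

lemma pt_akc_instance [pt_intros]: "pt f \<Longrightarrow> pt g \<Longrightarrow> pt h \<Longrightarrow> pt (\<lambda>x. akc_instance (f x) (g x) (h x))"
  by (rule pt_comp3[of akc_instance]) (unfold akc_instance_def, intro pt_intros)

lemma pt_nodes_of [pt_intros]: "pt f \<Longrightarrow> pt g \<Longrightarrow> pt (\<lambda>x. nodes_of d (f x) (g x))"
  by (rule pt_comp2[of "nodes_of d"]) (unfold nodes_of_def csp_of_def, intro pt_intros)

lemma pt_reduction: "pt (reduction d)"
  unfolding reduction_def[abs_def] by (intro pt_intros)

lemma enc_akc_eq: "enc_akc n es b k p = enc ((n, es), [b, k, p])"
proof -
  have "enc_edge = enc" by (rule ext) (simp add: enc_edge_def enc_prod_def enc_nat_def)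
  moreover have "enc_nat = enc" by (rule ext) (simp add: enc_nat_def)
  ultimately show ?thesis by (simp add: enc_akc_def enc_list_def)
qed

lemma pAKC_iff: "(enc_akc n es b k p, l) \<in> pAKC \<longleftrightarrow> l = b + k + p \<and> k \<ge> 3 \<and>
  simple_graph {..<n} (edges_of es) \<and> anchored_core {..<n} (edges_of es) b k p"
  by (auto simp: pAKC_def enc_akc_inject)

lemma akc_instance_iff:
  assumes "distinct ed" "set ed \<subseteq> {..<m} \<times> {..<m}" "1 \<le> q"
  shows "(enc (fst (akc_instance m ed q)), snd (akc_instance m ed q)) \<in> pAKC \<longleftrightarrow>
    (\<exists>R\<subseteq>{..<m}. card R = q \<and> R \<times> R \<subseteq> set ed)"
proof -
  interpret gadgets m q ed by standard (rule assms)+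
  show ?thesis
    unfolding akc_instance_def fst_conv snd_conv enc_akc_eq[symmetric] pAKC_iff
    using simple k_ge_3 clique_imp_core core_imp_clique by blast
qed

lemma reduction_correct: "z \<in> WCS 1 d \<longleftrightarrow> reduction d (z, advices (2 ^ d) (snd z)) \<in> pAKC"
proof -
  obtain t k where z: "z = (t, k)" by (cases z)
  let ?V0 = "choice_list d t" and ?V1 = "input_list t" and ?cls = "clause_list d t"
  let ?D = "2 ^ d + 1 :: nat"
  define ns where "ns = nodes ?D (?V0, ?V1, ?cls) k (advices (2 ^ d) k)"
  have len: "length (fst c) \<le> ?D" "length (snd c) \<le> 2 ^ d" if "c \<in> set ?cls" for c
    using clause_list_bound[OF that] by simp_all
  have "z \<in> WCS 1 d \<longleftrightarrow> (\<exists>f. csp_solution ?V0 ?V1 ?cls k f)"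
    unfolding z by (rule WCS_iff_csp)
  also have "\<dots> \<longleftrightarrow> (\<exists>R\<subseteq>{..<length ns}. card R = (k + 1) ^ ?D \<and> R \<times> R \<subseteq> set (clique_pairs ns))"
  proof
    assume "\<exists>f. csp_solution ?V0 ?V1 ?cls k f"
    then obtain f where "csp_solution ?V0 ?V1 ?cls k f" by blast
    from csp_imp_clique[OF this _ len(2) _ set_advices ns_def]
    show "\<exists>R\<subseteq>{..<length ns}. card R = (k + 1) ^ ?D \<and> R \<times> R \<subseteq> set (clique_pairs ns)" by simp
  next
    assume "\<exists>R\<subseteq>{..<length ns}. card R = (k + 1) ^ ?D \<and> R \<times> R \<subseteq> set (clique_pairs ns)"
    then obtain R where "R \<subseteq> {..<length ns}" "card R = (k + 1) ^ ?D" "R \<times> R \<subseteq> set (clique_pairs ns)" by blast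
    from clique_imp_csp[OF this _ len(1) ns_def]
    show "\<exists>f. csp_solution ?V0 ?V1 ?cls k f" by simp
  qed
  also have "\<dots> \<longleftrightarrow> (enc (fst (akc_instance (length ns) (clique_pairs ns) ((k + 1) ^ ?D))),
      snd (akc_instance (length ns) (clique_pairs ns) ((k + 1) ^ ?D))) \<in> pAKC"
  proof (rule akc_instance_iff[symmetric])
    show "set (clique_pairs ns) \<subseteq> {..<length ns} \<times> {..<length ns}"
      unfolding set_clique_pairs by blast
    show "1 \<le> (k + 1) ^ ?D" by (rule one_le_power) simp
  qed (rule distinct_clique_pairs)
  also have "\<dots> \<longleftrightarrow> reduction d (z, advices (2 ^ d) (snd z)) \<in> pAKC"
    unfolding reduction_def nodes_of_def csp_of_def z fst_conv snd_conv ns_def ..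
  finally show ?thesis .
qed

text \<open>A polynomial-time map is applied to the instance paired with a list that depends on the
  parameter alone. As \<open>d\<close> is constant, \<open>?q\<close>, and with it the new
  parameter, is a polynomial in the old one.\<close>

lemma WCS_reducible: "fpt_reducible (WCS 1 d) pAKC"
proof -
  let ?R = "\<lambda>z. reduction d (z, advices (2 ^ d) (snd z))"
  let ?q = "\<lambda>k. (k + 1) ^ (2 ^ d + 1) :: nat"
  let ?h = "\<lambda>k. akc_budget (?q k) + akc_degree (?q k) + akc_target (?q k)"
  obtain c F where "computes c (advices (2 ^ d)) F" "ct F" using advices_fpt by blast
  then have "fptc (\<lambda>z. advices (2 ^ d) (snd z))" by (rule fptc_param)
  from fptc_Pair[OF pt_imp_fptc[OF pt_id] this] have "fptc (\<lambda>z. (z, advices (2 ^ d) (snd z)))" .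
  then have "fptc ?R" by (rule fptc_pt_comp[OF pt_reduction])
  moreover have "ct ?h" by (intro pt_imp_ct pt_intros)
  moreover have "snd (?R z) \<le> ?h (snd z)" for z
    by (simp only: reduction_def akc_instance_def fst_conv snd_conv order_refl)
  moreover have "z \<in> WCS 1 d \<longleftrightarrow> ?R z \<in> pAKC" for z by (rule reduction_correct)
  ultimately show ?thesis unfolding fpt_reducible_iff by (intro exI[of _ ?R] exI[of _ ?h]) blast
qed

theorem theorem1:
  shows "fpt_hard (W 1) pAKC"
  \<comment> \<open>A member of \<open>W 1\<close> comes with a reduction to \<open>WCS 1 d\<close>
    for some \<open>d\<close> of its own; transitivity does the rest.\<close>
  unfolding fpt_hard_def W_def using fpt_reducible_trans WCS_reducible by blast

end
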